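(* Let $\sigma>0$ and let $P=Q_{\theta^\ast}$ for some $\theta^\ast$ in the interior of $\Theta$. Suppose $P$ has finite second moment and there is a partition $\mathbb{R}^{d} = \bigcup_{j=1}^{\infty} I_{j}$ into bounded convex sets with nonempty interior such that $\sup_{j}\mathrm{diam}(I_{j})<\infty$, $M_{j}:=\sup_{x\in I_{j}} \|x\|\geq 1$ for all $j$, and $\sum_{j=1}^{\infty} M_{j}P(I_{j})^{1/2} < \infty$. In addition, suppose that: (i) the map $\theta \mapsto Q_{\theta}$ is continuous relative to the weak topology; (ii) $P \ne Q_{\theta}$ for any $\theta \ne \theta^{\ast}$; (iii) there exists a vector-valued functional $D^{\sigma}=(D_1^\sigma,\dots,D_{d_0}^\sigma)\in (\ell^\infty(\mathsf{Lip}_{1,0}))^{d_0}$ such that $\big\|Q^{\sigma}_\theta-Q^{\sigma}_{\theta^\ast}-\langle\theta-\theta^\ast,D^{\sigma}\rangle\big\|_{\mathsf{Lip}_{1,0}}=o(\|\theta-\theta^\ast\|)$ as $\theta \to \theta^\ast$, where $\langle t,D^{\sigma} \rangle:=\sum_{i=1}^{d_0} t_iD_i^{\sigma}$ for $t\in\mathbb{R}^{d_0}$; (iv) the derivative $D^{\sigma}$ is nonsingular in the sense that $\langle t,D^{\sigma} \rangle\in\ell^\infty(\mathsf{Lip}_{1,0})$ is not the zero functional for all $0\neq t\in\mathbb{R}^{d_0}$; (v) $m = m_n \gg n$ (i.e. $n/m_n\to0$); (vi) $\sup_{\theta\in\Theta} \int \|x\|^q\,\mathrm{d} Q_\theta(x)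 < \infty$ for some $q > 2(d+1)$. Then $$\sqrt{n}\inf_{\theta\in\Theta} \mathbb{E} \big [ \mathsf{W}_1^{\sigma}(P_n,Q_{\theta, m_n}) \, \big| \, X_{1:n} \big ] \stackrel{d}{\to} \inf_{t \in \mathbb{R}^{d_0}}\big\|G_P^{\sigma}-\langle t,D^{\sigma}\rangle\big\|_{\mathsf{Lip}_{1,0}} .$$
   Context: $\mathcal{N}_\sigma=\mathcal N(0,\sigma^2 \mathrm{I}_d)$ with density $\varphi_\sigma$, $\mathsf{W}_1$ is the 1-Wasserstein distance on $\mathbb{R}^d$ (Euclidean cost) and $\mathsf{W}_1^{\sigma}(P,Q):=\mathsf{W}_1(P\ast\mathcal{N}_\sigma,Q\ast\mathcal{N}_\sigma)$. $\Theta\subset\mathbb{R}^{d_0}$ is compact with nonempty interior; $Q_\theta$, $\theta\in\Theta$, are Borel probability measures on $\mathbb{R}^d$ with finite first moment. $X_{1:n}=(X_1,\dots,X_n)$ are i.i.d. from $P$, $P_n=n^{-1}\sum_{i=1}^n\delta_{X_i}$. $Q_{\theta,m}=m^{-1}\sum_{i=1}^m\delta_{Y_i}$ with $Y_1,\dots,Y_m$ i.i.d. from $Q_\theta$, independent of $X_{1:n}$; the conditional expectation given $X_{1:n}$ is the integral over $Y_1,\dots,Y_m$. $\mathsf{Lip}_{1,0}$ is the set of $1$-Lipschitz $f:\mathbb{R}^d\to\mathbb{R}$ with $f(0)=0$; $\ell^\infty(\mathsf{Lip}_{1,0})$ carries the norm $\|z\|_{\mathsf{Lip}_{1,0}}=\sup_{f\in\mathsf{Lip}_{1,0}}|z(f)|$.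 For $Q$ with finite first moment, $Q^{\sigma}\in\ell^\infty(\mathsf{Lip}_{1,0})$ is $Q^{\sigma}(f):=\int f\ast\varphi_\sigma\,\mathrm{d}Q$, and $Q_\theta^\sigma:=(Q_\theta)^\sigma$. $G_P^{\sigma}$ is the centered Gaussian process on $\mathsf{Lip}_{1,0}$, tight in $\ell^\infty(\mathsf{Lip}_{1,0})$, with covariance $\mathrm{Cov}_P(f\ast\varphi_\sigma,g\ast\varphi_\sigma)$ (a tight version exists under the stated condition on $P$). *)

theory Defs
  imports "HOL-Probability.Probability" "HOL-Library.Landau_Symbols"
begin

subsection \<open>The space of bounded functionals on normalised 1-Lipschitz functions\<close>

typedef (overloaded) 'd lip10 =
  "{f :: real ^ 'd::finite \<Rightarrow> real. 1-lipschitz_on UNIV f \<and> f 0 = 0}"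
  morphisms lip_fun Abs_lip10
  by (rule exI[of _ "\<lambda>_. 0"]) (simp add: lipschitz_on_def)

text \<open>
  The discrete topology makes every function on \<^typ>\<open>'d lip10\<close> continuous, so that
  \<^typ>\<open>'d lip10 \<Rightarrow>\<^sub>C real\<close> consists of all bounded functions, with the supremum norm.
\<close>

instantiation lip10 :: (finite) discrete_topology
begin

definition open_lip10 :: "'a lip10 set \<Rightarrow> bool" where
  "open_lip10 U \<longleftrightarrow> True"

instance
  by standard (simp_all add: open_lip10_def)

end

type_synonym 'd linf_lip10 = "'d lip10 \<Rightarrow>\<^sub>C real"

definition pairing :: "real ^ 'k \<Rightarrow> ('d::finite linf_lip10) ^ 'k \<Rightarrow> 'd linf_lip10" where
  "pairing t D = (\<Sum>i\<in>UNIV. (t $ i) *\<^sub>R (D $ i))"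


subsection \<open>Gaussian smoothing\<close>

definition gauss_density :: "real \<Rightarrow> real ^ 'd \<Rightarrow> real" where
  "gauss_density \<sigma> x =
     (2 * pi * \<sigma>\<^sup>2) powr (- real CARD('d) / 2) * exp (- (norm x)\<^sup>2 / (2 * \<sigma>\<^sup>2))"

definition gauss_measure :: "real \<Rightarrow> (real ^ 'd) measure" where
  "gauss_measure \<sigma> = density lborel (\<lambda>x. ennreal (gauss_density \<sigma> x))"

definition gauss_smooth :: "real \<Rightarrow> (real ^ 'd \<Rightarrow> real) \<Rightarrow> real ^ 'd \<Rightarrow> real" where
  "gauss_smooth \<sigma> f x = (\<integral>y. f (x - y) * gauss_density \<sigma> y \<partial>lborel)"

text \<open>
  \<^term>\<open>Bcontfun\<close> is unspecified on unbounded functions; see the lemma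
  \<open>smoothed_functional_apply\<close> below for measures with finite first moment.
\<close>

definition smoothed_functional :: "real \<Rightarrow> (real ^ 'd::finite) measure \<Rightarrow> 'd linf_lip10" where
  "smoothed_functional \<sigma> Q = Bcontfun (\<lambda>f. \<integral>x. gauss_smooth \<sigma> (lip_fun f) x \<partial>Q)"


subsection \<open>Wasserstein distances and empirical measures\<close>

definition couplings ::
  "'a::topological_space measure \<Rightarrow> 'a measure \<Rightarrow> ('a \<times> 'a) measure set" where
  "couplings P Q =
     {\<pi>. prob_space \<pi> \<and> sets \<pi> = sets (borel \<Otimes>\<^sub>M borel) \<and>
         distr \<pi> borel fst = P \<and> distr \<pi> borel snd = Q}"

definition wasserstein1 :: "'a::metric_space measure \<Rightarrow> 'a measure \<Rightarrow> ennreal" where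
  "wasserstein1 P Q = (INF \<pi>\<in>couplings P Q. \<integral>\<^sup>+z. ennreal (dist (fst z) (snd z)) \<partial>\<pi>)"

definition smoothed_wasserstein1 ::
  "real \<Rightarrow> (real ^ 'd) measure \<Rightarrow> (real ^ 'd) measure \<Rightarrow> ennreal" where
  "smoothed_wasserstein1 \<sigma> P Q =
     wasserstein1 (P \<star> gauss_measure \<sigma>) (Q \<star> gauss_measure \<sigma>)"

definition empirical_measure :: "nat \<Rightarrow> (nat \<Rightarrow> 'a::topological_space) \<Rightarrow> 'a measure" where
  "empirical_measure n x = distr (uniform_count_measure {..<n}) borel x"

text \<open>
  The conditional expectation of the smoothed distance between the empirical measure of a sample
  \<open>x\<close> of size \<open>n\<close> and that of \<open>m\<close> independent draws from \<open>Q\<close>, given \<open>x\<close>.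
\<close>

definition expected_smoothed_wasserstein1 ::
  "real \<Rightarrow> nat \<Rightarrow> (nat \<Rightarrow> real ^ 'd) \<Rightarrow> nat \<Rightarrow> (real ^ 'd) measure \<Rightarrow> ennreal" where
  "expected_smoothed_wasserstein1 \<sigma> n x m Q =
     (\<integral>\<^sup>+y. smoothed_wasserstein1 \<sigma> (empirical_measure n x) (empirical_measure m y)
        \<partial>(\<Pi>\<^sub>M i\<in>{..<m}. Q))"


subsection \<open>Gaussian processes and convergence in distribution\<close>

text \<open>Standard deviation \<open>s = 0\<close> is the degenerate case.\<close>

definition normal_law :: "real \<Rightarrow> real \<Rightarrow> real measure" where
  "normal_law \<mu> s =
     (if s = 0 then return borel \<mu> else density lborel (\<lambda>x. ennreal (normal_density \<mu> s x)))"

definition gaussian_process :: "'v measure \<Rightarrow> ('i \<Rightarrow> 'v \<Rightarrow> real) \<Rightarrow> bool" where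
  "gaussian_process N Z \<longleftrightarrow>
     (\<forall>i. Z i \<in> borel_measurable N) \<and>
     (\<forall>F a. finite F \<longrightarrow>
        (\<exists>\<mu> s. s \<ge> 0 \<and> distr N borel (\<lambda>\<omega>. \<Sum>i\<in>F. a i * Z i \<omega>) = normal_law \<mu> s))"

definition tight_random_element :: "'v measure \<Rightarrow> ('v \<Rightarrow> 'b::topological_space) \<Rightarrow> bool" where
  "tight_random_element N G \<longleftrightarrow>
     G \<in> N \<rightarrow>\<^sub>M borel \<and>
     (\<forall>\<epsilon>>0. \<exists>K. compact K \<and> K \<in> sets borel \<and> measure N {\<omega> \<in> space N. G \<omega> \<in> K} \<ge> 1 - \<epsilon>)"

definition covariance :: "'a measure \<Rightarrow> ('a \<Rightarrow> real) \<Rightarrow> ('a \<Rightarrow> real) \<Rightarrow> real" where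
  "covariance M u v = (\<integral>x. (u x - (\<integral>y. u y \<partial>M)) * (v x - (\<integral>y. v y \<partial>M)) \<partial>M)"

definition is_limit_process ::
  "real \<Rightarrow> (real ^ 'd::finite) measure \<Rightarrow> 'v measure \<Rightarrow> ('v \<Rightarrow> 'd linf_lip10) \<Rightarrow> bool" where
  "is_limit_process \<sigma> P N G \<longleftrightarrow>
     prob_space N \<and>
     tight_random_element N G \<and>
     gaussian_process N (\<lambda>f \<omega>. G \<omega> f) \<and>
     (\<forall>f. (\<integral>\<omega>. G \<omega> f \<partial>N) = 0) \<and>
     (\<forall>f g. covariance N (\<lambda>\<omega>. G \<omega> f) (\<lambda>\<omega>. G \<omega> g) =
            covariance P (gauss_smooth \<sigma> (lip_fun f)) (gauss_smooth \<sigma> (lip_fun g)))"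

text \<open>
  Measurability is included since \<^const>\<open>distr\<close> is only meaningful for measurable functions.
\<close>

definition converges_in_distribution ::
  "'w measure \<Rightarrow> (nat \<Rightarrow> 'w \<Rightarrow> real) \<Rightarrow> 'v measure \<Rightarrow> ('v \<Rightarrow> real) \<Rightarrow> bool" where
  "converges_in_distribution M Z N Y \<longleftrightarrow>
     (\<forall>n. Z n \<in> borel_measurable M) \<and> Y \<in> borel_measurable N \<and>
     weak_conv_m (\<lambda>n. distr M borel (Z n)) (distr N borel Y)"


subsection \<open>Well-definedness of the smoothed functional\<close>

lemma gauss_density_nonneg: "0 \<le> gauss_density \<sigma> x"
  by (simp add: gauss_density_def)

lemma borel_measurable_gauss_density[measurable]: "gauss_density \<sigma> \<in> borel_measurable borel"
  unfolding gauss_density_def by measurable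

lemma gauss_density_eq_prod:
  fixes x :: "real ^ 'd"
  assumes "\<sigma> > 0"
  shows "gauss_density \<sigma> x = (\<Prod>b\<in>Basis. normal_density 0 \<sigma> (x \<bullet> b))"
proof -
  define c where "c = 2 * pi * \<sigma>\<^sup>2"
  have c: "c > 0" using assms by (simp add: c_def)
  have "(\<Prod>b\<in>Basis. normal_density 0 \<sigma> (x \<bullet> b)) =
        (\<Prod>b\<in>(Basis :: (real ^ 'd) set). 1 / sqrt c) *
        exp (\<Sum>b\<in>Basis. - (x \<bullet> b)\<^sup>2 / (2 * \<sigma>\<^sup>2))"
    by (simp add: normal_density_def c_def exp_sum prod_dividef power_divide)
  also have "(\<Sum>b\<in>Basis. - (x \<bullet> b)\<^sup>2 / (2 * \<sigma>\<^sup>2)) = - (norm x)\<^sup>2 / (2 * \<sigma>\<^sup>2)"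
    unfolding power2_norm_eq_inner euclidean_inner[of x x]
    by (simp add: sum_divide_distrib sum_negf power2_eq_square)
  also have "(\<Prod>b\<in>(Basis :: (real ^ 'd) set). 1 / sqrt c) = (1 / sqrt c) ^ CARD('d)"
    by simp
  also have "1 / sqrt c = c powr (- 1 / 2)"
    using c by (simp add: powr_minus_divide powr_half_sqrt)
  also have "(c powr (- 1 / 2)) ^ CARD('d) = c powr (- real CARD('d) / 2)"
    using c by (simp add: powr_powr flip: powr_realpow)
  finally show ?thesis
    by (simp add: gauss_density_def c_def)
qed

lemma nn_integral_gauss_density:
  assumes "\<sigma> > 0"
  shows "(\<integral>\<^sup>+x. ennreal (gauss_density \<sigma> x) \<partial>(lborel :: (real ^ 'd) measure)) = 1"
proof -
  have *: "(\<integral>\<^sup>+x. ennreal (normal_density 0 \<sigma> x) \<partial>lborel) = 1"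
    using prob_space.emeasure_space_1[OF prob_space_normal_density[OF assms, of 0]]
    by (simp add: emeasure_density)
  show ?thesis
    by (simp add: gauss_density_eq_prod[OF assms] prod_ennreal[symmetric] normal_density_nonneg)
      (subst nn_integral_lborel_prod; simp add: normal_density_nonneg *)
qed

lemma prob_space_gauss_measure:
  assumes "\<sigma> > 0"
  shows "prob_space (gauss_measure \<sigma> :: (real ^ 'd) measure)"
  using nn_integral_gauss_density[OF assms, where 'd='d]
  by (intro prob_spaceI) (simp add: gauss_measure_def emeasure_density)

lemma norm_le_prod:
  fixes x :: "real ^ 'd"
  shows "1 + norm x \<le> (\<Prod>b\<in>Basis. 1 + \<bar>x \<bullet> b\<bar>)"
proof -
  have "1 + (\<Sum>b\<in>B. \<bar>x \<bullet> b\<bar>) \<le> (\<Prod>b\<in>B. 1 + \<bar>x \<bullet> b\<bar>)" if "finite B" for B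
    using that
  proof induction
    case (insert b B)
    have "1 \<le> (\<Prod>b\<in>B. 1 + \<bar>x \<bullet> b\<bar>)"
      by (rule prod_ge_1) simp
    then have "\<bar>x \<bullet> b\<bar> * 1 \<le> \<bar>x \<bullet> b\<bar> * (\<Prod>b\<in>B. 1 + \<bar>x \<bullet> b\<bar>)"
      by (rule mult_left_mono) simp
    with insert show ?case by (simp add: algebra_simps)
  qed simp
  from this[OF finite_Basis] norm_le_l1[of x] show ?thesis by linarith
qed

lemma integrable_gauss_density_moment:
  assumes "\<sigma> > 0"
  shows "integrable lborel (\<lambda>x :: real ^ 'd. (1 + norm x) * gauss_density \<sigma> x)"
proof (rule integrableI_bounded)
  have int: "integrable lborel (\<lambda>x. (1 + \<bar>x\<bar>) * normal_density 0 \<sigma> x)"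
    using integrable_normal_moment_abs[OF assms, of 0 1] integrable_normal_density[OF assms, of 0]
    by (simp add: algebra_simps)
  then have fin: "(\<integral>\<^sup>+x. ennreal ((1 + \<bar>x\<bar>) * normal_density 0 \<sigma> x) \<partial>lborel) < \<infinity>"
    by (simp add: integrable_iff_bounded abs_mult normal_density_nonneg)
  have "(\<integral>\<^sup>+x. ennreal (norm ((1 + norm x) * gauss_density \<sigma> x)) \<partial>(lborel :: (real ^ 'd) measure))
    \<le> (\<integral>\<^sup>+x. (\<Prod>b\<in>Basis. ennreal ((1 + \<bar>x \<bullet> b\<bar>) * normal_density 0 \<sigma> (x \<bullet> b)))
          \<partial>(lborel :: (real ^ 'd) measure))"
  proof (rule nn_integral_mono)
    fix x :: "real ^ 'd"
    have "(1 + norm x) * gauss_density \<sigma> x \<le> (\<Prod>b\<in>Basis. 1 + \<bar>x \<bullet> b\<bar>) * gauss_density \<sigma> x"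
      by (intro mult_right_mono norm_le_prod gauss_density_nonneg)
    then show "ennreal (norm ((1 + norm x) * gauss_density \<sigma> x))
      \<le> (\<Prod>b\<in>Basis. ennreal ((1 + \<bar>x \<bullet> b\<bar>) * normal_density 0 \<sigma> (x \<bullet> b)))"
      by (simp add: prod_ennreal normal_density_nonneg gauss_density_nonneg abs_mult prod.distrib
          gauss_density_eq_prod[OF assms] prod_nonneg ennreal_leI)
  qed
  also have "\<dots> = (\<Prod>b\<in>(Basis :: (real ^ 'd) set).
      \<integral>\<^sup>+x. ennreal ((1 + \<bar>x\<bar>) * normal_density 0 \<sigma> x) \<partial>lborel)"
    by (subst nn_integral_lborel_prod) (simp_all add: normal_density_nonneg)
  also have "\<dots> < \<infinity>"
    using fin by (simp add: power_less_top_ennreal)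
  finally show "(\<integral>\<^sup>+x. ennreal (norm ((1 + norm x) * gauss_density \<sigma> x))
      \<partial>(lborel :: (real ^ 'd) measure)) < \<infinity>" .
qed measurable

lemma smoothed_functional_apply:
  fixes Q :: "(real ^ 'd::finite) measure"
  assumes "\<sigma> > 0" "prob_space Q" "sets Q = sets borel" "integrable Q norm"
  shows "smoothed_functional \<sigma> Q f = (\<integral>x. gauss_smooth \<sigma> (lip_fun f) x \<partial>Q)"
proof -
  interpret prob_space Q by fact
  define C where "C = (\<integral>y. (1 + norm y) * gauss_density \<sigma> y \<partial>(lborel :: (real ^ 'd) measure))"
  note I = integrable_gauss_density_moment[OF assms(1), where 'd='d]
  have smooth_le: "\<bar>gauss_smooth \<sigma> (lip_fun g) x\<bar> \<le> (1 + norm x) * C"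
    for g :: "'d lip10" and x
  proof -
    have g: "\<bar>lip_fun g z\<bar> \<le> norm z" for z
    proof -
      have "1-lipschitz_on UNIV (lip_fun g)" "lip_fun g 0 = 0"
        using lip_fun[of g] by auto
      then show ?thesis
        using lipschitz_onD[of 1 UNIV "lip_fun g" z 0] by (simp add: dist_norm)
    qed
    have pointwise: "norm (lip_fun g (x - y) * gauss_density \<sigma> y)
        \<le> (1 + norm x) * ((1 + norm y) * gauss_density \<sigma> y)" for y
    proof -
      have "\<bar>lip_fun g (x - y)\<bar> \<le> norm x + norm y"
        using g[of "x - y"] norm_triangle_ineq4[of x y] by linarith
      also have "\<dots> \<le> (1 + norm x) * (1 + norm y)"
        by (simp add: algebra_simps)
      finally show ?thesis
        using gauss_density_nonneg[of \<sigma> y]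
        by (simp add: abs_mult mult_right_mono flip: mult.assoc)
    qed
    have dominating: "integrable (lborel :: (real ^ 'd) measure) (\<lambda>y. (1 + norm x) * ((1 + norm y) * gauss_density \<sigma> y))"
      using I by simp
    have "continuous_on UNIV (lip_fun g)"
      using lip_fun[of g] by (auto intro: lipschitz_on_continuous_on)
    then have [measurable]: "lip_fun g \<in> borel_measurable borel"
      by (rule borel_measurable_continuous_onI)
    have "integrable lborel (\<lambda>y. lip_fun g (x - y) * gauss_density \<sigma> y)"
      by (rule Bochner_Integration.integrable_bound[OF dominating])
        (measurable, rule AE_I2, simp only: real_norm_def,
          rule order_trans[OF pointwise[unfolded real_norm_def] abs_ge_self])
    then have "norm (gauss_smooth \<sigma> (lip_fun g) x)
      \<le> (\<integral>y. (1 + norm x) * ((1 + norm y) * gauss_density \<sigma> y) \<partial>(lborel :: (real ^ 'd) measure))"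
      unfolding gauss_smooth_def
      by (rule Bochner_Integration.integral_norm_bound_integral[OF _ dominating pointwise])
    then show ?thesis by (simp add: C_def)
  qed
  have "bounded (range (\<lambda>g :: 'd lip10. \<integral>x. gauss_smooth \<sigma> (lip_fun g) x \<partial>Q))"
    unfolding bounded_iff
  proof (rule exI, clarify)
    fix g :: "'d lip10"
    have "norm (\<integral>x. gauss_smooth \<sigma> (lip_fun g) x \<partial>Q) \<le> (\<integral>x. (1 + norm x) * C \<partial>Q)"
    proof (cases "integrable Q (gauss_smooth \<sigma> (lip_fun g))")
      case True
      then show ?thesis
        using assms(4) smooth_le
        by (intro Bochner_Integration.integral_norm_bound_integral) auto
    next
      case False
      have "0 \<le> C"
        by (simp add: C_def gauss_density_nonneg)
      with False show ?thesis
        by (simp add: not_integrable_integral_eq)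
    qed
    then show "norm (\<integral>x. gauss_smooth \<sigma> (lip_fun g) x \<partial>Q) \<le> (\<integral>x. (1 + norm x) * C \<partial>Q)" .
  qed
  then have "(\<lambda>g :: 'd lip10. \<integral>x. gauss_smooth \<sigma> (lip_fun g) x \<partial>Q) \<in> bcontfun"
    by (simp add: bcontfun_def)
  then show ?thesis
    by (simp add: smoothed_functional_def Bcontfun_inverse)
qed

end

theory Submission
  imports Defs
begin

text \<open>
  By Kantorovich--Rubinstein duality the smoothed Wasserstein distance is the norm of a difference
  of smoothed functionals. A 1-Lipschitz \<open>f\<close> with \<open>f 0 = 0\<close> satisfies \<open>\<bar>f z\<bar> \<le> \<bar>z\<bar>\<close>, so the norm of
  \<open>(P\<^sub>n - P)\<^sup>\<sigma>\<close> is at most \<open>\<integral> \<bar>z\<bar> \<bar>(P\<^sub>n - P) * \<phi>\<^sub>\<sigma>\<bar>(z) dz\<close>, whose expectation is at most \<open>1 / \<surd>n\<close> times the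
  integral of \<open>\<bar>z\<bar> (\<integral> \<phi>\<^sub>\<sigma>(x - z)\<^sup>2 dP(x))\<^sup>1\<^sup>/\<^sup>2\<close>. The partition condition makes this integral finite for \<open>P\<close>;
  the moment condition bounds it uniformly over the model, so that replacing \<open>Q\<^sub>\<theta>\<close> by its sample of
  size \<open>m \<gg> n\<close> costs \<open>O(m\<^sup>-\<^sup>1\<^sup>/\<^sup>2) = o(n\<^sup>-\<^sup>1\<^sup>/\<^sup>2)\<close>. The same weighted \<open>L\<^sup>1\<close> bound shows that the empirical process is
  approximated, uniformly in \<open>n\<close>, by its values at finitely many \<open>f\<close>; tightness does the same for
  the limit process, and the scalar central limit theorem gives convergence of Lipschitz functionals.
  Finally, differentiability, nonsingularity and identifiability localise the minimisation at scale
  \<open>1 / \<surd>n\<close> around \<open>\<theta>\<^sub>0\<close>, where the criterion is \<open>E \<mapsto> inf\<^sub>t \<parallel>E - \<langle>t, D\<rangle>\<parallel>\<close> up to a uniformly small error on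
  bounded sets of \<open>E\<close>.
\<close>

subsection \<open>Kantorovich--Rubinstein duality\<close>

text \<open>The space of bounded functionals is not separable, and this shapes the proof twice. Sums
  of Borel maps into it need not be Borel, so the empirical functional is shown to be a continuous
  function of the sample. The infimum over the uncountable \<open>\<Theta>\<close> could fail to be
  measurable, but it is Lipschitz in the empirical functional. Every functional whose limit is taken
  is bounded and Lipschitz for the supremum norm, so the convergence statements involve ordinary
  integrals only.

  No chaining or entropy bound is needed: smoothing turns the difference of two measures into a
  function of z, and at fixed z its mean size is the standard deviation of an average of bounded
  variables. The single quantity \<open>root_kernel\<close> records that standard deviation. The
  partition condition and the moment condition are two ways to integrate it against a weight.

  Finite-dimensional laws are tested by cosines with a phase. A linear combination of coordinates is
  again one scalar sum, so a single scalar limit theorem suffices, and the same cosine criterion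
  shows that Gaussian smoothing is injective.\<close>

lemma farkas:
  fixes \<alpha> :: "'j \<Rightarrow> 'i \<Rightarrow> real" and \<gamma> :: "'i \<Rightarrow> real"
  assumes "finite J" and "finite K"
    and "\<And>v. (\<And>j. j \<in> J \<Longrightarrow> (\<Sum>k\<in>K. \<alpha> j k * v k) \<le> 0) \<Longrightarrow> (\<Sum>k\<in>K. \<gamma> k * v k) \<le> 0"
  shows "\<exists>u. (\<forall>j\<in>J. 0 \<le> u j) \<and> (\<forall>k\<in>K. \<gamma> k = (\<Sum>j\<in>J. u j * \<alpha> j k))"
  using assms(1,3)
proof (induction J arbitrary: \<alpha> \<gamma> rule: finite_induct)
  case empty
  have "\<gamma> k = 0" if k: "k \<in> K" for k
  proof -
    \<comment> \<open>With no constraints the premise holds for every v; testing a vector supported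
      at k with entry \<open>\<gamma> k\<close> gives a square that is at most 0.\<close>
    have "(\<Sum>i\<in>K. \<gamma> i * (if i = k then \<gamma> k else 0)) \<le> 0"
      by (rule empty) simp
    then have "\<gamma> k * \<gamma> k \<le> 0"
      using k assms(2) by (simp add: if_distrib[of "(*) _"] cong: if_cong)
    moreover have "0 \<le> \<gamma> k * \<gamma> k" by simp
    ultimately have "\<gamma> k * \<gamma> k = 0" by (rule antisym)
    then show ?thesis by simp
  qed
  then show ?case by simp
next
  \<comment> \<open>If the constraints in \<open>J\<close> do not suffice, a violating direction lies strictly on the wrong side
    of \<open>\<alpha> m\<close>; projecting along it onto the kernel of \<open>\<alpha> m\<close> reduces to \<open>J\<close>.\<close>
  case (insert m J)
  define ev where "ev \<beta> v = (\<Sum>k\<in>K. \<beta> k * v k)" for \<beta> v :: "'i \<Rightarrow> real"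
  have ev_lin: "ev (\<lambda>k. \<beta> k - c * \<beta>' k) v = ev \<beta> v - c * ev \<beta>' v"
    "ev \<beta> (\<lambda>k. v k - c * w k) = ev \<beta> v - c * ev \<beta> w"
    "ev \<beta> (\<lambda>k. c * w k) = c * ev \<beta> w" for \<beta> \<beta>' v w :: "'i \<Rightarrow> real" and c
    by (simp_all add: ev_def sum_subtractf sum_distrib_left algebra_simps)
  show ?case
  proof (cases "\<forall>v. (\<forall>j\<in>J. ev (\<alpha> j) v \<le> 0) \<longrightarrow> ev \<gamma> v \<le> 0")
    case True
    then have "\<exists>u. (\<forall>j\<in>J. 0 \<le> u j) \<and> (\<forall>k\<in>K. \<gamma> k = (\<Sum>j\<in>J. u j * \<alpha> j k))"
      by (intro insert.IH) (simp add: ev_def)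
    then obtain u where "\<forall>j\<in>J. 0 \<le> u j" "\<forall>k\<in>K. \<gamma> k = (\<Sum>j\<in>J. u j * \<alpha> j k)" by blast
    then show ?thesis
      using insert.hyps
      by (intro exI[of _ "u(m := 0)"]) (auto intro!: sum.cong)
  next
    case False
    then obtain v where v: "\<And>j. j \<in> J \<Longrightarrow> ev (\<alpha> j) v \<le> 0" and "0 < ev \<gamma> v" by force
    then have pos: "0 < ev (\<alpha> m) v"
      using insert.prems[of v] by (force simp: ev_def)
    define w where "w = (\<lambda>k. inverse (ev (\<alpha> m) v) * v k)"
    have wm: "ev (\<alpha> m) w = 1" and w: "\<And>j. j \<in> J \<Longrightarrow> ev (\<alpha> j) w \<le> 0" and w\<gamma>: "0 < ev \<gamma> w"
      using pos v \<open>0 < ev \<gamma> v\<close> by (auto simp: w_def ev_lin mult_nonneg_nonpos)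
    \<comment> \<open>Since \<open>ev (\<alpha> m) w = 1\<close>, the map sending x to x -
      \<open>ev (\<alpha> m) x\<close> w is the projection onto the kernel of
      \<open>\<alpha> m\<close> along w. The primed functionals are the original ones composed with
      it.\<close>
    define \<alpha>' where "\<alpha>' j = (\<lambda>k. \<alpha> j k - ev (\<alpha> j) w * \<alpha> m k)" for j
    define \<gamma>' where "\<gamma>' = (\<lambda>k. \<gamma> k - ev \<gamma> w * \<alpha> m k)"
    have "\<exists>u. (\<forall>j\<in>J. 0 \<le> u j) \<and> (\<forall>k\<in>K. \<gamma>' k = (\<Sum>j\<in>J. u j * \<alpha>' j k))"
    proof (rule insert.IH)
      fix x assume x: "(\<Sum>k\<in>K. \<alpha>' j k * x k) \<le> 0" if "j \<in> J" for j
      define x' where "x' = (\<lambda>k. x k - ev (\<alpha> m) x * w k)"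
      have eq: "ev (\<alpha> j) x' = ev (\<alpha>' j) x" "ev \<gamma> x' = ev \<gamma>' x" "ev (\<alpha> m) x' = 0" for j
        by (simp_all add: x'_def \<alpha>'_def \<gamma>'_def ev_lin wm)
      have "ev \<gamma> x' \<le> 0"
        unfolding ev_def using x eq by (intro insert.prems) (auto simp: ev_def)
      then show "(\<Sum>k\<in>K. \<gamma>' k * x k) \<le> 0"
        using eq by (simp add: ev_def)
    qed
    then obtain u where u: "\<forall>j\<in>J. 0 \<le> u j" "\<forall>k\<in>K. \<gamma>' k = (\<Sum>j\<in>J. u j * \<alpha>' j k)" by blast
    \<comment> \<open>Undoing the projection leaves this coefficient in front of
      \<open>\<alpha> m\<close>. It is nonnegative because w violates \<open>\<gamma>\<close> but
      satisfies every constraint in J.\<close>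
    define c where "c = ev \<gamma> w - (\<Sum>j\<in>J. u j * ev (\<alpha> j) w)"
    have "(\<Sum>j\<in>J. u j * ev (\<alpha> j) w) \<le> 0"
      using u w by (intro sum_nonpos) (auto simp: mult_nonneg_nonpos)
    then have "0 \<le> c" using w\<gamma> by (simp add: c_def)
    moreover have "\<gamma> k = c * \<alpha> m k + (\<Sum>j\<in>J. u j * \<alpha> j k)" if "k \<in> K" for k
    proof -
      have "\<gamma> k - ev \<gamma> w * \<alpha> m k = (\<Sum>j\<in>J. u j * \<alpha>' j k)"
        using u that by (simp add: \<gamma>'_def)
      also have "\<dots> = (\<Sum>j\<in>J. u j * \<alpha> j k) - (\<Sum>j\<in>J. u j * ev (\<alpha> j) w) * \<alpha> m k"
        by (simp add: \<alpha>'_def sum_subtractf sum_distrib_right sum_distrib_left algebra_simps)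
      finally show ?thesis by (simp add: c_def algebra_simps)
    qed
    moreover have "(\<Sum>j\<in>J. (u(m := c)) j * \<alpha> j k) = (\<Sum>j\<in>J. u j * \<alpha> j k)" for k
      using insert.hyps by (intro sum.cong) auto
    ultimately show ?thesis
      using u insert.hyps by (intro exI[of _ "u(m := c)"]) auto
  qed
qed

lemma lipschitz_on_Min:
  assumes "finite B" "B \<noteq> {}" "\<And>b. b \<in> B \<Longrightarrow> 1-lipschitz_on UNIV (h b)"
  shows "1-lipschitz_on UNIV (\<lambda>x. Min ((\<lambda>b. h b x) ` B) :: real)"
proof (rule lipschitz_onI)
  fix x y
  have "Min ((\<lambda>b. h b x) ` B) - dist x y \<le> Min ((\<lambda>b. h b y) ` B)" for x y
  proof -
    have "Min ((\<lambda>b. h b x) ` B) - dist x y \<le> h b y" if "b \<in> B" for b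
    proof -
      have "Min ((\<lambda>b. h b x) ` B) \<le> h b x" using that assms by auto
      moreover have "\<bar>h b x - h b y\<bar> \<le> dist x y"
        using lipschitz_onD[OF assms(3)[OF that], of x y] by (simp add: dist_real_def)
      ultimately show ?thesis by linarith
    qed
    then show ?thesis using assms by (subst Min_ge_iff) auto
  qed
  from this[of x y] this[of y x]
  show "dist (Min ((\<lambda>b. h b x) ` B)) (Min ((\<lambda>b. h b y) ` B)) \<le> 1 * dist x y"
    by (simp add: dist_real_def abs_le_iff dist_commute)
qed simp

text \<open>Finding a plan of cost at most S is a linear feasibility problem, so Farkas' lemma
  reduces it to refuting a dual certificate: potentials f and g and a price l with f a + g b bounded
  by l times the distance. The c-transform of such potentials is a 1-Lipschitz function on the whole
  space, and the assumed bound for that function is the refutation.\<close>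

lemma finite_kantorovich_rubinstein:
  fixes A :: "'a::metric_space set" and p q :: "'a \<Rightarrow> real"
  assumes A: "finite A"
    and p: "\<And>a. a \<in> A \<Longrightarrow> 0 \<le> p a" "sum p A = 1"
    and q: "\<And>a. a \<in> A \<Longrightarrow> 0 \<le> q a" "sum q A = 1"
    and S: "\<And>h. 1-lipschitz_on UNIV h \<Longrightarrow> (\<Sum>a\<in>A. h a * p a) - (\<Sum>a\<in>A. h a * q a) \<le> S"
  shows "\<exists>w. (\<forall>a\<in>A. \<forall>b\<in>A. 0 \<le> w a b) \<and> (\<forall>a\<in>A. (\<Sum>b\<in>A. w a b) = p a) \<and>
    (\<forall>b\<in>A. (\<Sum>a\<in>A. w a b) = q b) \<and> (\<Sum>a\<in>A. \<Sum>b\<in>A. w a b * dist a b) \<le> S"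
proof -
  \<comment> \<open>K indexes the equations: the first marginal, the second marginal and the cost. J
    indexes the unknowns: \<open>Some (a, b)\<close> is an entry of the plan and \<open>None\<close>
    is the slack that turns the cost inequality into an equation.\<close>
  define K where "K = A <+> (A <+> {()})"
  define J where "J = insert None (Some ` (A \<times> A))"
  have fin: "finite K" "finite J" using A by (auto simp: K_def J_def)
  have A0: "A \<noteq> {}" using p by auto
  define \<gamma> where "\<gamma> k = (case k of Inl a \<Rightarrow> p a | Inr (Inl b) \<Rightarrow> q b | Inr (Inr _) \<Rightarrow> - S)"
    for k :: "'a + 'a + unit"
  define \<alpha> where "\<alpha> j k = (case j of
      None \<Rightarrow> (case k of Inl _ \<Rightarrow> 0 | Inr (Inl _) \<Rightarrow> 0 | Inr (Inr _) \<Rightarrow> - 1)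
    | Some (a, b) \<Rightarrow> (case k of Inl x \<Rightarrow> of_bool (x = a) | Inr (Inl y) \<Rightarrow> of_bool (y = b)
        | Inr (Inr _) \<Rightarrow> - dist a b))" for j :: "('a \<times> 'a) option" and k :: "'a + 'a + unit"
  have sumK: "(\<Sum>k\<in>K. F k) = (\<Sum>a\<in>A. F (Inl a)) + ((\<Sum>b\<in>A. F (Inr (Inl b))) + F (Inr (Inr ())))"
    for F :: "'a + 'a + unit \<Rightarrow> real"
    using A by (simp add: K_def sum.Plus finite_Plus)
  have sumJ: "(\<Sum>j\<in>J. F j) = F None + (\<Sum>a\<in>A. \<Sum>b\<in>A. F (Some (a, b)))"
    for F :: "('a \<times> 'a) option \<Rightarrow> real"
    using A by (simp add: J_def sum.reindex sum.cartesian_product)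
  have dual: "(\<Sum>k\<in>K. \<gamma> k * v k) \<le> 0"
    if v: "\<And>j. j \<in> J \<Longrightarrow> (\<Sum>k\<in>K. \<alpha> j k * v k) \<le> 0" for v
  proof -
    define f g l where "f a = v (Inl a)" and "g b = v (Inr (Inl b))" and "l = v (Inr (Inr ()))" for a b
    have l: "0 \<le> l"
      using v[of None] by (simp add: J_def sumK \<alpha>_def l_def)
    have fg: "f a + g b \<le> l * dist a b" if "a \<in> A" "b \<in> A" for a b
      using v[of "Some (a, b)"] that A by (simp add: J_def sumK \<alpha>_def f_def g_def l_def mult.commute)
    have "(\<Sum>a\<in>A. p a * f a) + (\<Sum>b\<in>A. q b * g b) \<le> l * S"
    proof (cases "l = 0")
      case True
      \<comment> \<open>Without a price the potentials satisfy f a + g b \<le> 0, and the constant M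
        separates f from -g. It integrates to the same value against p and q because both have total
        mass 1.\<close>
      define M where "M = Max (f ` A)"
      have "(\<Sum>a\<in>A. p a * f a) \<le> (\<Sum>a\<in>A. p a * M)"
        using A p by (intro sum_mono mult_left_mono) (auto simp: M_def)
      moreover have "(\<Sum>b\<in>A. q b * g b) \<le> (\<Sum>b\<in>A. q b * (- M))"
      proof (intro sum_mono mult_left_mono)
        fix b assume "b \<in> A"
        have "M \<in> f ` A" using A A0 by (auto simp: M_def intro!: Max_in)
        then show "g b \<le> - M" using fg[OF _ \<open>b \<in> A\<close>] True by fastforce
      qed (use q in auto)
      moreover have "(\<Sum>a\<in>A. p a * M) + (\<Sum>b\<in>A. q b * (- M)) = 0"
        using p(2) q(2) by (simp add: sum_negf flip: sum_distrib_right)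
      ultimately show ?thesis using True by simp
    next
      case False
      then have l: "0 < l" using l by simp
      \<comment> \<open>the c-transform of \<open>g\<close>, which dominates \<open>f\<close> and is dominated by \<open>- g\<close>\<close>
      define h where "h x = Min ((\<lambda>b. dist x b - g b / l) ` A)" for x
      have lip: "1-lipschitz_on UNIV h"
        unfolding h_def
        by (rule lipschitz_on_Min[OF A A0], rule lipschitz_onI)
          (auto simp: dist_real_def abs_le_iff intro: dist_triangle_le,
            (metis add.commute dist_commute dist_triangle le_diff_eq diff_le_eq)+)
      have "f a / l \<le> h a" if "a \<in> A" for a
      proof -
        have "f a / l \<le> dist a b - g b / l" if "b \<in> A" for b
          using fg[OF \<open>a \<in> A\<close> that] l by (simp add: field_simps)
        then show ?thesis unfolding h_def using A A0 by (subst Min_ge_iff) auto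
      qed
      then have 1: "(\<Sum>a\<in>A. p a * (f a / l)) \<le> (\<Sum>a\<in>A. h a * p a)"
        using p by (intro sum_mono) (simp only: mult.commute[of "h _"], auto intro!: mult_left_mono simp del: times_divide_eq_right)
      have "h b \<le> - (g b / l)" if "b \<in> A" for b
      proof -
        have "h b \<le> dist b b - g b / l" unfolding h_def using A that by (intro Min_le imageI finite_imageI)
        then show ?thesis by simp
      qed
      then have 2: "(\<Sum>b\<in>A. q b * (g b / l)) \<le> (\<Sum>b\<in>A. - (h b * q b))"
        using q by (intro sum_mono) (metis minus_le_iff mult.commute mult_left_mono mult_minus_right le_minus_iff)
      have "(\<Sum>a\<in>A. p a * (f a / l)) + (\<Sum>b\<in>A. q b * (g b / l)) \<le> S"
        using 1 2 S[OF lip] by (simp add: sum_negf)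
      then have "((\<Sum>a\<in>A. p a * f a) + (\<Sum>b\<in>A. q b * g b)) / l \<le> S"
        by (simp add: sum_divide_distrib add_divide_distrib)
      then show ?thesis using l by (simp add: field_simps)
    qed
    then show ?thesis by (simp add: sumK \<gamma>_def f_def g_def l_def mult.commute)
  qed
  obtain u where u: "\<forall>j\<in>J. 0 \<le> u j" "\<forall>k\<in>K. \<gamma> k = (\<Sum>j\<in>J. u j * \<alpha> j k)"
    using farkas[OF fin(2,1) dual] by blast
  define w where "w a b = u (Some (a, b))" for a b
  have "\<forall>a\<in>A. \<forall>b\<in>A. 0 \<le> w a b" using u(1) by (auto simp: J_def w_def)
  moreover have "(\<Sum>b\<in>A. w a b) = p a" if "a \<in> A" for a
  proof -
    have "p a = (\<Sum>x\<in>A. \<Sum>b\<in>A. w x b * of_bool (a = x))"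
      using u(2)[rule_format, of "Inl a"] that by (auto simp: K_def \<gamma>_def sumJ \<alpha>_def w_def)
    also have "\<dots> = (\<Sum>x\<in>A. if a = x then \<Sum>b\<in>A. w x b else 0)"
      by (intro sum.cong) auto
    finally show ?thesis using A that by simp
  qed
  moreover have "(\<Sum>a\<in>A. w a b) = q b" if "b \<in> A" for b
  proof -
    have "q b = (\<Sum>a\<in>A. \<Sum>y\<in>A. w a y * of_bool (b = y))"
      using u(2)[rule_format, of "Inr (Inl b)"] that by (auto simp: K_def \<gamma>_def sumJ \<alpha>_def w_def)
    then show ?thesis using A that by simp
  qed
  moreover have "(\<Sum>a\<in>A. \<Sum>b\<in>A. w a b * dist a b) \<le> S"
  proof -
    have "- S = - u None + (\<Sum>a\<in>A. \<Sum>b\<in>A. w a b * - dist a b)"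
      using u(2)[rule_format, of "Inr (Inr ())"] by (auto simp: K_def \<gamma>_def sumJ \<alpha>_def w_def)
    moreover have "0 \<le> u None" using u(1) by (auto simp: J_def)
    ultimately show ?thesis by (simp add: sum_negf)
  qed
  ultimately show ?thesis by blast
qed

section \<open>From finite transport plans to couplings of general measures\<close>

lemma nn_integral_finite_range:
  fixes T :: "'a \<Rightarrow> 'b"
  assumes "finite A" "T \<in> space M \<rightarrow> A" "\<And>a. a \<in> A \<Longrightarrow> T -` {a} \<inter> space M \<in> sets M"
  shows "(\<integral>\<^sup>+x. F (T x) \<partial>M) = (\<Sum>a\<in>A. F a * emeasure M (T -` {a} \<inter> space M))"
proof -
  have "(\<integral>\<^sup>+x. F (T x) \<partial>M) = (\<integral>\<^sup>+x. (\<Sum>a\<in>A. F a * indicator (T -` {a} \<inter> space M) x) \<partial>M)"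
  proof (rule nn_integral_cong)
    fix x assume x: "x \<in> space M"
    then have "T x \<in> A" using assms(2) by auto
    have "(\<Sum>a\<in>A. F a * indicator (T -` {a} \<inter> space M) x) = (\<Sum>a\<in>A. if a = T x then F a else 0)"
      using x by (intro sum.cong) (auto simp: indicator_def)
    then show "F (T x) = (\<Sum>a\<in>A. F a * indicator (T -` {a} \<inter> space M) x)"
      using \<open>T x \<in> A\<close> assms(1) by simp
  qed
  also have "\<dots> = (\<Sum>a\<in>A. \<integral>\<^sup>+x. F a * indicator (T -` {a} \<inter> space M) x \<partial>M)"
    using assms by (intro nn_integral_sum borel_measurable_times_ennreal) auto
  also have "\<dots> = (\<Sum>a\<in>A. F a * emeasure M (T -` {a} \<inter> space M))"
    using assms by (intro sum.cong) (simp_all add: nn_integral_cmult_indicator)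
  finally show ?thesis .
qed

lemma (in prob_space) integral_finite_range:
  fixes T :: "'a \<Rightarrow> 'b" and F :: "'b \<Rightarrow> real"
  assumes "finite A" "T \<in> space M \<rightarrow> A" "\<And>a. a \<in> A \<Longrightarrow> T -` {a} \<inter> space M \<in> sets M"
  shows "(\<integral>x. F (T x) \<partial>M) = (\<Sum>a\<in>A. F a * measure M (T -` {a} \<inter> space M))"
proof -
  have "(\<integral>x. F (T x) \<partial>M) = (\<integral>x. (\<Sum>a\<in>A. F a * indicator (T -` {a} \<inter> space M) x) \<partial>M)"
  proof (rule Bochner_Integration.integral_cong[OF refl])
    fix x assume x: "x \<in> space M"
    then have "T x \<in> A" using assms(2) by auto
    have "(\<Sum>a\<in>A. F a * indicator (T -` {a} \<inter> space M) x) = (\<Sum>a\<in>A. if a = T x then F a else 0)"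
      using x by (intro sum.cong) (auto simp: indicator_def)
    then show "F (T x) = (\<Sum>a\<in>A. F a * indicator (T -` {a} \<inter> space M) x)"
      using \<open>T x \<in> A\<close> assms(1) by simp
  qed
  also have "\<dots> = (\<Sum>a\<in>A. \<integral>x. F a * indicator (T -` {a} \<inter> space M) x \<partial>M)"
    using assms by (intro Bochner_Integration.integral_sum integrable_mult_right
        integrable_real_indicator) (auto simp: emeasure_eq_measure)
  also have "\<dots> = (\<Sum>a\<in>A. F a * measure M (T -` {a} \<inter> space M))"
    using assms by (intro sum.cong) (auto simp: Int_absorb2 sets.sets_into_space)
  finally show ?thesis .
qed

text \<open>With couplings given by a density against the product measure, the marginals are checked
  by Tonelli. The conditional masses are required only almost everywhere because a density built by
  dividing by cell probabilities is meaningless on cells of probability 0.\<close>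

lemma density_pair_in_couplings:
  fixes \<mu> \<nu> :: "'a::second_countable_topology measure"
  assumes "prob_space \<mu>" "prob_space \<nu>" and sets: "sets \<mu> = sets borel" "sets \<nu> = sets borel"
    and g: "g \<in> borel_measurable (borel \<Otimes>\<^sub>M borel)"
    and 1: "AE x in \<mu>. (\<integral>\<^sup>+y. g (x, y) \<partial>\<nu>) = 1" and 2: "AE y in \<nu>. (\<integral>\<^sup>+x. g (x, y) \<partial>\<mu>) = 1"
  shows "density (\<mu> \<Otimes>\<^sub>M \<nu>) g \<in> couplings \<mu> \<nu>"
proof -
  interpret \<mu>: prob_space \<mu> by fact
  interpret \<nu>: prob_space \<nu> by fact
  interpret pair_prob_space \<mu> \<nu> ..
  note [measurable_cong] = sets
  note [measurable] = g
  have sp: "space \<mu> = UNIV" "space \<nu> = UNIV" using sets by (auto dest: sets_eq_imp_space_eq)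
  let ?\<pi> = "density (\<mu> \<Otimes>\<^sub>M \<nu>) g"
  have fst: "emeasure ?\<pi> (B \<times> UNIV) = emeasure \<mu> B" if B: "B \<in> sets borel" for B
  proof -
    have "emeasure ?\<pi> (B \<times> UNIV) = (\<integral>\<^sup>+z. g z * indicator (B \<times> UNIV) z \<partial>(\<mu> \<Otimes>\<^sub>M \<nu>))"
      using B sp by (subst emeasure_density) (auto simp: sets intro!: pair_measureI)
    also have "\<dots> = (\<integral>\<^sup>+x. \<integral>\<^sup>+y. indicator B x * g (x, y) \<partial>\<nu> \<partial>\<mu>)"
      using B by (subst \<nu>.nn_integral_fst[symmetric]) (auto intro!: nn_integral_cong split: split_indicator)
    also have "\<dots> = (\<integral>\<^sup>+x. indicator B x * (\<integral>\<^sup>+y. g (x, y) \<partial>\<nu>) \<partial>\<mu>)"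
      by (intro nn_integral_cong nn_integral_cmult) measurable
    also have "\<dots> = (\<integral>\<^sup>+x. indicator B x \<partial>\<mu>)"
      using 1 by (intro nn_integral_cong_AE) auto
    finally show ?thesis using B by (simp add: sets)
  qed
  have snd: "emeasure ?\<pi> (UNIV \<times> B) = emeasure \<nu> B" if B: "B \<in> sets borel" for B
  proof -
    have "emeasure ?\<pi> (UNIV \<times> B) = (\<integral>\<^sup>+z. g z * indicator (UNIV \<times> B) z \<partial>(\<mu> \<Otimes>\<^sub>M \<nu>))"
      using B sp by (subst emeasure_density) (auto simp: sets intro!: pair_measureI)
    also have "\<dots> = (\<integral>\<^sup>+y. \<integral>\<^sup>+x. indicator B y * g (x, y) \<partial>\<mu> \<partial>\<nu>)"
      using B by (subst nn_integral_snd[symmetric]) (auto intro!: nn_integral_cong split: split_indicator)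
    also have "\<dots> = (\<integral>\<^sup>+y. indicator B y * (\<integral>\<^sup>+x. g (x, y) \<partial>\<mu>) \<partial>\<nu>)"
      by (intro nn_integral_cong nn_integral_cmult) measurable
    also have "\<dots> = (\<integral>\<^sup>+y. indicator B y \<partial>\<nu>)"
      using 2 by (intro nn_integral_cong_AE) auto
    finally show ?thesis using B by (simp add: sets)
  qed
  have "prob_space ?\<pi>"
    using fst[of UNIV] \<mu>.emeasure_space_1 sp
    by (intro prob_spaceI) (simp add: space_pair_measure)
  moreover have "distr ?\<pi> borel fst = \<mu>"
  proof (rule measure_eqI)
    fix B assume "B \<in> sets (distr ?\<pi> borel fst)"
    then have B: "B \<in> sets borel" by simp
    have "fst -` B \<inter> space ?\<pi> = B \<times> UNIV" by (auto simp: space_pair_measure sp)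
    then show "emeasure (distr ?\<pi> borel fst) B = emeasure \<mu> B"
      using B fst by (subst emeasure_distr) (auto simp: sets)
  qed (simp add: sets)
  moreover have "distr ?\<pi> borel snd = \<nu>"
  proof (rule measure_eqI)
    fix B assume "B \<in> sets (distr ?\<pi> borel snd)"
    then have B: "B \<in> sets borel" by simp
    have "snd -` B \<inter> space ?\<pi> = UNIV \<times> B" by (auto simp: space_pair_measure sp)
    then show "emeasure (distr ?\<pi> borel snd) B = emeasure \<nu> B"
      using B snd by (subst emeasure_distr) (auto simp: sets)
  qed (simp add: sets)
  ultimately show ?thesis
    by (simp add: couplings_def) (intro sets_pair_measure_cong sets)
qed

text \<open>The same T has to serve both measures, so it is taken from one sequence of simple
  functions approximating the identity. Growth at most twice that of the identity gives the
  dominating function 3 |x| for both.\<close>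

lemma discretisation:
  fixes \<mu> \<nu> :: "'a::euclidean_space measure"
  assumes sets: "sets \<mu> = sets borel" "sets \<nu> = sets borel"
    and int: "integrable \<mu> norm" "integrable \<nu> norm" and "0 < e"
  shows "\<exists>T. T \<in> borel_measurable borel \<and> finite (range T) \<and>
    integrable \<mu> (\<lambda>x. dist x (T x)) \<and> integrable \<nu> (\<lambda>x. dist x (T x)) \<and>
    (\<integral>x. dist x (T x) \<partial>\<mu>) < e \<and> (\<integral>x. dist x (T x) \<partial>\<nu>) < e"
proof -
  obtain s :: "nat \<Rightarrow> 'a \<Rightarrow> 'a" where s: "\<And>i. simple_function borel (s i)"
      "\<And>x. (\<lambda>i. s i x) \<longlonglongrightarrow> x" "\<And>i x. dist (s i x) 0 \<le> 2 * dist x 0"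
    using borel_measurable_implies_sequence_metric[of "\<lambda>x::'a. x" borel 0] by auto
  have [measurable]: "s i \<in> borel_measurable borel" for i
    using s(1) by (rule borel_measurable_simple_function)
  have bound: "norm (dist x (s i x)) \<le> 3 * norm x" for i x
    using s(3)[of i x] dist_triangle[of x "s i x" 0] by (simp add: dist_commute)
  have *: "integrable M (\<lambda>x. dist x (s i x))" "(\<lambda>i. \<integral>x. dist x (s i x) \<partial>M) \<longlonglongrightarrow> 0"
    if M[measurable_cong]: "sets M = sets borel" and int: "integrable M norm" for M i
  proof -
    have lim: "(\<lambda>i. dist x (s i x)) \<longlonglongrightarrow> 0" for x
      using tendsto_dist[OF tendsto_const s(2), of x x] by simp
    have "integrable M (\<lambda>x. dist x (s i x))" for i
      by (rule Bochner_Integration.integrable_bound[of _ "\<lambda>x. 3 * norm x"])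
        (use int bound in auto)
    moreover have "(\<lambda>i. \<integral>x. dist x (s i x) \<partial>M) \<longlonglongrightarrow> (\<integral>x. 0 \<partial>M)"
      by (rule integral_dominated_convergence[where w="\<lambda>x. 3 * norm x"])
        (use int bound lim in auto)
    ultimately show "integrable M (\<lambda>x. dist x (s i x))" "(\<lambda>i. \<integral>x. dist x (s i x) \<partial>M) \<longlonglongrightarrow> 0"
      by simp_all
  qed
  have "\<forall>\<^sub>F i in sequentially. (\<integral>x. dist x (s i x) \<partial>\<mu>) < e"
    using order_tendstoD(2)[OF *(2)[OF sets(1) int(1)]] \<open>0 < e\<close> by blast
  moreover have "\<forall>\<^sub>F i in sequentially. (\<integral>x. dist x (s i x) \<partial>\<nu>) < e"
    using order_tendstoD(2)[OF *(2)[OF sets(2) int(2)]] \<open>0 < e\<close> by blast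
  ultimately have "\<forall>\<^sub>F i in sequentially. (\<integral>x. dist x (s i x) \<partial>\<mu>) < e \<and> (\<integral>x. dist x (s i x) \<partial>\<nu>) < e"
    by eventually_elim auto
  then obtain i where "(\<integral>x. dist x (s i x) \<partial>\<mu>) < e" "(\<integral>x. dist x (s i x) \<partial>\<nu>) < e"
    using eventually_happens'[OF sequentially_bot] by blast
  moreover have "finite (range (s i))"
    using simple_functionD(1)[OF s(1)[of i]] by simp
  ultimately show ?thesis
    using *(1) sets int by (intro exI[of _ "s i"]) auto
qed

lemma integrable_lipschitz:
  fixes h :: "'a::euclidean_space \<Rightarrow> real"
  assumes "prob_space \<mu>" "sets \<mu> = sets borel" "integrable \<mu> norm" "1-lipschitz_on UNIV h"
  shows "integrable \<mu> h"
proof -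
  interpret prob_space \<mu> by fact
  note [measurable_cong] = assms(2)
  have [measurable]: "h \<in> borel_measurable borel"
    using assms(4) by (intro borel_measurable_continuous_onI lipschitz_on_continuous_on)
  have bound: "norm (h x) \<le> norm x + \<bar>h 0\<bar>" for x
    using lipschitz_onD[OF assms(4), of x 0] by (simp add: dist_real_def)
  show ?thesis
    by (rule Bochner_Integration.integrable_bound[of \<mu> "\<lambda>x. norm x + \<bar>h 0\<bar>"])
      (use assms(3) order_trans[OF bound abs_ge_self] in auto)
qed

text \<open>Spreading the optimal plan of the discretised marginals by a piecewise constant density with
  respect to the product measure couples the original marginals directly, without a gluing lemma.\<close>

lemma wasserstein1_le:
  fixes \<mu> \<nu> :: "'a::euclidean_space measure"
  assumes \<mu>: "prob_space \<mu>" "sets \<mu> = sets borel" "integrable \<mu> norm"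
    and \<nu>: "prob_space \<nu>" "sets \<nu> = sets borel" "integrable \<nu> norm"
    and S: "\<And>h. 1-lipschitz_on UNIV h \<Longrightarrow> (\<integral>x. h x \<partial>\<mu>) - (\<integral>x. h x \<partial>\<nu>) \<le> S"
  shows "wasserstein1 \<mu> \<nu> \<le> ennreal S"
proof (rule ennreal_le_epsilon)
  fix e' :: real assume "0 < e'"
  \<comment> \<open>The discretisation error is paid four times: twice when the dual bound passes to
    the discrete marginals, and once for each endpoint moved to its cell.\<close>
  define e where "e = e' / 4"
  have "0 < e" using \<open>0 < e'\<close> by (simp add: e_def)
  interpret \<mu>: prob_space \<mu> by fact
  interpret \<nu>: prob_space \<nu> by fact
  interpret pair_prob_space \<mu> \<nu> ..
  note [measurable_cong] = \<mu>(2) \<nu>(2)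
  have sp: "space \<mu> = UNIV" "space \<nu> = UNIV" using \<mu>(2) \<nu>(2) by (auto dest: sets_eq_imp_space_eq)
  have "0 \<le> S" using S[of "\<lambda>_. 0"] by (simp add: lipschitz_on_def)
  obtain T where [measurable]: "T \<in> borel_measurable borel" and fin: "finite (range T)"
    and T: "integrable \<mu> (\<lambda>x. dist x (T x))" "integrable \<nu> (\<lambda>x. dist x (T x))"
      "(\<integral>x. dist x (T x) \<partial>\<mu>) < e" "(\<integral>x. dist x (T x) \<partial>\<nu>) < e"
    using discretisation[OF \<mu>(2) \<nu>(2) \<mu>(3) \<nu>(3) \<open>0 < e\<close>] by blast
  define A where "A = range T"
  define p q where "p a = measure \<mu> (T -` {a})" and "q a = measure \<nu> (T -` {a})" for a
  have A: "finite A" "T x \<in> A" for x using fin by (auto simp: A_def)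
  have vim: "T -` {a} \<in> sets borel" for a
    using measurable_sets_borel[of T borel "{a}"] by simp
  have int_p: "(\<integral>x. F (T x) \<partial>\<mu>) = (\<Sum>a\<in>A. F a * p a)" for F :: "'a \<Rightarrow> real"
    using A vim by (subst \<mu>.integral_finite_range[of A]) (auto simp: \<mu>(2) p_def sp)
  have int_q: "(\<integral>x. F (T x) \<partial>\<nu>) = (\<Sum>a\<in>A. F a * q a)" for F :: "'a \<Rightarrow> real"
    using A vim by (subst \<nu>.integral_finite_range[of A]) (auto simp: \<nu>(2) q_def sp)
  have nn_p: "(\<integral>\<^sup>+x. F (T x) \<partial>\<mu>) = (\<Sum>a\<in>A. F a * ennreal (p a))" for F
    using A vim by (subst nn_integral_finite_range[of A])
      (auto simp: \<mu>(2) p_def sp \<mu>.emeasure_eq_measure)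
  have nn_q: "(\<integral>\<^sup>+x. F (T x) \<partial>\<nu>) = (\<Sum>a\<in>A. F a * ennreal (q a))" for F
    using A vim by (subst nn_integral_finite_range[of A])
      (auto simp: \<nu>(2) q_def sp \<nu>.emeasure_eq_measure)
  have p: "0 \<le> p a" "sum p A = 1" and q: "0 \<le> q a" "sum q A = 1" for a
    using int_p[of "\<lambda>_. 1"] int_q[of "\<lambda>_. 1"] by (simp_all add: p_def q_def \<mu>.prob_space \<nu>.prob_space)
  have discrete: "(\<Sum>a\<in>A. h a * p a) - (\<Sum>a\<in>A. h a * q a) \<le> S + 2 * e"
    if h: "1-lipschitz_on UNIV h" for h
  proof -
    have [measurable]: "h \<in> borel_measurable borel"
      using h by (intro borel_measurable_continuous_onI lipschitz_on_continuous_on)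
    have close: "\<bar>h x - h (T x)\<bar> \<le> dist x (T x)" for x
      using lipschitz_onD[OF h, of x "T x"] by (simp add: dist_real_def)
    have *: "\<bar>(\<integral>x. h x \<partial>M) - (\<integral>x. h (T x) \<partial>M)\<bar> \<le> (\<integral>x. dist x (T x) \<partial>M)"
      if M: "prob_space M" "sets M = sets borel" "integrable M norm" "integrable M (\<lambda>x. dist x (T x))" for M
    proof -
      note [measurable_cong] = M(2)
      have h_int: "integrable M h" by (rule integrable_lipschitz[OF M(1-3) h])
      have d_int: "integrable M (\<lambda>x. h x - h (T x))"
        by (rule Bochner_Integration.integrable_bound[OF M(4)]) (use close in auto)
      have "integrable M (\<lambda>x. h (T x))"
        using Bochner_Integration.integrable_diff[OF h_int d_int] by simp
      then have "(\<integral>x. h x \<partial>M) - (\<integral>x. h (T x) \<partial>M) = (\<integral>x. h x - h (T x) \<partial>M)"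
        using h_int by simp
      moreover have "norm (\<integral>x. h x - h (T x) \<partial>M) \<le> (\<integral>x. dist x (T x) \<partial>M)"
        by (rule Bochner_Integration.integral_norm_bound_integral[OF d_int M(4)]) (use close in auto)
      ultimately show ?thesis by simp
    qed
    show ?thesis
      using *[OF \<mu> T(1)] *[OF \<nu> T(2)] S[OF h] T(3,4)
      by (simp add: int_p[symmetric] int_q[symmetric])
  qed
  obtain w where w: "\<And>a b. a \<in> A \<Longrightarrow> b \<in> A \<Longrightarrow> 0 \<le> w a b" "\<And>a. a \<in> A \<Longrightarrow> (\<Sum>b\<in>A. w a b) = p a"
    "\<And>b. b \<in> A \<Longrightarrow> (\<Sum>a\<in>A. w a b) = q b" "(\<Sum>a\<in>A. \<Sum>b\<in>A. w a b * dist a b) \<le> S + 2 * e"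
    using finite_kantorovich_rubinstein[OF A(1) p q discrete] by blast
  have w0: "w a b = 0" if "a \<in> A" "b \<in> A" "p a = 0 \<or> q b = 0" for a b
    using that(3)
  proof
    assume "p a = 0"
    then have "(\<Sum>b\<in>A. w a b) = 0" using w(2) that by simp
    then show ?thesis using w(1) that A by (subst (asm) sum_nonneg_eq_0_iff) auto
  next
    assume "q b = 0"
    then have "(\<Sum>a\<in>A. w a b) = 0" using w(3) that by simp
    then show ?thesis using w(1) that A by (subst (asm) sum_nonneg_eq_0_iff) auto
  qed
  \<comment> \<open>Division by 0 yields 0, so W vanishes on pairs with an empty cell. The plan
    vanishes there as well by \<open>w0\<close>, which is why W times the cell masses recovers w
    without exception.\<close>
  define W where "W a b = w a b / (p a * q b)" for a b
  have W: "0 \<le> W a b" "W a b * p a * q b = w a b" if "a \<in> A" "b \<in> A" for a b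
    using w(1) w0 that p q by (auto simp: W_def)
  define g where "g z = ennreal (W (T (fst z)) (T (snd z)))" for z
  have g: "g \<in> borel_measurable (borel \<Otimes>\<^sub>M borel)"
  proof -
    \<comment> \<open>W is an arbitrary function, so \<open>g\<close> is not measurable by
      composition. The finite range of T makes it a finite sum of indicators of rectangles.\<close>
    have "(\<lambda>z. (\<Sum>a\<in>A. \<Sum>b\<in>A. ennreal (W a b) * indicator (T -` {a}) (fst z) * indicator (T -` {b}) (snd z)))
      \<in> borel_measurable (borel \<Otimes>\<^sub>M borel)"
      using vim by measurable
    also have "(\<lambda>z. (\<Sum>a\<in>A. \<Sum>b\<in>A. ennreal (W a b) * indicator (T -` {a}) (fst z) * indicator (T -` {b}) (snd z))) = g"
    proof
      fix z :: "'a \<times> 'a"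
      have "(\<Sum>a\<in>A. \<Sum>b\<in>A. ennreal (W a b) * indicator (T -` {a}) (fst z) * indicator (T -` {b}) (snd z))
        = (\<Sum>a\<in>A. if a = T (fst z) then (\<Sum>b\<in>A. if b = T (snd z) then ennreal (W a b) else 0) else 0)"
        by (auto intro!: sum.cong sum.neutral simp: indicator_def)
      then show "(\<Sum>a\<in>A. \<Sum>b\<in>A. ennreal (W a b) * indicator (T -` {a}) (fst z) * indicator (T -` {b}) (snd z)) = g z"
        using A by (simp add: g_def)
    qed
    finally show ?thesis .
  qed
  have AE_pos: "AE x in M. measure M (T -` {T x}) \<noteq> 0"
    if M: "prob_space M" "sets M = sets borel" for M
  proof -
    interpret prob_space M by fact
    have "AE x in M. \<forall>a\<in>A. measure M (T -` {a}) = 0 \<longrightarrow> T x \<noteq> a"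
    proof (rule AE_finite_allI[OF A(1)])
      fix a
      show "AE x in M. measure M (T -` {a}) = 0 \<longrightarrow> T x \<noteq> a"
      proof (cases "measure M (T -` {a}) = 0")
        case True
        then have "T -` {a} \<in> null_sets M"
          using vim M(2) by (auto simp: emeasure_eq_measure)
        from AE_not_in[OF this] show ?thesis by eventually_elim auto
      qed simp
    qed
    then show ?thesis using A(2) by auto
  qed
  have "AE x in \<mu>. (\<integral>\<^sup>+y. g (x, y) \<partial>\<nu>) = 1"
    using AE_pos[OF \<mu>(1,2)]
  proof eventually_elim
    case (elim x)
    have "(\<integral>\<^sup>+y. g (x, y) \<partial>\<nu>) = (\<Sum>b\<in>A. ennreal (W (T x) b) * ennreal (q b))"
      by (simp add: g_def nn_q[of "\<lambda>b. ennreal (W (T x) b)"])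
    also have "\<dots> = ennreal (\<Sum>b\<in>A. W (T x) b * q b)"
      using W A q by (simp add: ennreal_mult[symmetric] sum_ennreal)
    also have "(\<Sum>b\<in>A. W (T x) b * q b) = (\<Sum>b\<in>A. w (T x) b / p (T x))"
      using elim w0 A by (intro sum.cong) (auto simp: W_def p_def)
    also have "\<dots> = 1"
      using elim w(2) A by (simp add: sum_divide_distrib[symmetric]) (simp add: p_def)
    finally show ?case by simp
  qed
  moreover have "AE y in \<nu>. (\<integral>\<^sup>+x. g (x, y) \<partial>\<mu>) = 1"
    using AE_pos[OF \<nu>(1,2)]
  proof eventually_elim
    case (elim y)
    have "(\<integral>\<^sup>+x. g (x, y) \<partial>\<mu>) = (\<Sum>a\<in>A. ennreal (W a (T y)) * ennreal (p a))"
      by (simp add: g_def nn_p[of "\<lambda>a. ennreal (W a (T y))"])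
    also have "\<dots> = ennreal (\<Sum>a\<in>A. W a (T y) * p a)"
      using W A p by (simp add: ennreal_mult[symmetric] sum_ennreal)
    also have "(\<Sum>a\<in>A. W a (T y) * p a) = (\<Sum>a\<in>A. w a (T y) / q (T y))"
      using elim w0 A by (intro sum.cong) (auto simp: W_def q_def)
    also have "\<dots> = 1"
      using elim w(3) A by (simp add: sum_divide_distrib[symmetric]) (simp add: q_def)
    finally show ?case by simp
  qed
  ultimately have \<pi>: "density (\<mu> \<Otimes>\<^sub>M \<nu>) g \<in> couplings \<mu> \<nu>"
    using g \<mu> \<nu> by (intro density_pair_in_couplings) auto
  define \<pi> where "\<pi> = density (\<mu> \<Otimes>\<^sub>M \<nu>) g"
  have sets_\<pi>[measurable_cong]: "sets \<pi> = sets (borel \<Otimes>\<^sub>M borel)"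
    and marg: "distr \<pi> borel fst = \<mu>" "distr \<pi> borel snd = \<nu>"
    using \<pi> by (auto simp: couplings_def \<pi>_def)
  note [measurable] = g
  have "wasserstein1 \<mu> \<nu> \<le> (\<integral>\<^sup>+z. ennreal (dist (fst z) (snd z)) \<partial>\<pi>)"
    unfolding wasserstein1_def \<pi>_def by (rule INF_lower[OF \<pi>])
  also have "\<dots> \<le> (\<integral>\<^sup>+z. ennreal (dist (fst z) (T (fst z))) +
      (ennreal (dist (T (fst z)) (T (snd z))) + ennreal (dist (snd z) (T (snd z)))) \<partial>\<pi>)"
  proof (intro nn_integral_mono)
    fix z :: "'a \<times> 'a"
    have "dist (fst z) (snd z) \<le> dist (fst z) (T (fst z)) +
        (dist (T (fst z)) (T (snd z)) + dist (snd z) (T (snd z)))"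
      by metric
    then show "ennreal (dist (fst z) (snd z)) \<le> ennreal (dist (fst z) (T (fst z))) +
      (ennreal (dist (T (fst z)) (T (snd z))) + ennreal (dist (snd z) (T (snd z))))"
      by (simp add: ennreal_plus[symmetric] ennreal_leI del: ennreal_plus)
  qed
  also have "\<dots> = (\<integral>\<^sup>+z. ennreal (dist (fst z) (T (fst z))) \<partial>\<pi>) +
      ((\<integral>\<^sup>+z. ennreal (dist (T (fst z)) (T (snd z))) \<partial>\<pi>) + (\<integral>\<^sup>+z. ennreal (dist (snd z) (T (snd z))) \<partial>\<pi>))"
    by (subst nn_integral_add, measurable, subst nn_integral_add, measurable)
  also have "(\<integral>\<^sup>+z. ennreal (dist (fst z) (T (fst z))) \<partial>\<pi>) = (\<integral>\<^sup>+x. ennreal (dist x (T x)) \<partial>distr \<pi> borel fst)"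
    by (subst nn_integral_distr) auto
  also have "\<dots> = ennreal (\<integral>x. dist x (T x) \<partial>\<mu>)"
    unfolding marg by (intro nn_integral_eq_integral T) auto
  also have "(\<integral>\<^sup>+z. ennreal (dist (snd z) (T (snd z))) \<partial>\<pi>) = (\<integral>\<^sup>+x. ennreal (dist x (T x)) \<partial>distr \<pi> borel snd)"
    by (subst nn_integral_distr) auto
  also have "\<dots> = ennreal (\<integral>x. dist x (T x) \<partial>\<nu>)"
    unfolding marg by (intro nn_integral_eq_integral T) auto
  also have "(\<integral>\<^sup>+z. ennreal (dist (T (fst z)) (T (snd z))) \<partial>\<pi>)
      = (\<integral>\<^sup>+x. \<integral>\<^sup>+y. ennreal (W (T x) (T y)) * ennreal (dist (T x) (T y)) \<partial>\<nu> \<partial>\<mu>)"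
  proof -
    have "(\<integral>\<^sup>+z. ennreal (dist (T (fst z)) (T (snd z))) \<partial>\<pi>)
        = (\<integral>\<^sup>+z. g z * ennreal (dist (T (fst z)) (T (snd z))) \<partial>(\<mu> \<Otimes>\<^sub>M \<nu>))"
      unfolding \<pi>_def by (subst nn_integral_density) auto
    also have "\<dots> = (\<integral>\<^sup>+x. \<integral>\<^sup>+y. g (x, y) * ennreal (dist (T x) (T y)) \<partial>\<nu> \<partial>\<mu>)"
      by (subst \<nu>.nn_integral_fst[symmetric]) auto
    finally show ?thesis by (simp add: g_def)
  qed
  also have "\<dots> = (\<Sum>a\<in>A. (\<Sum>b\<in>A. ennreal (W a b) * ennreal (dist a b) * ennreal (q b)) * ennreal (p a))"
    by (simp add: nn_q[of "\<lambda>b. ennreal (W _ b) * ennreal (dist _ b)"]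
        nn_p[of "\<lambda>a. \<Sum>b\<in>A. ennreal (W a b) * ennreal (dist a b) * ennreal (q b)"])
  also have "\<dots> = (\<Sum>a\<in>A. \<Sum>b\<in>A. ennreal (w a b * dist a b))"
  proof (intro sum.cong refl)
    fix a assume a: "a \<in> A"
    show "(\<Sum>b\<in>A. ennreal (W a b) * ennreal (dist a b) * ennreal (q b)) * ennreal (p a)
      = (\<Sum>b\<in>A. ennreal (w a b * dist a b))"
      unfolding sum_distrib_right
    proof (intro sum.cong refl)
      fix b assume b: "b \<in> A"
      have "ennreal (W a b) * ennreal (dist a b) * ennreal (q b) * ennreal (p a)
        = ennreal (W a b * p a * q b * dist a b)"
        using W(1)[OF a b] p q by (simp add: ennreal_mult[symmetric] mult_ac)
      then show "ennreal (W a b) * ennreal (dist a b) * ennreal (q b) * ennreal (p a)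
        = ennreal (w a b * dist a b)" using W[OF a b] by simp
    qed
  qed
  also have "\<dots> = ennreal (\<Sum>a\<in>A. \<Sum>b\<in>A. w a b * dist a b)"
    using w(1) by (simp add: sum_ennreal sum_nonneg)
  also have "ennreal (\<integral>x. dist x (T x) \<partial>\<mu>) + (ennreal (\<Sum>a\<in>A. \<Sum>b\<in>A. w a b * dist a b)
      + ennreal (\<integral>x. dist x (T x) \<partial>\<nu>)) \<le> ennreal e + (ennreal (S + 2 * e) + ennreal e)"
    using T w(4) by (intro add_mono ennreal_leI) auto
  also have "\<dots> = ennreal S + ennreal e'"
    using \<open>0 < e\<close> \<open>0 \<le> S\<close> by (simp add: ennreal_plus[symmetric] e_def del: ennreal_plus)
  finally show "wasserstein1 \<mu> \<nu> \<le> ennreal S + ennreal e'" .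
qed

lemma wasserstein1_ge:
  fixes \<mu> \<nu> :: "'a::euclidean_space measure"
  assumes \<mu>: "prob_space \<mu>" "sets \<mu> = sets borel" "integrable \<mu> norm"
    and \<nu>: "prob_space \<nu>" "sets \<nu> = sets borel" "integrable \<nu> norm"
    and h: "1-lipschitz_on UNIV h"
  shows "ennreal \<bar>(\<integral>x. h x \<partial>\<mu>) - (\<integral>x. h x \<partial>\<nu>)\<bar> \<le> wasserstein1 \<mu> \<nu>"
  unfolding wasserstein1_def
proof (rule INF_greatest)
  fix \<pi> assume "\<pi> \<in> couplings \<mu> \<nu>"
  then have [measurable_cong]: "sets \<pi> = sets (borel \<Otimes>\<^sub>M borel)" and "prob_space \<pi>"
    and marg: "\<mu> = distr \<pi> borel fst" "\<nu> = distr \<pi> borel snd"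
    by (auto simp: couplings_def)
  have [measurable]: "h \<in> borel_measurable borel"
    using h by (intro borel_measurable_continuous_onI lipschitz_on_continuous_on)
  have "integrable \<mu> h" "integrable \<nu> h"
    using \<mu> \<nu> h by (auto intro: integrable_lipschitz)
  then have int: "integrable \<pi> (\<lambda>z. h (fst z))" "integrable \<pi> (\<lambda>z. h (snd z))"
    unfolding marg by (auto simp: integrable_distr_eq)
  have "(\<integral>x. h x \<partial>\<mu>) - (\<integral>x. h x \<partial>\<nu>) = (\<integral>z. h (fst z) - h (snd z) \<partial>\<pi>)"
    unfolding marg using int by (simp add: integral_distr)
  then have "ennreal \<bar>(\<integral>x. h x \<partial>\<mu>) - (\<integral>x. h x \<partial>\<nu>)\<bar> \<le> (\<integral>\<^sup>+z. ennreal (norm (h (fst z) - h (snd z))) \<partial>\<pi>)"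
    using integral_norm_bound_ennreal[of \<pi> "\<lambda>z. h (fst z) - h (snd z)"] int by simp
  also have "\<dots> \<le> (\<integral>\<^sup>+z. ennreal (dist (fst z) (snd z)) \<partial>\<pi>)"
    using lipschitz_onD[OF h] by (intro nn_integral_mono ennreal_leI) (simp add: dist_real_def)
  finally show "ennreal \<bar>(\<integral>x. h x \<partial>\<mu>) - (\<integral>x. h x \<partial>\<nu>)\<bar> \<le> (\<integral>\<^sup>+z. ennreal (dist (fst z) (snd z)) \<partial>\<pi>)" .
qed

subsection \<open>Gaussian smoothing as a map into bounded functionals\<close>

lemma distr_lborel_reflect: "distr lborel borel (\<lambda>y. x - y) = (lborel :: 'a::euclidean_space measure)"
proof -
  have "lborel = density (distr lborel borel (\<lambda>y. x + (- 1) *\<^sub>R y)) (\<lambda>_. ennreal (\<bar>- 1 :: real\<bar> ^ DIM('a)))"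
    using lborel_affine[of "- 1" x] by simp
  also have "\<dots> = distr lborel borel (\<lambda>y. x - y)"
    by (simp add: density_1)
  finally show ?thesis by simp
qed

lemma integral_lborel_reflect:
  fixes F :: "'a::euclidean_space \<Rightarrow> real"
  assumes [measurable]: "F \<in> borel_measurable borel"
  shows "(\<integral>y. F (x - y) \<partial>lborel) = (\<integral>y. F y \<partial>lborel)"
  by (subst (2) distr_lborel_reflect[of x, symmetric], subst integral_distr) auto

lemma gauss_density_minus [simp]: "gauss_density \<sigma> (- x) = gauss_density \<sigma> x"
  by (simp add: gauss_density_def)

lemma gauss_density_minus_commute: "gauss_density \<sigma> (x - y) = gauss_density \<sigma> (y - x)"
  using gauss_density_minus[of \<sigma> "x - y"] by simp

lemma sets_gauss_measure [simp, measurable_cong]: "sets (gauss_measure \<sigma>) = sets borel"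
  by (simp add: gauss_measure_def)

lemma space_gauss_measure [simp]: "space (gauss_measure \<sigma>) = UNIV"
  by (simp add: gauss_measure_def)

lemma borel_measurable_lip [measurable]: "lip_fun f \<in> borel_measurable borel"
  using lip_fun[of f] by (intro borel_measurable_continuous_onI) (auto intro: lipschitz_on_continuous_on)

lemma lip_fun_lipschitz: "1-lipschitz_on UNIV (lip_fun f)" and lip_fun_0 [simp]: "lip_fun f 0 = 0"
  using lip_fun[of f] by auto

lemma lip_fun_bound: "\<bar>lip_fun f x\<bar> \<le> norm x"
  using lipschitz_onD[OF lip_fun_lipschitz, of x 0 f] by (simp add: dist_real_def)

lemma borel_measurable_lipschitz:
  fixes h :: "'a::metric_space \<Rightarrow> 'b::metric_space"
  shows "C-lipschitz_on UNIV h \<Longrightarrow> h \<in> borel_measurable borel"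
  by (intro borel_measurable_continuous_onI lipschitz_on_continuous_on)

lemma lipschitz_on_abs:
  fixes h :: "'a::metric_space \<Rightarrow> real"
  assumes "C-lipschitz_on U h"
  shows "C-lipschitz_on U (\<lambda>x. \<bar>h x\<bar>)"
proof (rule lipschitz_onI)
  fix x y assume "x \<in> U" "y \<in> U"
  then have "\<bar>h x - h y\<bar> \<le> C * dist x y"
    using lipschitz_onD[OF assms] by (simp add: dist_real_def)
  then show "dist \<bar>h x\<bar> \<bar>h y\<bar> \<le> C * dist x y"
    unfolding dist_real_def by linarith
qed (rule lipschitz_on_nonneg[OF assms])

text \<open>The Lebesgue density of the convolution of Q with the Gaussian; the evenness of the
  kernel allows the argument x - z.\<close>

definition smoothed_density :: "real \<Rightarrow> (real ^ 'd) measure \<Rightarrow> real ^ 'd \<Rightarrow> real" where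
  "smoothed_density \<sigma> Q z = (\<integral>x. gauss_density \<sigma> (x - z) \<partial>Q)"

context
  fixes \<sigma> :: real
  assumes \<sigma>: "\<sigma> > 0"
begin

lemma integrable_norm_gauss: "integrable (gauss_measure \<sigma> :: (real ^ 'd) measure) norm"
proof -
  have "integrable lborel (\<lambda>x :: real ^ 'd. gauss_density \<sigma> x *\<^sub>R norm x)"
  proof (rule Bochner_Integration.integrable_bound[OF integrable_gauss_density_moment[OF \<sigma>]])
    show "AE x in lborel. norm (gauss_density \<sigma> x *\<^sub>R norm x)
        \<le> norm ((1 + norm x) * gauss_density \<sigma> (x :: real ^ 'd))"
      by (rule AE_I2) (simp add: abs_mult gauss_density_nonneg algebra_simps)
  qed measurable
  then show ?thesis
    unfolding gauss_measure_def by (subst integrable_density) (auto simp: gauss_density_nonneg)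
qed

lemma gauss_smooth_eq_density:
  fixes h :: "real ^ 'd \<Rightarrow> real"
  assumes [measurable]: "h \<in> borel_measurable borel"
  shows "gauss_smooth \<sigma> h x = (\<integral>z. h z * gauss_density \<sigma> (x - z) \<partial>lborel)"
  unfolding gauss_smooth_def
  using integral_lborel_reflect[of "\<lambda>z. h z * gauss_density \<sigma> (x - z)" x] by simp

text \<open>By symmetry of the Gaussian, smoothing is the mean of h under translation by a random
  vector. Lipschitz constants are then visibly preserved, because a translation does not change
  them.\<close>

lemma gauss_smooth_eq_plus:
  fixes h :: "real ^ 'd \<Rightarrow> real"
  assumes [measurable]: "h \<in> borel_measurable borel"
  shows "gauss_smooth \<sigma> h x = (\<integral>y. h (x + y) \<partial>gauss_measure \<sigma>)"
proof -
  have "(\<integral>y. h (x + y) \<partial>gauss_measure \<sigma>) = (\<integral>y. gauss_density \<sigma> y * h (x + y) \<partial>lborel)"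
    unfolding gauss_measure_def by (subst integral_density) (auto simp: gauss_density_nonneg)
  also have "\<dots> = (\<integral>y. gauss_density \<sigma> (0 - y) * h (x + (0 - y)) \<partial>lborel)"
    by (subst integral_lborel_reflect) auto
  finally show ?thesis by (simp add: gauss_smooth_def mult.commute)
qed

lemma integrable_gauss_lipschitz:
  fixes h :: "real ^ 'd \<Rightarrow> real"
  assumes "1-lipschitz_on UNIV h"
  shows "integrable (gauss_measure \<sigma>) (\<lambda>y. h (x + y))"
proof (rule integrable_lipschitz[OF prob_space_gauss_measure[OF \<sigma>] _ integrable_norm_gauss])
  show "1-lipschitz_on UNIV (\<lambda>y. h (x + y))"
    using lipschitz_onD[OF assms, of "x + y" "x + z" for y z] by (intro lipschitz_onI) auto
qed simp

lemma gauss_smooth_lipschitz: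
  fixes h :: "real ^ 'd \<Rightarrow> real"
  assumes h: "1-lipschitz_on UNIV h"
  shows "1-lipschitz_on UNIV (gauss_smooth \<sigma> h)"
proof (rule lipschitz_onI)
  fix x y :: "real ^ 'd"
  interpret G: prob_space "gauss_measure \<sigma> :: (real ^ 'd) measure"
    by (rule prob_space_gauss_measure[OF \<sigma>])
  note [measurable] = borel_measurable_lipschitz[OF h]
  have "norm (\<integral>z. h (x + z) - h (y + z) \<partial>gauss_measure \<sigma>) \<le> (\<integral>z. dist x y \<partial>(gauss_measure \<sigma> :: (real ^ 'd) measure))"
    using integrable_gauss_lipschitz[OF h] lipschitz_onD[OF h, of "x + z" "y + z" for z]
    by (intro Bochner_Integration.integral_norm_bound_integral) (auto simp: dist_real_def)
  then show "dist (gauss_smooth \<sigma> h x) (gauss_smooth \<sigma> h y) \<le> 1 * dist x y"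
    using integrable_gauss_lipschitz[OF h] G.prob_space
    by (simp add: gauss_smooth_eq_plus dist_real_def)
qed simp

lemma borel_measurable_gauss_smooth [measurable]:
  "gauss_smooth \<sigma> (lip_fun (f :: 'd::finite lip10)) \<in> borel_measurable borel"
  by (rule borel_measurable_lipschitz[OF gauss_smooth_lipschitz[OF lip_fun_lipschitz]])

lemma integral_convolution_gauss:
  fixes Q :: "(real ^ 'd) measure"
  assumes Q: "prob_space Q" "sets Q = sets borel" "integrable Q norm"
  shows "prob_space (Q \<star> gauss_measure \<sigma>)" "integrable (Q \<star> gauss_measure \<sigma>) norm"
    and "1-lipschitz_on UNIV h \<Longrightarrow> (\<integral>x. h x \<partial>(Q \<star> gauss_measure \<sigma>)) = (\<integral>x. gauss_smooth \<sigma> h x \<partial>Q)"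
proof -
  interpret Q: prob_space Q by fact
  interpret G: prob_space "gauss_measure \<sigma> :: (real ^ 'd) measure"
    by (rule prob_space_gauss_measure[OF \<sigma>])
  interpret pair_prob_space Q "gauss_measure \<sigma> :: (real ^ 'd) measure" ..
  note [measurable_cong] = Q(2)
  show "prob_space (Q \<star> gauss_measure \<sigma>)"
    unfolding convolution_def by (rule prob_space_distr) measurable
  have int: "integrable (Q \<Otimes>\<^sub>M gauss_measure \<sigma>) (\<lambda>(x, y). h (x + y))"
    if h: "1-lipschitz_on UNIV h" for h :: "real ^ 'd \<Rightarrow> real"
  proof (rule Fubini_integrable)
    note [measurable] = borel_measurable_lipschitz[OF h]
    show "(\<lambda>(x, y). h (x + y)) \<in> borel_measurable (Q \<Otimes>\<^sub>M gauss_measure \<sigma>)" by measurable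
    \<comment> \<open>Absolute integrability for Fubini costs nothing extra: the absolute value of h
      is again 1-Lipschitz, hence so is its smoothing, and Lipschitz functions are integrable by the
      first moment.\<close>
    have "integrable Q (gauss_smooth \<sigma> (\<lambda>x. \<bar>h x\<bar>))"
      using Q gauss_smooth_lipschitz[OF lipschitz_on_abs[OF h]] by (rule integrable_lipschitz)
    then show "integrable Q (\<lambda>x. \<integral>y. norm (case (x, y) of (x, y) \<Rightarrow> h (x + y)) \<partial>gauss_measure \<sigma>)"
      by (subst (asm) ext[OF gauss_smooth_eq_plus]) simp_all
  qed (use integrable_gauss_lipschitz[OF h] in auto)
  show "integrable (Q \<star> gauss_measure \<sigma>) norm"
    unfolding convolution_def using int[of norm]
    by (subst integrable_distr_eq) (auto simp: split_beta' lipschitz_on_def dist_real_def dist_norm norm_triangle_ineq3)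
  show "(\<integral>x. h x \<partial>(Q \<star> gauss_measure \<sigma>)) = (\<integral>x. gauss_smooth \<sigma> h x \<partial>Q)" if h: "1-lipschitz_on UNIV h"
  proof -
    note [measurable] = borel_measurable_lipschitz[OF h]
    have "(\<integral>x. h x \<partial>(Q \<star> gauss_measure \<sigma>)) = (\<integral>z. (case z of (x, y) \<Rightarrow> h (x + y)) \<partial>(Q \<Otimes>\<^sub>M gauss_measure \<sigma>))"
      unfolding convolution_def by (subst integral_distr) (auto simp: split_beta')
    also have "\<dots> = (\<integral>x. \<integral>y. h (x + y) \<partial>gauss_measure \<sigma> \<partial>Q)"
      using int[OF h] by (subst integral_fst'[symmetric]) auto
    finally show ?thesis by (simp add: gauss_smooth_eq_plus)
  qed
qed

text \<open>Duality ranges over all 1-Lipschitz functions while the index set contains only those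
  vanishing at 0. Subtracting the constant h 0 reconciles the two, since constants cancel between
  probability measures.\<close>

lemma smoothed_wasserstein1_eq_norm:
  fixes \<mu> \<nu> :: "(real ^ 'd) measure"
  assumes \<mu>: "prob_space \<mu>" "sets \<mu> = sets borel" "integrable \<mu> norm"
    and \<nu>: "prob_space \<nu>" "sets \<nu> = sets borel" "integrable \<nu> norm"
  shows "smoothed_wasserstein1 \<sigma> \<mu> \<nu> = ennreal (norm (smoothed_functional \<sigma> \<mu> - smoothed_functional \<sigma> \<nu>))"
    (is "_ = ennreal (norm ?z)")
proof (rule antisym)
  have z: "?z f = (\<integral>x. lip_fun f x \<partial>(\<mu> \<star> gauss_measure \<sigma>)) - (\<integral>x. lip_fun f x \<partial>(\<nu> \<star> gauss_measure \<sigma>))" for f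
    by (simp add: smoothed_functional_apply[OF \<sigma> \<mu>] smoothed_functional_apply[OF \<sigma> \<nu>]
        integral_convolution_gauss[OF \<mu>] integral_convolution_gauss[OF \<nu>] lip_fun_lipschitz)
  have int: "integrable (\<mu> \<star> gauss_measure \<sigma>) h" "integrable (\<nu> \<star> gauss_measure \<sigma>) h"
    if "1-lipschitz_on UNIV h" for h :: "real ^ 'd \<Rightarrow> real"
    using integrable_lipschitz[OF _ _ _ that] integral_convolution_gauss(1,2)[OF \<mu>]
      integral_convolution_gauss(1,2)[OF \<nu>] by auto
  interpret \<mu>: prob_space "\<mu> \<star> gauss_measure \<sigma>" by (rule integral_convolution_gauss[OF \<mu>])
  interpret \<nu>: prob_space "\<nu> \<star> gauss_measure \<sigma>" by (rule integral_convolution_gauss[OF \<nu>])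
  show "smoothed_wasserstein1 \<sigma> \<mu> \<nu> \<le> ennreal (norm ?z)"
    unfolding smoothed_wasserstein1_def
  proof (rule wasserstein1_le)
    fix h :: "real ^ 'd \<Rightarrow> real" assume h: "1-lipschitz_on UNIV h"
    define f where "f = Abs_lip10 (\<lambda>x. h x - h 0)"
    have "1-lipschitz_on UNIV (\<lambda>x. h x - h 0)"
      using lipschitz_onD[OF h] by (intro lipschitz_onI) (auto simp: dist_real_def)
    then have "lip_fun f = (\<lambda>x. h x - h 0)"
      unfolding f_def by (intro Abs_lip10_inverse) auto
    then have "?z f = (\<integral>x. h x \<partial>(\<mu> \<star> gauss_measure \<sigma>)) - (\<integral>x. h x \<partial>(\<nu> \<star> gauss_measure \<sigma>))"
      using int[OF h] \<mu>.prob_space \<nu>.prob_space unfolding z by simp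
    then show "(\<integral>x. h x \<partial>(\<mu> \<star> gauss_measure \<sigma>)) - (\<integral>x. h x \<partial>(\<nu> \<star> gauss_measure \<sigma>)) \<le> norm ?z"
      using norm_bounded[of ?z f] by simp
  qed (use \<mu> \<nu> integral_convolution_gauss in auto)
  have bound: "ennreal \<bar>?z f\<bar> \<le> smoothed_wasserstein1 \<sigma> \<mu> \<nu>" for f
    unfolding smoothed_wasserstein1_def z
    by (rule wasserstein1_ge) (use \<mu> \<nu> integral_convolution_gauss lip_fun_lipschitz in auto)
  show "ennreal (norm ?z) \<le> smoothed_wasserstein1 \<sigma> \<mu> \<nu>"
  proof (cases "smoothed_wasserstein1 \<sigma> \<mu> \<nu>")
    case (real r)
    then have "norm ?z \<le> r"
      using bound by (intro norm_bound) simp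
    then show ?thesis using real by (simp add: ennreal_leI)
  qed simp
qed

text \<open>Fubini moves the smoothing from the test function to the measure. The test function then
  appears as a bare factor against a fixed density, so a pointwise bound on it gives an estimate
  uniform over the whole index set.\<close>

lemma integral_gauss_smooth:
  fixes Q :: "(real ^ 'd) measure" and h :: "real ^ 'd \<Rightarrow> real"
  assumes Q: "prob_space Q" "sets Q = sets borel" "integrable Q norm" and h: "1-lipschitz_on UNIV h"
  shows "integrable lborel (\<lambda>z. h z * smoothed_density \<sigma> Q z)"
    and "(\<integral>x. gauss_smooth \<sigma> h x \<partial>Q) = (\<integral>z. h z * smoothed_density \<sigma> Q z \<partial>lborel)"
proof -
  interpret Q: prob_space Q by fact
  interpret pair_sigma_finite Q "lborel :: (real ^ 'd) measure" ..
  note [measurable_cong] = Q(2)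
  note [measurable] = borel_measurable_lipschitz[OF h]
  have int: "integrable lborel (\<lambda>z. g z * gauss_density \<sigma> (x - z))"
    if g: "1-lipschitz_on UNIV g" for g :: "real ^ 'd \<Rightarrow> real" and x
  proof -
    note [measurable] = borel_measurable_lipschitz[OF g]
    have "integrable (gauss_measure \<sigma>) (\<lambda>y. g (x + y))" by (rule integrable_gauss_lipschitz[OF g])
    then have "integrable lborel (\<lambda>y. gauss_density \<sigma> y * g (x + y))"
      unfolding gauss_measure_def by (subst (asm) integrable_density) (auto simp: gauss_density_nonneg)
    then have "integrable (distr lborel borel ((+) (- x))) (\<lambda>y. gauss_density \<sigma> y * g (x + y))"
      by (simp add: lborel_distr_plus)
    then have "integrable lborel (\<lambda>z. gauss_density \<sigma> (z - x) * g z)"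
      by (subst (asm) integrable_distr_eq) auto
    then show ?thesis by (simp add: mult.commute gauss_density_minus_commute)
  qed
  have pair: "integrable (Q \<Otimes>\<^sub>M lborel) (\<lambda>(x, z). h z * gauss_density \<sigma> (x - z))"
  proof (rule Fubini_integrable)
    have "integrable Q (gauss_smooth \<sigma> (\<lambda>x. \<bar>h x\<bar>))"
      using Q gauss_smooth_lipschitz[OF lipschitz_on_abs[OF h]] by (rule integrable_lipschitz)
    then show "integrable Q (\<lambda>x. \<integral>y. norm (case (x, y) of (x, z) \<Rightarrow> h z * gauss_density \<sigma> (x - z)) \<partial>lborel)"
      by (subst (asm) ext[OF gauss_smooth_eq_density]) (simp_all add: abs_mult gauss_density_nonneg)
  qed (use int[OF h] in auto)
  show "integrable lborel (\<lambda>z. h z * smoothed_density \<sigma> Q z)"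
    using integrable_snd[OF pair] by (simp add: smoothed_density_def)
  show "(\<integral>x. gauss_smooth \<sigma> h x \<partial>Q) = (\<integral>z. h z * smoothed_density \<sigma> Q z \<partial>lborel)"
    using Fubini_integral[OF pair] by (simp add: gauss_smooth_eq_density smoothed_density_def)
qed

text \<open>Serves two purposes: with \<open>zero_lip\<close> for g and the norm as weight it bounds
  the norm of u, and with a coarsened index for g it bounds the error of coarsening.\<close>

lemma smoothed_functional_diff_bound:
  fixes \<mu> \<nu> :: "(real ^ 'd) measure"
  assumes \<mu>: "prob_space \<mu>" "sets \<mu> = sets borel" "integrable \<mu> norm"
    and \<nu>: "prob_space \<nu>" "sets \<nu> = sets borel" "integrable \<nu> norm"
    and w: "\<And>z. \<bar>lip_fun f z - lip_fun g z\<bar> \<le> w z"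
  defines "u \<equiv> smoothed_functional \<sigma> \<mu> - smoothed_functional \<sigma> \<nu>"
  shows "ennreal \<bar>u f - u g\<bar> \<le> (\<integral>\<^sup>+z. ennreal (w z * \<bar>smoothed_density \<sigma> \<mu> z - smoothed_density \<sigma> \<nu> z\<bar>) \<partial>lborel)"
proof -
  note I = integral_gauss_smooth[OF _ _ _ lip_fun_lipschitz]
  have int: "integrable lborel (\<lambda>z. (lip_fun f z - lip_fun g z) * (smoothed_density \<sigma> \<mu> z - smoothed_density \<sigma> \<nu> z))"
    using I(1)[OF \<mu>, of f] I(1)[OF \<nu>, of f] I(1)[OF \<mu>, of g] I(1)[OF \<nu>, of g]
    by (simp add: algebra_simps)
  have "u f - u g = (\<integral>z. (lip_fun f z - lip_fun g z) * (smoothed_density \<sigma> \<mu> z - smoothed_density \<sigma> \<nu> z) \<partial>lborel)"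
    using I(1)[OF \<mu>, of f] I(1)[OF \<nu>, of f] I(1)[OF \<mu>, of g] I(1)[OF \<nu>, of g]
    by (simp add: u_def smoothed_functional_apply[OF \<sigma> \<mu>] smoothed_functional_apply[OF \<sigma> \<nu>]
        I(2)[OF \<mu>] I(2)[OF \<nu>] algebra_simps)
  then have "ennreal \<bar>u f - u g\<bar> \<le> (\<integral>\<^sup>+z. ennreal (norm ((lip_fun f z - lip_fun g z) *
      (smoothed_density \<sigma> \<mu> z - smoothed_density \<sigma> \<nu> z))) \<partial>lborel)"
    using integral_norm_bound_ennreal[OF int] by simp
  also have "\<dots> \<le> (\<integral>\<^sup>+z. ennreal (w z * \<bar>smoothed_density \<sigma> \<mu> z - smoothed_density \<sigma> \<nu> z\<bar>) \<partial>lborel)"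
    using w by (intro nn_integral_mono ennreal_leI) (auto simp: abs_mult intro!: mult_right_mono)
  finally show ?thesis .
qed

end

subsection \<open>Empirical measures\<close>

lemma
  fixes x :: "nat \<Rightarrow> 'a::topological_space"
  assumes n: "n \<ge> 1"
  shows prob_space_empirical_measure: "prob_space (empirical_measure n x)"
    and sets_empirical_measure: "sets (empirical_measure n x) = sets borel"
    and integrable_empirical_measure:
      "(h :: 'a \<Rightarrow> real) \<in> borel_measurable borel \<Longrightarrow> integrable (empirical_measure n x) h"
    and integral_empirical_measure:
      "(h :: 'a \<Rightarrow> real) \<in> borel_measurable borel \<Longrightarrow>
        (\<integral>y. h y \<partial>empirical_measure n x) = (\<Sum>i<n. h (x i)) / n"
proof -
  have ne: "{..<n} \<noteq> {}" using n by (auto simp: lessThan_empty_iff)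
  interpret U: prob_space "uniform_count_measure {..<n}"
    using ne by (intro prob_space_uniform_count_measure) auto
  have sets: "sets (uniform_count_measure {..<n}) = Pow {..<n}"
    and sp: "space (uniform_count_measure {..<n}) = {..<n}"
    by (simp_all add: sets_uniform_count_measure space_uniform_count_measure)
  have gm: "g \<in> uniform_count_measure {..<n} \<rightarrow>\<^sub>M borel" for g :: "nat \<Rightarrow> 'c::topological_space"
    by (auto simp: measurable_def sets sp)
  show "prob_space (empirical_measure n x)"
    unfolding empirical_measure_def by (intro U.prob_space_distr gm)
  show "sets (empirical_measure n x) = sets borel"
    by (simp add: empirical_measure_def)
  assume h: "h \<in> borel_measurable borel"
  show "integrable (empirical_measure n x) h"
    unfolding empirical_measure_def
  proof (subst integrable_distr_eq[OF gm h])
    show "integrable (uniform_count_measure {..<n}) (\<lambda>i. h (x i))"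
      by (rule U.integrable_const_bound[where B="\<Sum>i<n. \<bar>h (x i)\<bar>"])
        (auto simp: sp gm intro!: AE_I2 member_le_sum[where f="\<lambda>i. \<bar>h (x i)\<bar>"])
  qed
  show "(\<integral>y. h y \<partial>empirical_measure n x) = (\<Sum>i<n. h (x i)) / n"
    unfolding empirical_measure_def
    by (subst integral_distr[OF gm h]) (simp add: integral_uniform_count_measure)
qed

text \<open>The functional of a point mass. These are the summands of the empirical functional and
  the source of its continuity in the sample.\<close>

definition point_functional :: "real \<Rightarrow> real ^ 'd \<Rightarrow> 'd::finite linf_lip10" where
  "point_functional \<sigma> y = smoothed_functional \<sigma> (return borel y)"

definition empirical_functional :: "real \<Rightarrow> nat \<Rightarrow> (nat \<Rightarrow> real ^ 'd) \<Rightarrow> 'd::finite linf_lip10" where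
  "empirical_functional \<sigma> n x = smoothed_functional \<sigma> (empirical_measure n x)"

text \<open>A base point of the index set at which smoothed functionals vanish, so that a value of a
  functional can be read as a difference of two values.\<close>

definition zero_lip :: "'d::finite lip10" where
  "zero_lip = Abs_lip10 (\<lambda>_. 0)"

text \<open>The root mean square of the Gaussian kernel at z. Divided by the root of the sample
  size, it bounds the mean absolute error of the empirical density at z.\<close>

definition root_kernel :: "real \<Rightarrow> (real ^ 'd) measure \<Rightarrow> real ^ 'd \<Rightarrow> real" where
  "root_kernel \<sigma> Q z = sqrt (\<integral>x. (gauss_density \<sigma> (x - z))\<^sup>2 \<partial>Q)"

section \<open>Mean absolute deviation of sample means\<close>

lemma (in prob_space) expectation_abs_le_sqrt:
  fixes Z :: "'a \<Rightarrow> real"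
  assumes [measurable]: "Z \<in> borel_measurable M" and sq: "integrable M (\<lambda>\<omega>. (Z \<omega>)\<^sup>2)"
  shows "expectation (\<lambda>\<omega>. \<bar>Z \<omega>\<bar>) \<le> sqrt (expectation (\<lambda>\<omega>. (Z \<omega>)\<^sup>2))"
proof (rule real_le_rsqrt)
  have "integrable M (\<lambda>\<omega>. \<bar>Z \<omega>\<bar>)"
    by (rule integrable_abs[OF square_integrable_imp_integrable[OF _ sq]]) simp
  then have "0 \<le> expectation (\<lambda>\<omega>. \<bar>Z \<omega>\<bar>\<^sup>2) - (expectation (\<lambda>\<omega>. \<bar>Z \<omega>\<bar>))\<^sup>2"
    using variance_positive[of "\<lambda>\<omega>. \<bar>Z \<omega>\<bar>"] sq by (subst (asm) variance_eq) auto
  then show "(expectation (\<lambda>\<omega>. \<bar>Z \<omega>\<bar>))\<^sup>2 \<le> expectation (\<lambda>\<omega>. (Z \<omega>)\<^sup>2)" by simp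
qed

text \<open>Independence removes the off-diagonal products from the square of the centred sum, and
  each diagonal term is a variance. It is bounded by the raw second moment, which is simpler to
  integrate over z later. Boundedness of u supplies the integrability of all products.\<close>

lemma (in prob_space) expectation_sample_mean_deviation:
  fixes u :: "'b::topological_space \<Rightarrow> real" and n :: nat
  assumes n: "n \<ge> 1" and indep: "indep_vars (\<lambda>_. borel) V {..<n}"
    and Q: "\<And>i. i < n \<Longrightarrow> distr M borel (V i) = Q"
    and [measurable]: "u \<in> borel_measurable borel" and bounded: "\<And>x. \<bar>u x\<bar> \<le> B"
  shows "expectation (\<lambda>\<omega>. \<bar>(\<Sum>i<n. u (V i \<omega>)) / n - (\<integral>x. u x \<partial>Q)\<bar>) \<le> sqrt ((\<integral>x. (u x)\<^sup>2 \<partial>Q) / n)"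
proof -
  have V[measurable]: "V i \<in> borel_measurable M" if "i < n" for i
    using indep that by (auto simp: indep_vars_def2)
  define a where "a = (\<integral>x. u x \<partial>Q)"
  define c where "c i \<omega> = u (V i \<omega>) - a" for i \<omega>
  have mc[measurable]: "c i \<in> borel_measurable M" if "i < n" for i
    unfolding c_def using that by measurable
  have sq_le: "(u x)\<^sup>2 \<le> B\<^sup>2" for x
    using power_mono[OF bounded[of x], of 2] by simp
  have uV: "integrable M (\<lambda>\<omega>. u (V i \<omega>))" "integrable M (\<lambda>\<omega>. (u (V i \<omega>))\<^sup>2)" if "i < n" for i
  proof -
    note [measurable] = V[OF that]
    show "integrable M (\<lambda>\<omega>. u (V i \<omega>))"
      by (rule integrable_const_bound[where B=B]) (simp_all add: bounded)
    show "integrable M (\<lambda>\<omega>. (u (V i \<omega>))\<^sup>2)"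
      by (rule integrable_const_bound[where B="B\<^sup>2"]) (simp_all add: sq_le)
  qed
  have Eu: "expectation (\<lambda>\<omega>. u (V i \<omega>)) = a" "expectation (\<lambda>\<omega>. (u (V i \<omega>))\<^sup>2) = (\<integral>x. (u x)\<^sup>2 \<partial>Q)"
    if "i < n" for i
    using V[OF that] unfolding a_def Q[OF that, symmetric] by (simp_all add: integral_distr)
  have cint: "integrable M (c i)" if "i < n" for i
    unfolding c_def using uV[OF that] by simp
  have c0: "expectation (c i) = 0" if "i < n" for i
    unfolding c_def using uV[OF that] Eu[OF that] by (simp add: prob_space)
  have c2: "expectation (\<lambda>\<omega>. (c i \<omega>)\<^sup>2) \<le> (\<integral>x. (u x)\<^sup>2 \<partial>Q)" if "i < n" for i
    using variance_eq[OF uV(1)[OF that] uV(2)[OF that]] Eu[OF that] by (simp add: c_def)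
  have cc: "integrable M (\<lambda>\<omega>. c i \<omega> * c j \<omega>)" if "i < n" "j < n" for i j
  proof (rule integrable_const_bound[where B="(B + \<bar>a\<bar>) * (B + \<bar>a\<bar>)"])
    have "\<bar>c i \<omega>\<bar> \<le> B + \<bar>a\<bar>" for i \<omega>
      using bounded[of "V i \<omega>"] by (simp add: c_def)
    then show "AE \<omega> in M. norm (c i \<omega> * c j \<omega>) \<le> (B + \<bar>a\<bar>) * (B + \<bar>a\<bar>)"
      by (intro AE_I2) (auto simp: abs_mult intro!: mult_mono order_trans[OF abs_ge_zero])
  qed (use that in measurable)
  have indep_c: "indep_vars (\<lambda>_. borel) c {..<n}"
    using indep_vars_compose2[OF indep, of "\<lambda>_ x. u x - a" "\<lambda>_. borel"] by (simp add: c_def[abs_def])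
  have cross: "expectation (\<lambda>\<omega>. c i \<omega> * c j \<omega>) = 0" if "i < n" "j < n" "i \<noteq> j" for i j
    using indep_vars_lebesgue_integral[of "{i, j}" c] indep_vars_subset[OF indep_c, of "{i, j}"] that cint c0
    by auto
  define Z where "Z \<omega> = (\<Sum>i<n. c i \<omega>)" for \<omega>
  have Z: "(\<Sum>i<n. u (V i \<omega>)) / n - a = Z \<omega> / n" for \<omega>
    using n by (simp add: Z_def c_def sum_subtractf field_simps)
  have Z2: "(Z \<omega>)\<^sup>2 = (\<Sum>i<n. \<Sum>j<n. c i \<omega> * c j \<omega>)" for \<omega>
    by (simp add: Z_def power2_eq_square sum_product)
  have int2: "integrable M (\<lambda>\<omega>. (Z \<omega>)\<^sup>2)"
    unfolding Z2 using cc by (intro Bochner_Integration.integrable_sum) auto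
  have "expectation (\<lambda>\<omega>. (Z \<omega>)\<^sup>2) = (\<Sum>i<n. \<Sum>j<n. expectation (\<lambda>\<omega>. c i \<omega> * c j \<omega>))"
    unfolding Z2 using cc by (subst Bochner_Integration.integral_sum; (intro Bochner_Integration.integrable_sum sum.cong refl)?;
      (subst Bochner_Integration.integral_sum)?) auto
  also have "\<dots> = (\<Sum>i<n. \<Sum>j<n. if j = i then expectation (\<lambda>\<omega>. (c i \<omega>)\<^sup>2) else 0)"
    using cross by (intro sum.cong) (auto simp: power2_eq_square)
  also have "\<dots> = (\<Sum>i<n. expectation (\<lambda>\<omega>. (c i \<omega>)\<^sup>2))" by simp
  also have "\<dots> \<le> (\<Sum>i<n. (\<integral>x. (u x)\<^sup>2 \<partial>Q))"
    using c2 by (intro sum_mono) auto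
  finally have EZ2: "expectation (\<lambda>\<omega>. (Z \<omega>)\<^sup>2) \<le> n * (\<integral>x. (u x)\<^sup>2 \<partial>Q)" by simp
  have "expectation (\<lambda>\<omega>. \<bar>Z \<omega> / n\<bar>) \<le> sqrt (expectation (\<lambda>\<omega>. (Z \<omega> / n)\<^sup>2))"
    using int2 by (intro expectation_abs_le_sqrt) (auto simp: power_divide Z_def)
  also have "expectation (\<lambda>\<omega>. (Z \<omega> / n)\<^sup>2) = expectation (\<lambda>\<omega>. (Z \<omega>)\<^sup>2) / (real n)\<^sup>2"
    by (simp add: power_divide)
  also have "\<dots> \<le> n * (\<integral>x. (u x)\<^sup>2 \<partial>Q) / (real n)\<^sup>2"
    using EZ2 by (intro divide_right_mono) auto
  also have "\<dots> = (\<integral>x. (u x)\<^sup>2 \<partial>Q) / n" using n by (simp add: power2_eq_square)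
  finally show ?thesis unfolding a_def[symmetric] Z by simp
qed

text \<open>The inner sample lives on a product space rather than on an abstract probability space.
  With this, the deviation bound for independent variables covers the data and the inner sample
  alike.\<close>

lemma indep_vars_PiM_coordinates:
  assumes "prob_space Q" "sets Q = sets borel" "n \<ge> (1::nat)"
  shows "prob_space (\<Pi>\<^sub>M i\<in>{..<n}. Q)"
    and "prob_space.indep_vars (\<Pi>\<^sub>M i\<in>{..<n}. Q) (\<lambda>_. borel) (\<lambda>i y. y i) {..<n}"
    and "i < n \<Longrightarrow> distr (\<Pi>\<^sub>M i\<in>{..<n}. Q) borel (\<lambda>y. y i) = Q"
proof -
  interpret Q: prob_space Q by fact
  show PiM: "prob_space (\<Pi>\<^sub>M i\<in>{..<n}. Q)" by (rule prob_space_PiM) (rule assms(1))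
  then interpret PiM: prob_space "\<Pi>\<^sub>M i\<in>{..<n}. Q" .
  have comp: "distr (\<Pi>\<^sub>M i\<in>{..<n}. Q) borel (\<lambda>y. y i) = Q" if "i < n" for i
  proof -
    have "distr (\<Pi>\<^sub>M i\<in>{..<n}. Q) borel (\<lambda>y. y i) = distr (\<Pi>\<^sub>M i\<in>{..<n}. Q) Q (\<lambda>y. y i)"
      using assms by (intro distr_cong) auto
    also have "\<dots> = Q"
      using that assms by (intro distr_PiM_component) auto
    finally show ?thesis .
  qed
  then show "i < n \<Longrightarrow> distr (\<Pi>\<^sub>M i\<in>{..<n}. Q) borel (\<lambda>y. y i) = Q" .
  show "PiM.indep_vars (\<lambda>_. borel) (\<lambda>i y. y i) {..<n}"
  proof (subst PiM.indep_vars_iff_distr_eq_PiM')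
    show "(\<lambda>y. y i) \<in> borel_measurable (\<Pi>\<^sub>M i\<in>{..<n}. Q)" if "i \<in> {..<n}" for i
      using measurable_component_singleton[OF that, of "\<lambda>_. Q"] assms(2) by (simp cong: measurable_cong_sets)
    have "distr (\<Pi>\<^sub>M i\<in>{..<n}. Q) (\<Pi>\<^sub>M i\<in>{..<n}. borel) (\<lambda>y. \<lambda>i\<in>{..<n}. y i)
      = distr (\<Pi>\<^sub>M i\<in>{..<n}. Q) (\<Pi>\<^sub>M i\<in>{..<n}. Q) (\<lambda>y. y)"
      using assms by (intro distr_cong sets_PiM_cong) (auto simp: space_PiM)
    also have "\<dots> = (\<Pi>\<^sub>M i\<in>{..<n}. distr (\<Pi>\<^sub>M i\<in>{..<n}. Q) borel (\<lambda>y. y i))"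
      unfolding distr_id by (rule PiM_cong) (simp_all add: comp)
    finally show "distr (\<Pi>\<^sub>M i\<in>{..<n}. Q) (\<Pi>\<^sub>M i\<in>{..<n}. borel) (\<lambda>y. \<lambda>i\<in>{..<n}. y i)
      = (\<Pi>\<^sub>M i\<in>{..<n}. distr (\<Pi>\<^sub>M i\<in>{..<n}. Q) borel (\<lambda>y. y i))" .
  qed (use assms in \<open>auto simp: lessThan_empty_iff\<close>)
qed

lemma gauss_density_le: "gauss_density \<sigma> (x :: real ^ 'd) \<le> (2 * pi * \<sigma>\<^sup>2) powr (- real CARD('d) / 2)"
  unfolding gauss_density_def by (rule mult_left_le) auto

lemma root_kernel_nonneg: "0 \<le> root_kernel \<sigma> Q z"
  by (simp add: root_kernel_def)

lemma borel_measurable_smoothed_density: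
  fixes Q :: "(real ^ 'd) measure"
  assumes "prob_space Q" "sets Q = sets borel"
  shows "smoothed_density \<sigma> Q \<in> borel_measurable borel" and "root_kernel \<sigma> Q \<in> borel_measurable borel"
proof -
  interpret Q: prob_space Q by fact
  note [measurable_cong] = assms(2)
  show "smoothed_density \<sigma> Q \<in> borel_measurable borel"
    unfolding smoothed_density_def[abs_def] by measurable
  show "root_kernel \<sigma> Q \<in> borel_measurable borel"
    unfolding root_kernel_def[abs_def] by measurable
qed

text \<open>The bound is allowed to be infinite, so integral bounds over z can be used pathwise
  before their finiteness is known.\<close>

lemma norm_functional_le_of_coordinates:
  fixes u :: "'d::finite linf_lip10"
  assumes "\<And>f. ennreal \<bar>u f\<bar> \<le> b"
  shows "ennreal (norm u) \<le> b"
proof (cases b)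
  case (real r)
  then have "norm u \<le> r" using assms by (intro norm_bound) simp
  then show ?thesis using real by (simp add: ennreal_leI)
qed simp

context
  fixes \<sigma> :: real
  assumes \<sigma>: "\<sigma> > 0"
begin

lemma point_functional_apply:
  fixes y :: "real ^ 'd::finite"
  shows "point_functional \<sigma> y f = gauss_smooth \<sigma> (lip_fun f) y"
proof -
  have [measurable]: "gauss_smooth \<sigma> (lip_fun f) \<in> borel_measurable borel"
    by (rule borel_measurable_gauss_smooth[OF \<sigma>])
  have "integrable (return borel y) norm"
    by (rule integrableI_bounded) (auto simp: nn_integral_return)
  then show ?thesis
    unfolding point_functional_def
    by (subst smoothed_functional_apply[OF \<sigma>]) (auto simp: prob_space_return integral_return)
qed

lemma dist_point_functional_le:
  fixes x y :: "real ^ 'd::finite"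
  shows "dist (point_functional \<sigma> x) (point_functional \<sigma> y) \<le> dist x y"
proof (rule dist_bound)
  fix f :: "'d lip10"
  show "dist (point_functional \<sigma> x f) (point_functional \<sigma> y f) \<le> dist x y"
    using lipschitz_onD[OF gauss_smooth_lipschitz[OF \<sigma> lip_fun_lipschitz, of f], of x y]
    by (simp add: point_functional_apply)
qed

lemma continuous_point_functional: "continuous_on UNIV (point_functional \<sigma> :: real ^ 'd::finite \<Rightarrow> _)"
proof (rule lipschitz_on_continuous_on)
  show "1-lipschitz_on UNIV (point_functional \<sigma> :: real ^ 'd \<Rightarrow> _)"
    using dist_point_functional_le by (intro lipschitz_onI) auto
qed

lemma empirical_functional_eq:
  fixes x :: "nat \<Rightarrow> real ^ 'd::finite"
  assumes n: "n \<ge> 1"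
  shows "empirical_functional \<sigma> n x = (1 / real n) *\<^sub>R (\<Sum>i<n. point_functional \<sigma> (x i))"
proof (rule bcontfun_eqI)
  fix f :: "'d lip10"
  have [measurable]: "gauss_smooth \<sigma> (lip_fun f) \<in> borel_measurable borel"
    by (rule borel_measurable_gauss_smooth[OF \<sigma>])
  have sum: "(\<Sum>i\<in>A. point_functional \<sigma> (x i)) f = (\<Sum>i\<in>A. gauss_smooth \<sigma> (lip_fun f) (x i))" for A
    by (induction A rule: infinite_finite_induct) (auto simp: point_functional_apply)
  show "empirical_functional \<sigma> n x f = ((1 / real n) *\<^sub>R (\<Sum>i<n. point_functional \<sigma> (x i))) f"
    using n unfolding empirical_functional_def
    by (subst smoothed_functional_apply[OF \<sigma>])
      (auto simp: prob_space_empirical_measure sets_empirical_measure integrable_empirical_measure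
        integral_empirical_measure sum)
qed

lemma continuous_empirical_functional:
  assumes "n \<ge> 1"
  shows "continuous_on UNIV (empirical_functional \<sigma> n :: (nat \<Rightarrow> real ^ 'd::finite) \<Rightarrow> _)"
proof -
  have "continuous_on UNIV (\<lambda>x. (1 / real n) *\<^sub>R (\<Sum>i<n. point_functional \<sigma> (x i :: real ^ 'd)))"
    by (intro continuous_intros continuous_on_compose2[OF continuous_point_functional]
        continuous_on_product_coordinates) auto
  then show ?thesis using assms by (subst ext[OF empirical_functional_eq])
qed

text \<open>In a nonseparable space a sum of Borel maps need not be Borel, so the sum formula does
  not give measurability by itself. Continuity of the functional on the second countable space of
  samples does.\<close>

lemma measurable_empirical_functional:
  fixes V :: "nat \<Rightarrow> 'w \<Rightarrow> real ^ 'd::finite"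
  assumes n: "n \<ge> 1" and V: "\<And>i. i < n \<Longrightarrow> V i \<in> borel_measurable M"
  shows "(\<lambda>\<omega>. empirical_functional \<sigma> n (\<lambda>i. V i \<omega>)) \<in> borel_measurable M"
proof -
  \<comment> \<open>Only the first n variables are known to be measurable; replacing the others by 0
    does not change the functional.\<close>
  have "(\<lambda>\<omega> i. if i < n then V i \<omega> else 0) \<in> borel_measurable M"
  proof (rule measurable_coordinatewise_then_product)
    show "(\<lambda>\<omega>. if i < n then V i \<omega> else 0) \<in> borel_measurable M" for i
      by (cases "i < n") (simp_all add: V)
  qed
  then have "(\<lambda>\<omega>. empirical_functional \<sigma> n (\<lambda>i. if i < n then V i \<omega> else 0)) \<in> borel_measurable M"
    by (rule measurable_compose[OF _ borel_measurable_continuous_onI[OF continuous_empirical_functional[OF n]]])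
  then show ?thesis using n by (simp add: empirical_functional_eq)
qed

lemma smoothed_density_empirical:
  assumes "n \<ge> 1"
  shows "smoothed_density \<sigma> (empirical_measure n x) z = (\<Sum>i<n. gauss_density \<sigma> (x i - z)) / n"
  using assms unfolding smoothed_density_def by (subst integral_empirical_measure) auto

text \<open>After exchanging the integrals, the inner one is at fixed z the mean deviation of an
  average of the bounded variables obtained by evaluating the Gaussian density at x - z. The weight
  stays free because the norm bound and the coarsening bound need different ones.\<close>

lemma nn_integral_empirical_density_bound:
  fixes V :: "nat \<Rightarrow> 'w \<Rightarrow> real ^ 'd::finite"
  assumes "prob_space M" and n: "n \<ge> 1" and indep: "prob_space.indep_vars M (\<lambda>_. borel) V {..<n}"
    and law: "\<And>i. i < n \<Longrightarrow> distr M borel (V i) = Q"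
    and Q: "prob_space Q" "sets Q = sets borel"
    and w[measurable]: "w \<in> borel_measurable borel" and w0: "\<And>z. 0 \<le> w z"
  shows "(\<integral>\<^sup>+\<omega>. \<integral>\<^sup>+z. ennreal (w z *
      \<bar>smoothed_density \<sigma> (empirical_measure n (\<lambda>i. V i \<omega>)) z - smoothed_density \<sigma> Q z\<bar>) \<partial>lborel \<partial>M)
    \<le> ennreal (1 / sqrt n) * (\<integral>\<^sup>+z. ennreal (w z * root_kernel \<sigma> Q z) \<partial>lborel)"
proof -
  interpret prob_space M by fact
  interpret pair_sigma_finite "lborel :: (real ^ 'd) measure" M ..
  note [measurable] = borel_measurable_smoothed_density[OF Q]
  have V[measurable]: "V i \<in> borel_measurable M" if "i < n" for i
    using indep that by (auto simp: indep_vars_def2)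
  define k where "k \<omega> z = (\<Sum>i<n. gauss_density \<sigma> (V i \<omega> - z)) / n - smoothed_density \<sigma> Q z" for \<omega> z
  have [measurable]: "case_prod (\<lambda>z \<omega>. k \<omega> z) \<in> borel_measurable (borel \<Otimes>\<^sub>M M)"
    unfolding k_def split_beta'
    by (intro borel_measurable_diff borel_measurable_divide borel_measurable_sum) measurable
  have [measurable]: "case_prod (\<lambda>z \<omega>. k \<omega> z) \<in> borel_measurable (lborel \<Otimes>\<^sub>M M)"
    by measurable
  have kz[measurable]: "(\<lambda>\<omega>. k \<omega> z) \<in> borel_measurable M" for z
    by measurable
  have "(\<integral>\<^sup>+\<omega>. \<integral>\<^sup>+z. ennreal (w z *
      \<bar>smoothed_density \<sigma> (empirical_measure n (\<lambda>i. V i \<omega>)) z - smoothed_density \<sigma> Q z\<bar>) \<partial>lborel \<partial>M)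
    = (\<integral>\<^sup>+\<omega>. \<integral>\<^sup>+z. ennreal (w z * \<bar>k \<omega> z\<bar>) \<partial>lborel \<partial>M)"
    using n by (simp add: k_def smoothed_density_empirical)
  also have "\<dots> = (\<integral>\<^sup>+z. \<integral>\<^sup>+\<omega>. ennreal (w z * \<bar>k \<omega> z\<bar>) \<partial>M \<partial>lborel)"
    by (rule Fubini') measurable
  also have "\<dots> \<le> (\<integral>\<^sup>+z. ennreal (1 / sqrt n) * ennreal (w z * root_kernel \<sigma> Q z) \<partial>lborel)"
  proof (rule nn_integral_mono)
    fix z
    \<comment> \<open>The peak of the Gaussian density, a bound for the averaged variables
      independent of z.\<close>
    define B where "B = (2 * pi * \<sigma>\<^sup>2) powr (- real CARD('d) / 2)"
    have gB: "gauss_density \<sigma> x \<le> B" for x :: "real ^ 'd"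
      unfolding B_def by (rule gauss_density_le)
    have "expectation (\<lambda>\<omega>. \<bar>k \<omega> z\<bar>) \<le> sqrt ((\<integral>x. (gauss_density \<sigma> (x - z))\<^sup>2 \<partial>Q) / n)"
      unfolding k_def smoothed_density_def
      by (rule expectation_sample_mean_deviation[OF n indep law, where u="\<lambda>x. gauss_density \<sigma> (x - z)" and B=B])
        (auto simp: gauss_density_nonneg gB)
    also have "\<dots> = root_kernel \<sigma> Q z / sqrt n"
      by (simp add: root_kernel_def real_sqrt_divide)
    finally have E: "expectation (\<lambda>\<omega>. \<bar>k \<omega> z\<bar>) \<le> root_kernel \<sigma> Q z / sqrt n" .
    have sd: "\<bar>smoothed_density \<sigma> Q z\<bar> \<le> B"
    proof -
      interpret Q: prob_space Q by fact
      have "norm (smoothed_density \<sigma> Q z) \<le> (\<integral>x. B \<partial>Q)"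
        unfolding smoothed_density_def
      proof (rule Bochner_Integration.integral_norm_bound_integral)
        note [measurable_cong] = Q(2)
        show "integrable Q (\<lambda>x. gauss_density \<sigma> (x - z))"
          by (rule Q.integrable_const_bound[where B=B]) (simp_all add: gauss_density_nonneg gB)
      qed (simp_all add: gauss_density_nonneg gB)
      then show ?thesis by (simp add: Q.prob_space)
    qed
    have kb: "\<bar>k \<omega> z\<bar> \<le> B + B" for \<omega>
    proof -
      have "(\<Sum>i<n. gauss_density \<sigma> (V i \<omega> - z)) / n \<le> (\<Sum>i<n. B) / n"
        by (intro divide_right_mono sum_mono) (auto simp: gB)
      then have "\<bar>(\<Sum>i<n. gauss_density \<sigma> (V i \<omega> - z)) / n\<bar> \<le> B"
        using n by (simp add: gauss_density_nonneg sum_nonneg)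
      then show ?thesis using sd unfolding k_def by linarith
    qed
    have int: "integrable M (\<lambda>\<omega>. \<bar>k \<omega> z\<bar>)"
      by (rule integrable_const_bound[where B="B + B"]) (use kb in auto)
    have "(\<integral>\<^sup>+\<omega>. ennreal (w z * \<bar>k \<omega> z\<bar>) \<partial>M) = ennreal (w z * expectation (\<lambda>\<omega>. \<bar>k \<omega> z\<bar>))"
      using int w0[of z] by (subst nn_integral_eq_integral) auto
    also have "\<dots> \<le> ennreal (w z * (root_kernel \<sigma> Q z / sqrt n))"
      using E w0[of z] by (intro ennreal_leI mult_left_mono)
    also have "\<dots> = ennreal (1 / sqrt n) * ennreal (w z * root_kernel \<sigma> Q z)"
      using w0[of z] root_kernel_nonneg[of \<sigma> Q z] by (simp add: ennreal_mult[symmetric])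
    finally show "(\<integral>\<^sup>+\<omega>. ennreal (w z * \<bar>k \<omega> z\<bar>) \<partial>M) \<le> ennreal (1 / sqrt n) * ennreal (w z * root_kernel \<sigma> Q z)" .
  qed
  also have "\<dots> = ennreal (1 / sqrt n) * (\<integral>\<^sup>+z. ennreal (w z * root_kernel \<sigma> Q z) \<partial>lborel)"
    by (rule nn_integral_cmult) measurable
  finally show ?thesis .
qed

lemma lip_fun_zero_lip: "lip_fun zero_lip x = 0"
  unfolding zero_lip_def by (subst Abs_lip10_inverse) (auto simp: lipschitz_on_def)

lemma smoothed_functional_zero_lip:
  fixes Q :: "(real ^ 'd::finite) measure"
  assumes "prob_space Q" "sets Q = sets borel" "integrable Q norm"
  shows "smoothed_functional \<sigma> Q zero_lip = 0"
  by (simp add: smoothed_functional_apply[OF \<sigma> assms] gauss_smooth_def lip_fun_zero_lip)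

text \<open>Used for the data drawn from P, where it gives tightness of the process, and for the
  inner sample drawn from a member of the model, where it bounds the cost of sampling.\<close>

lemma nn_integral_norm_empirical_deviation:
  fixes V :: "nat \<Rightarrow> 'w \<Rightarrow> real ^ 'd::finite"
  assumes "prob_space M" and n: "n \<ge> 1" and indep: "prob_space.indep_vars M (\<lambda>_. borel) V {..<n}"
    and law: "\<And>i. i < n \<Longrightarrow> distr M borel (V i) = Q"
    and Q: "prob_space Q" "sets Q = sets borel" "integrable Q norm"
  shows "(\<integral>\<^sup>+\<omega>. ennreal (norm (empirical_functional \<sigma> n (\<lambda>i. V i \<omega>) - smoothed_functional \<sigma> Q)) \<partial>M)
    \<le> ennreal (1 / sqrt n) * (\<integral>\<^sup>+z. ennreal (norm z * root_kernel \<sigma> Q z) \<partial>lborel)"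
proof -
  have "(\<integral>\<^sup>+\<omega>. ennreal (norm (empirical_functional \<sigma> n (\<lambda>i. V i \<omega>) - smoothed_functional \<sigma> Q)) \<partial>M)
    \<le> (\<integral>\<^sup>+\<omega>. \<integral>\<^sup>+z. ennreal (norm z *
      \<bar>smoothed_density \<sigma> (empirical_measure n (\<lambda>i. V i \<omega>)) z - smoothed_density \<sigma> Q z\<bar>) \<partial>lborel \<partial>M)"
  proof (intro nn_integral_mono norm_functional_le_of_coordinates)
    fix \<omega> and f :: "'d lip10"
    have E: "prob_space (empirical_measure n (\<lambda>i. V i \<omega>))" "sets (empirical_measure n (\<lambda>i. V i \<omega>)) = sets borel"
      "integrable (empirical_measure n (\<lambda>i. V i \<omega>)) norm"
      using n by (auto simp: prob_space_empirical_measure sets_empirical_measure integrable_empirical_measure)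
    show "ennreal \<bar>(empirical_functional \<sigma> n (\<lambda>i. V i \<omega>) - smoothed_functional \<sigma> Q) f\<bar> \<le>
      (\<integral>\<^sup>+z. ennreal (norm z *
      \<bar>smoothed_density \<sigma> (empirical_measure n (\<lambda>i. V i \<omega>)) z - smoothed_density \<sigma> Q z\<bar>) \<partial>lborel)"
      using smoothed_functional_diff_bound[OF \<sigma> E Q, of f zero_lip norm] lip_fun_bound[of f]
      by (simp add: lip_fun_zero_lip smoothed_functional_zero_lip[OF E] smoothed_functional_zero_lip[OF Q]
          empirical_functional_def)
  qed
  also have "\<dots> \<le> ennreal (1 / sqrt n) * (\<integral>\<^sup>+z. ennreal (norm z * root_kernel \<sigma> Q z) \<partial>lborel)"
    by (rule nn_integral_empirical_density_bound[OF assms(1-4) Q(1,2)]) auto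
  finally show ?thesis .
qed

end

subsection \<open>Moment conditions\<close>

lemma add_one_power_le:
  fixes a :: real
  assumes "0 \<le> a"
  shows "(1 + a) ^ p \<le> 2 ^ p * (1 + a ^ p)"
proof (cases "a \<le> 1")
  case True
  then have "(1 + a) ^ p \<le> 2 ^ p" using assms by (intro power_mono) auto
  also have "\<dots> \<le> 2 ^ p * (1 + a ^ p)" using assms by simp
  finally show ?thesis .
next
  case False
  then have "(1 + a) ^ p \<le> (2 * a) ^ p" using assms by (intro power_mono) auto
  also have "\<dots> \<le> 2 ^ p * (1 + a ^ p)" by (simp add: power_mult_distrib)
  finally show ?thesis .
qed

text \<open>The weight is dominated by a product over coordinates, and the density is such a
  product, so the integral splits into one-dimensional normal moments.\<close>

lemma nn_integral_gauss_moment_finite: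
  assumes \<sigma>: "\<sigma> > 0"
  shows "(\<integral>\<^sup>+y. ennreal ((1 + norm y) ^ p * gauss_density \<sigma> y) \<partial>(lborel :: (real ^ 'd) measure)) < \<infinity>"
proof -
  have int: "integrable lborel (\<lambda>x. (2 ^ p * (1 + \<bar>x\<bar> ^ p)) * normal_density 0 \<sigma> x)"
  proof -
    have "integrable lborel (\<lambda>x. 2 ^ p * normal_density 0 \<sigma> x + 2 ^ p * (normal_density 0 \<sigma> x * \<bar>x\<bar> ^ p))"
      using integrable_normal_moment_abs[OF \<sigma>, of 0 p] integrable_normal_density[OF \<sigma>, of 0] by simp
    moreover have "(2 ^ p * (1 + \<bar>x\<bar> ^ p)) * normal_density 0 \<sigma> x
      = 2 ^ p * normal_density 0 \<sigma> x + 2 ^ p * (normal_density 0 \<sigma> x * \<bar>x\<bar> ^ p)" for x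
      by (simp add: algebra_simps)
    ultimately show ?thesis by presburger
  qed
  have "(\<integral>\<^sup>+x. ennreal ((1 + \<bar>x\<bar>) ^ p * normal_density 0 \<sigma> x) \<partial>lborel)
      \<le> (\<integral>\<^sup>+x. ennreal ((2 ^ p * (1 + \<bar>x\<bar> ^ p)) * normal_density 0 \<sigma> x) \<partial>lborel)"
    by (intro nn_integral_mono ennreal_leI mult_right_mono add_one_power_le)
      (auto simp: normal_density_nonneg)
  also have "\<dots> < \<infinity>"
    using int by (simp add: integrable_iff_bounded abs_mult normal_density_nonneg)
  finally have fin: "(\<integral>\<^sup>+x. ennreal ((1 + \<bar>x\<bar>) ^ p * normal_density 0 \<sigma> x) \<partial>lborel) < \<infinity>" .
  have "(\<integral>\<^sup>+x. ennreal ((1 + norm x) ^ p * gauss_density \<sigma> x) \<partial>(lborel :: (real ^ 'd) measure))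
    \<le> (\<integral>\<^sup>+x. (\<Prod>b\<in>Basis. ennreal ((1 + \<bar>x \<bullet> b\<bar>) ^ p * normal_density 0 \<sigma> (x \<bullet> b)))
          \<partial>(lborel :: (real ^ 'd) measure))"
  proof (rule nn_integral_mono)
    fix x :: "real ^ 'd"
    have "(1 + norm x) ^ p * gauss_density \<sigma> x \<le> (\<Prod>b\<in>Basis. 1 + \<bar>x \<bullet> b\<bar>) ^ p * gauss_density \<sigma> x"
      by (intro mult_right_mono power_mono norm_le_prod gauss_density_nonneg) simp
    then show "ennreal ((1 + norm x) ^ p * gauss_density \<sigma> x)
      \<le> (\<Prod>b\<in>Basis. ennreal ((1 + \<bar>x \<bullet> b\<bar>) ^ p * normal_density 0 \<sigma> (x \<bullet> b)))"
      by (simp add: prod_ennreal normal_density_nonneg prod.distrib prod_power_distrib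
          gauss_density_eq_prod[OF \<sigma>] ennreal_leI)
  qed
  also have "\<dots> = (\<Prod>b\<in>(Basis :: (real ^ 'd) set).
      \<integral>\<^sup>+x. ennreal ((1 + \<bar>x\<bar>) ^ p * normal_density 0 \<sigma> x) \<partial>lborel)"
    by (subst nn_integral_lborel_prod) (simp_all add: normal_density_nonneg)
  also have "\<dots> < \<infinity>"
    using fin by (simp add: power_less_top_ennreal)
  finally show ?thesis .
qed

section \<open>Weighted integrals of the root kernel\<close>

lemma nn_integral_lborel_reflect:
  fixes F :: "'a::euclidean_space \<Rightarrow> ennreal"
  assumes [measurable]: "F \<in> borel_measurable borel"
  shows "(\<integral>\<^sup>+y. F (x - y) \<partial>lborel) = (\<integral>\<^sup>+y. F y \<partial>lborel)"
  by (subst (2) distr_lborel_reflect[of x, symmetric], subst nn_integral_distr) auto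

text \<open>The weight 1 + |z| is submultiplicative under addition of vectors, so recentring the
  Gaussian at x costs exactly one factor depending on x.\<close>

lemma nn_integral_weighted_gauss_shift:
  fixes x :: "real ^ 'd"
  shows "(\<integral>\<^sup>+z. ennreal ((1 + norm z) ^ p * gauss_density \<sigma> (x - z)) \<partial>lborel)
    \<le> ennreal ((1 + norm x) ^ p) *
      (\<integral>\<^sup>+y. ennreal ((1 + norm y) ^ p * gauss_density \<sigma> y) \<partial>(lborel :: (real ^ 'd) measure))"
proof -
  have "(\<integral>\<^sup>+z. ennreal ((1 + norm z) ^ p * gauss_density \<sigma> (x - z)) \<partial>lborel)
    \<le> (\<integral>\<^sup>+z. ennreal ((1 + norm x) ^ p) * ennreal ((1 + norm (x - z)) ^ p * gauss_density \<sigma> (x - z)) \<partial>lborel)"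
  proof (rule nn_integral_mono)
    fix z
    have "norm z \<le> norm x + norm (x - z)"
      using norm_triangle_ineq4[of x "x - z"] by simp
    moreover have "0 \<le> norm x * norm (x - z)" by simp
    ultimately have "1 + norm z \<le> (1 + norm x) * (1 + norm (x - z))"
      unfolding distrib_left distrib_right mult_1_left mult_1_right by linarith
    then have "(1 + norm z) ^ p \<le> (1 + norm x) ^ p * (1 + norm (x - z)) ^ p"
      unfolding power_mult_distrib[symmetric] by (intro power_mono) auto
    then have "(1 + norm z) ^ p * gauss_density \<sigma> (x - z)
      \<le> ((1 + norm x) ^ p * (1 + norm (x - z)) ^ p) * gauss_density \<sigma> (x - z)"
      by (intro mult_right_mono gauss_density_nonneg)
    then show "ennreal ((1 + norm z) ^ p * gauss_density \<sigma> (x - z))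
      \<le> ennreal ((1 + norm x) ^ p) * ennreal ((1 + norm (x - z)) ^ p * gauss_density \<sigma> (x - z))"
      by (simp add: ennreal_mult[symmetric] gauss_density_nonneg ennreal_leI mult.assoc)
  qed
  also have "\<dots> = ennreal ((1 + norm x) ^ p) *
      (\<integral>\<^sup>+z. ennreal ((1 + norm (x - z)) ^ p * gauss_density \<sigma> (x - z)) \<partial>lborel)"
    by (rule nn_integral_cmult) measurable
  also have "(\<integral>\<^sup>+z. ennreal ((1 + norm (x - z)) ^ p * gauss_density \<sigma> (x - z)) \<partial>lborel)
    = (\<integral>\<^sup>+y. ennreal ((1 + norm y) ^ p * gauss_density \<sigma> y) \<partial>(lborel :: (real ^ 'd) measure))"
    by (rule nn_integral_lborel_reflect[where F="\<lambda>y :: real ^ 'd. ennreal ((1 + norm y) ^ p * gauss_density \<sigma> y)"]) measurable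
  finally show ?thesis .
qed

lemma nn_integral_inverse_one_plus_square: "(\<integral>\<^sup>+x. ennreal (inverse (1 + x\<^sup>2)) \<partial>lborel) < \<infinity>"
proof -
  have "integrable lborel (\<lambda>x::real. inverse (1 + x\<^sup>2))"
    using integrable_inverse_1_plus_square by (simp add: set_integrable_def)
  then show ?thesis by (simp add: integrable_iff_bounded add_nonneg_nonneg)
qed

text \<open>The squared kernel is at most its peak times the kernel, which trades the square for a
  density with known moments. The exact formula is kept for the partition argument, where the square
  is estimated cell by cell.\<close>

lemma root_kernel_sq_le:
  fixes Q :: "(real ^ 'd) measure"
  assumes "prob_space Q" "sets Q = sets borel"
  shows "ennreal ((root_kernel \<sigma> Q z)\<^sup>2)
    \<le> ennreal ((2 * pi * \<sigma>\<^sup>2) powr (- real CARD('d) / 2)) * (\<integral>\<^sup>+x. ennreal (gauss_density \<sigma> (x - z)) \<partial>Q)"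
    and "ennreal ((root_kernel \<sigma> Q z)\<^sup>2) = (\<integral>\<^sup>+x. ennreal ((gauss_density \<sigma> (x - z))\<^sup>2) \<partial>Q)"
proof -
  interpret Q: prob_space Q by fact
  note [measurable_cong] = assms(2)
  define c where "c = (2 * pi * \<sigma>\<^sup>2) powr (- real CARD('d) / 2)"
  have c: "gauss_density \<sigma> x \<le> c" "0 \<le> c" for x :: "real ^ 'd"
    unfolding c_def by (rule gauss_density_le) simp
  have sq: "(gauss_density \<sigma> x)\<^sup>2 \<le> c * gauss_density \<sigma> x" for x :: "real ^ 'd"
    using c by (simp add: power2_eq_square mult_right_mono gauss_density_nonneg)
  have sq': "(gauss_density \<sigma> x)\<^sup>2 \<le> c * c" for x :: "real ^ 'd"
    using order_trans[OF sq mult_left_mono[OF c]] .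
  have "integrable Q (\<lambda>x. (gauss_density \<sigma> (x - z))\<^sup>2)"
    by (rule Q.integrable_const_bound[where B="c * c"]) (simp_all add: sq')
  then show eq: "ennreal ((root_kernel \<sigma> Q z)\<^sup>2) = (\<integral>\<^sup>+x. ennreal ((gauss_density \<sigma> (x - z))\<^sup>2) \<partial>Q)"
    by (simp add: root_kernel_def nn_integral_eq_integral)
  show "ennreal ((root_kernel \<sigma> Q z)\<^sup>2) \<le> ennreal c * (\<integral>\<^sup>+x. ennreal (gauss_density \<sigma> (x - z)) \<partial>Q)"
    unfolding eq using sq c
    by (subst nn_integral_cmult[symmetric])
      (auto intro!: nn_integral_mono simp: ennreal_mult[symmetric] gauss_density_nonneg ennreal_leI)
qed

text \<open>The weight \<open>\<Prod>b. 1 + z\<^sub>b\<^sup>2\<close> has an integrable inverse and grows no faster than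
  \<open>(1 + \<bar>z\<bar>)\<^sup>2\<^sup>d\<close>; this is where the exponent \<open>2 (d + 1)\<close> comes from.\<close>

lemma root_kernel_moment_bound:
  assumes \<sigma>: "\<sigma> > 0"
  shows "\<exists>C\<ge>0. \<forall>Q :: (real ^ 'd) measure. prob_space Q \<longrightarrow> sets Q = sets borel \<longrightarrow>
    (\<integral>\<^sup>+z. ennreal (norm z * root_kernel \<sigma> Q z) \<partial>lborel)
      \<le> ennreal C * (1 + (\<integral>\<^sup>+x. ennreal ((1 + norm x) ^ (2 * (CARD('d) + 1))) \<partial>Q))"
proof -
  define p where "p = 2 * (CARD('d) + 1)"
  define c where "c = (2 * pi * \<sigma>\<^sup>2) powr (- real CARD('d) / 2)"
  define W where "W z = (\<Prod>b\<in>Basis. 1 + (z \<bullet> b)\<^sup>2)" for z :: "real ^ 'd"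
  define A where "A = (\<integral>\<^sup>+y. ennreal ((1 + norm y) ^ p * gauss_density \<sigma> y) \<partial>(lborel :: (real ^ 'd) measure))"
  define K where "K = (\<integral>\<^sup>+z. ennreal (inverse (W z)) \<partial>lborel)"
  have [measurable]: "W \<in> borel_measurable borel" unfolding W_def by measurable
  have Wpos: "0 < W z" for z
    unfolding W_def by (intro prod_pos) (auto simp: add_pos_nonneg)
  have K: "K < \<infinity>"
  proof -
    have "K = (\<integral>\<^sup>+z. (\<Prod>b\<in>Basis. ennreal (inverse (1 + (z \<bullet> b)\<^sup>2))) \<partial>(lborel :: (real ^ 'd) measure))"
      unfolding K_def W_def by (simp add: prod_ennreal prod_inversef[symmetric] o_def)
    also have "\<dots> = (\<Prod>b\<in>(Basis :: (real ^ 'd) set). \<integral>\<^sup>+x. ennreal (inverse (1 + x\<^sup>2)) \<partial>lborel)"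
      by (subst nn_integral_lborel_prod) auto
    also have "\<dots> < \<infinity>"
      using nn_integral_inverse_one_plus_square by (simp add: power_less_top_ennreal)
    finally show ?thesis .
  qed
  have A: "A < \<infinity>" unfolding A_def by (rule nn_integral_gauss_moment_finite[OF \<sigma>])
  have W_le: "(norm z)\<^sup>2 * W z \<le> (1 + norm z) ^ p" for z
  proof -
    have "W z \<le> (\<Prod>b\<in>(Basis :: (real ^ 'd) set). (1 + norm z)\<^sup>2)"
      unfolding W_def
    proof (intro prod_mono conjI)
      fix b :: "real ^ 'd" assume "b \<in> Basis"
      then have "\<bar>z \<bullet> b\<bar> \<le> norm z" by (rule Basis_le_norm)
      then have "\<bar>z \<bullet> b\<bar>\<^sup>2 \<le> (norm z)\<^sup>2" by (intro power_mono) auto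
      moreover have "(1 + norm z)\<^sup>2 = 1 + 2 * norm z + (norm z)\<^sup>2"
        by (simp add: power2_sum)
      ultimately show "1 + (z \<bullet> b)\<^sup>2 \<le> (1 + norm z)\<^sup>2"
        using norm_ge_zero[of z] unfolding power2_abs by linarith
    qed (auto simp: add_nonneg_nonneg)
    also have "\<dots> = (1 + norm z) ^ (2 * CARD('d))" by (simp add: power_mult)
    finally have "(norm z)\<^sup>2 * W z \<le> (1 + norm z)\<^sup>2 * (1 + norm z) ^ (2 * CARD('d))"
      using Wpos[of z] by (intro mult_mono power_mono) (auto simp: less_imp_le)
    then show ?thesis by (simp add: p_def power_add[symmetric] add.commute)
  qed
  define C where "C = enn2real K + c * enn2real A"
  have C: "K \<le> ennreal C" "ennreal c * A \<le> ennreal C" "0 \<le> C"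
    using K A by (auto simp: C_def c_def less_top ennreal_plus ennreal_mult add_increasing add_increasing2)
  have "(\<integral>\<^sup>+z. ennreal (norm z * root_kernel \<sigma> Q z) \<partial>lborel)
      \<le> ennreal C * (1 + (\<integral>\<^sup>+x. ennreal ((1 + norm x) ^ p) \<partial>Q))"
    if Q: "prob_space Q" "sets Q = sets borel" for Q :: "(real ^ 'd) measure"
  proof -
    interpret Q: prob_space Q by fact
    interpret pair_sigma_finite "lborel :: (real ^ 'd) measure" Q ..
    note [measurable_cong] = Q(2)
    note [measurable] = borel_measurable_smoothed_density[OF Q]
    have "(\<integral>\<^sup>+z. ennreal (norm z * root_kernel \<sigma> Q z) \<partial>lborel)
      \<le> (\<integral>\<^sup>+z. ennreal (inverse (W z)) +
          (\<integral>\<^sup>+x. ennreal c * ennreal ((1 + norm z) ^ p * gauss_density \<sigma> (x - z)) \<partial>Q) \<partial>lborel)"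
    proof (rule nn_integral_mono)
      fix z :: "real ^ 'd"
      define r where "r = root_kernel \<sigma> Q z"
      \<comment> \<open>The product of |z| and the root kernel is split with the weight
        \<open>a\<close> and the inequality between arithmetic and geometric means. The square of
        the root kernel is linear in Q, which the root kernel is not, so the integral becomes a
        moment of Q.\<close>
      define a where "a = sqrt (W z)"
      have a: "0 < a" "a\<^sup>2 = W z" using Wpos[of z] by (auto simp: a_def)
      have "2 * (norm z * r) = 2 * (inverse a) * (a * (norm z * r))" using a by simp
      also have "\<dots> \<le> (inverse a)\<^sup>2 + (a * (norm z * r))\<^sup>2" by (rule sum_squares_bound)
      also have "\<dots> = inverse (W z) + ((norm z)\<^sup>2 * W z) * r\<^sup>2"
        using a by (simp add: power_mult_distrib power_inverse mult_ac)
      also have "\<dots> \<le> inverse (W z) + (1 + norm z) ^ p * r\<^sup>2"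
        using W_le by (intro add_left_mono mult_right_mono) auto
      finally have "norm z * r \<le> inverse (W z) + (1 + norm z) ^ p * r\<^sup>2"
        using root_kernel_nonneg[of \<sigma> Q z] by (simp add: r_def) (smt (verit) mult_nonneg_nonneg norm_ge_zero)
      then have "ennreal (norm z * r) \<le> ennreal (inverse (W z) + (1 + norm z) ^ p * r\<^sup>2)"
        by (rule ennreal_leI)
      also have "\<dots> = ennreal (inverse (W z)) + ennreal ((1 + norm z) ^ p) * ennreal (r\<^sup>2)"
        using Wpos[of z] by (simp add: ennreal_mult ennreal_plus less_imp_le)
      also have "\<dots> \<le> ennreal (inverse (W z)) + ennreal ((1 + norm z) ^ p) *
          (ennreal c * (\<integral>\<^sup>+x. ennreal (gauss_density \<sigma> (x - z)) \<partial>Q))"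
        unfolding r_def c_def by (intro add_left_mono mult_left_mono root_kernel_sq_le Q) auto
      also have "ennreal ((1 + norm z) ^ p) * (ennreal c * (\<integral>\<^sup>+x. ennreal (gauss_density \<sigma> (x - z)) \<partial>Q))
        = (\<integral>\<^sup>+x. ennreal c * ennreal ((1 + norm z) ^ p * gauss_density \<sigma> (x - z)) \<partial>Q)"
        by (simp add: nn_integral_cmult[symmetric] ennreal_mult gauss_density_nonneg mult_ac)
      finally show "ennreal (norm z * root_kernel \<sigma> Q z) \<le> ennreal (inverse (W z)) +
          (\<integral>\<^sup>+x. ennreal c * ennreal ((1 + norm z) ^ p * gauss_density \<sigma> (x - z)) \<partial>Q)"
        by (simp add: r_def)
    qed
    also have "\<dots> = K + (\<integral>\<^sup>+z. \<integral>\<^sup>+x. ennreal c * ennreal ((1 + norm z) ^ p * gauss_density \<sigma> (x - z)) \<partial>Q \<partial>lborel)"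
      unfolding K_def by (rule nn_integral_add) measurable
    also have "(\<integral>\<^sup>+z. \<integral>\<^sup>+x. ennreal c * ennreal ((1 + norm z) ^ p * gauss_density \<sigma> (x - z)) \<partial>Q \<partial>lborel)
      = (\<integral>\<^sup>+x. \<integral>\<^sup>+z. ennreal c * ennreal ((1 + norm z) ^ p * gauss_density \<sigma> (x - z)) \<partial>lborel \<partial>Q)"
      by (rule Fubini'[symmetric]) measurable
    also have "\<dots> \<le> (\<integral>\<^sup>+x. (ennreal c * A) * ennreal ((1 + norm x) ^ p) \<partial>Q)"
    proof (rule nn_integral_mono)
      fix x :: "real ^ 'd"
      have "(\<integral>\<^sup>+z. ennreal c * ennreal ((1 + norm z) ^ p * gauss_density \<sigma> (x - z)) \<partial>lborel)
        = ennreal c * (\<integral>\<^sup>+z. ennreal ((1 + norm z) ^ p * gauss_density \<sigma> (x - z)) \<partial>lborel)"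
        by (rule nn_integral_cmult) measurable
      also have "\<dots> \<le> ennreal c * (ennreal ((1 + norm x) ^ p) * A)"
        using nn_integral_weighted_gauss_shift[of p \<sigma> x] unfolding A_def by (rule mult_left_mono) simp
      finally show "(\<integral>\<^sup>+z. ennreal c * ennreal ((1 + norm z) ^ p * gauss_density \<sigma> (x - z)) \<partial>lborel)
        \<le> (ennreal c * A) * ennreal ((1 + norm x) ^ p)" by (simp add: mult_ac)
    qed
    also have "\<dots> = (ennreal c * A) * (\<integral>\<^sup>+x. ennreal ((1 + norm x) ^ p) \<partial>Q)"
      by (rule nn_integral_cmult) measurable
    finally have "(\<integral>\<^sup>+z. ennreal (norm z * root_kernel \<sigma> Q z) \<partial>lborel)
      \<le> K + (ennreal c * A) * (\<integral>\<^sup>+x. ennreal ((1 + norm x) ^ p) \<partial>Q)" by (simp add: add_left_mono)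
    also have "\<dots> \<le> ennreal C + ennreal C * (\<integral>\<^sup>+x. ennreal ((1 + norm x) ^ p) \<partial>Q)"
      using C by (intro add_mono mult_right_mono) auto
    finally show ?thesis by (simp add: distrib_left)
  qed
  then show ?thesis using C(3) unfolding p_def by blast
qed

lemma root_kernel_uniform_bound:
  fixes Q :: "'p \<Rightarrow> (real ^ 'd) measure"
  assumes \<sigma>: "\<sigma> > 0" and Q: "\<And>\<theta>. \<theta> \<in> \<Theta> \<Longrightarrow> prob_space (Q \<theta>) \<and> sets (Q \<theta>) = sets borel"
    and q: "q > 2 * (real CARD('d) + 1)"
    and moment: "(SUP \<theta>\<in>\<Theta>. \<integral>\<^sup>+x. ennreal (norm x powr q) \<partial>(Q \<theta>)) < \<infinity>"
  shows "\<exists>C\<ge>0. \<forall>\<theta>\<in>\<Theta>. (\<integral>\<^sup>+z. ennreal (norm z * root_kernel \<sigma> (Q \<theta>) z) \<partial>lborel) \<le> ennreal C"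
proof -
  define p where "p = 2 * (CARD('d) + 1)"
  obtain C where C: "0 \<le> C" "\<And>Q :: (real ^ 'd) measure. prob_space Q \<Longrightarrow> sets Q = sets borel \<Longrightarrow>
    (\<integral>\<^sup>+z. ennreal (norm z * root_kernel \<sigma> Q z) \<partial>lborel)
      \<le> ennreal C * (1 + (\<integral>\<^sup>+x. ennreal ((1 + norm x) ^ p) \<partial>Q))"
    using root_kernel_moment_bound[OF \<sigma>, where 'd='d] unfolding p_def by blast
  define B where "B = (SUP \<theta>\<in>\<Theta>. \<integral>\<^sup>+x. ennreal (norm x powr q) \<partial>(Q \<theta>))"
  define T where "T = ennreal C * (1 + ennreal (2 ^ p) * (2 + B))"
  have "T < \<infinity>"
    using moment unfolding T_def B_def by (simp add: ennreal_mult_less_top ennreal_add_less_top)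
  have "(\<integral>\<^sup>+z. ennreal (norm z * root_kernel \<sigma> (Q \<theta>) z) \<partial>lborel) \<le> T" if \<theta>: "\<theta> \<in> \<Theta>" for \<theta>
  proof -
    interpret Q: prob_space "Q \<theta>" using Q[OF \<theta>] by blast
    have [measurable_cong]: "sets (Q \<theta>) = sets borel" using Q[OF \<theta>] by blast
    have "(\<integral>\<^sup>+x. ennreal ((1 + norm x) ^ p) \<partial>Q \<theta>) \<le> (\<integral>\<^sup>+x. ennreal (2 ^ p) * (2 + ennreal (norm x powr q)) \<partial>Q \<theta>)"
    proof (rule nn_integral_mono)
      fix x :: "real ^ 'd"
      \<comment> \<open>The integer exponent p lies below q, so the p-th moment is controlled by the
        assumed one after separating the unit ball.\<close>
      have "norm x ^ p \<le> 1 + norm x powr q"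
      proof (cases "norm x \<le> 1")
        case True
        then have "norm x ^ p \<le> 1" by (intro power_le_one) auto
        then show ?thesis by (smt (verit) powr_ge_zero)
      next
        case False
        then have "norm x ^ p = norm x powr real p" by (intro powr_realpow[symmetric]) auto
        also have "\<dots> \<le> norm x powr q" using False q by (intro powr_mono) (auto simp: p_def)
        finally show ?thesis by simp
      qed
      then have "(1 + norm x) ^ p \<le> 2 ^ p * (2 + norm x powr q)"
        using add_one_power_le[of "norm x" p] by (smt (verit) norm_ge_zero mult_left_mono zero_le_power)
      then have "ennreal ((1 + norm x) ^ p) \<le> ennreal (2 ^ p * (2 + norm x powr q))" by (rule ennreal_leI)
      also have "\<dots> = ennreal (2 ^ p) * (2 + ennreal (norm x powr q))"
        by (simp add: ennreal_mult ennreal_plus)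
      finally show "ennreal ((1 + norm x) ^ p) \<le> ennreal (2 ^ p) * (2 + ennreal (norm x powr q))" .
    qed
    also have "\<dots> = ennreal (2 ^ p) * (2 + (\<integral>\<^sup>+x. ennreal (norm x powr q) \<partial>Q \<theta>))"
      by (subst nn_integral_cmult, measurable, subst nn_integral_add) (auto simp: Q.emeasure_space_1)
    also have "\<dots> \<le> ennreal (2 ^ p) * (2 + B)"
      unfolding B_def using \<theta> by (intro mult_left_mono add_left_mono SUP_upper) auto
    finally show ?thesis
      unfolding T_def using C(2)[of "Q \<theta>"] Q[OF \<theta>]
      by (auto elim!: order_trans intro!: mult_left_mono add_left_mono)
  qed
  then show ?thesis
    using \<open>T < \<infinity>\<close> by (intro exI[of _ "enn2real T"]) (auto simp: less_top)
qed

text \<open>The inequality |y - z|^2 \<le> 2 |x - z|^2 + 2 \<Delta>^2 shows that doubling the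
  variance absorbs a displacement of at most \<Delta>. The constant is the ratio of the
  normalisations times the remaining exponential.\<close>

lemma gauss_density_near:
  fixes x y z :: "real ^ 'd"
  assumes \<sigma>: "\<sigma> > 0"
  shows "\<exists>K\<ge>0. \<forall>x y z :: real ^ 'd. dist x y \<le> \<Delta> \<longrightarrow>
    gauss_density \<sigma> (x - z) \<le> K * gauss_density (sqrt 2 * \<sigma>) (y - z)"
proof -
  define a where "a = (2 * pi * \<sigma>\<^sup>2) powr (- real CARD('d) / 2)"
  define b where "b = (2 * pi * (sqrt 2 * \<sigma>)\<^sup>2) powr (- real CARD('d) / 2)"
  have a: "0 \<le> a" and b: "0 < b" using \<sigma> by (auto simp: a_def b_def)
  define K where "K = a / b * exp (\<Delta>\<^sup>2 / (2 * \<sigma>\<^sup>2))"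
  have "gauss_density \<sigma> (x - z) \<le> K * gauss_density (sqrt 2 * \<sigma>) (y - z)"
    if d: "dist x y \<le> \<Delta>" for x y z :: "real ^ 'd"
  proof -
    have "norm (y - z) \<le> norm (x - z) + \<Delta>"
      using d norm_triangle_ineq4[of "x - z" "x - y"] by (simp add: dist_norm)
    then have "(norm (y - z))\<^sup>2 \<le> (norm (x - z) + \<Delta>)\<^sup>2" by (intro power_mono) auto
    also have "\<dots> \<le> 2 * (norm (x - z))\<^sup>2 + 2 * \<Delta>\<^sup>2"
      using sum_squares_bound[of "norm (x - z)" \<Delta>] by (simp add: power2_sum)
    finally have "- (norm (x - z))\<^sup>2 / (2 * \<sigma>\<^sup>2) \<le> (\<Delta>\<^sup>2 - (norm (y - z))\<^sup>2 / 2) / (2 * \<sigma>\<^sup>2)"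
      by (intro divide_right_mono) auto
    also have "\<dots> = \<Delta>\<^sup>2 / (2 * \<sigma>\<^sup>2) + - (norm (y - z))\<^sup>2 / (2 * (sqrt 2 * \<sigma>)\<^sup>2)"
      using \<sigma> by (simp add: power_mult_distrib field_simps)
    finally have "exp (- (norm (x - z))\<^sup>2 / (2 * \<sigma>\<^sup>2))
      \<le> exp (\<Delta>\<^sup>2 / (2 * \<sigma>\<^sup>2)) * exp (- (norm (y - z))\<^sup>2 / (2 * (sqrt 2 * \<sigma>)\<^sup>2))"
      by (simp add: exp_add[symmetric])
    then have "a * exp (- (norm (x - z))\<^sup>2 / (2 * \<sigma>\<^sup>2))
      \<le> a * (exp (\<Delta>\<^sup>2 / (2 * \<sigma>\<^sup>2)) * exp (- (norm (y - z))\<^sup>2 / (2 * (sqrt 2 * \<sigma>)\<^sup>2)))"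
      using a by (rule mult_left_mono)
    then show ?thesis
      using b unfolding gauss_density_def a_def[symmetric] b_def[symmetric] K_def by simp
  qed
  moreover have "0 \<le> K" using a b by (simp add: K_def)
  ultimately show ?thesis by blast
qed

text \<open>On a cell the kernel is comparable to one Gaussian of doubled variance at a chosen point
  y j, because the diameters are uniformly bounded. The squared root kernel is thus at most the sum
  of the squares of the b j, and the root of that sum is at most the sum of the b j. Integrated
  against 1 + |z|, each b j contributes a constant times (1 + |y j|) times the root of the cell
  probability, and 1 + |y j| \<le> 2 M j since M j is at least 1.\<close>

lemma root_kernel_partition_bound:
  fixes P :: "(real ^ 'd) measure"
  assumes \<sigma>: "\<sigma> > 0" and P: "prob_space P" "sets P = sets borel"
    and I: "disjoint_family I" "(\<Union>j. I j) = UNIV" "\<And>j. I j \<in> sets borel"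
    and bnd: "\<And>j. bounded (I j)" "\<And>j. I j \<noteq> {}" "bdd_above (range (\<lambda>j. diameter (I j)))"
    and M: "\<And>j. M j = (SUP x\<in>I j. norm x)" "\<And>j. M j \<ge> 1"
    and sum: "summable (\<lambda>j. M j * sqrt (measure P (I j)))"
  shows "(\<integral>\<^sup>+z. ennreal ((1 + norm z) * root_kernel \<sigma> P z) \<partial>lborel) < \<infinity>"
proof -
  interpret P: prob_space P by fact
  note [measurable_cong] = P(2)
  obtain \<Delta> where \<Delta>: "\<And>j. diameter (I j) \<le> \<Delta>"
    using bnd(3) by (auto simp: bdd_above_def)
  obtain K where K: "0 \<le> K" "\<And>x y z :: real ^ 'd. dist x y \<le> \<Delta> \<Longrightarrow>
    gauss_density \<sigma> (x - z) \<le> K * gauss_density (sqrt 2 * \<sigma>) (y - z)"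
    using gauss_density_near[OF \<sigma>, of \<Delta>] by blast
  obtain y where y: "\<And>j. y j \<in> I j" using bnd(2) choice[of "\<lambda>j x. x \<in> I j"] by blast
  have yM: "norm (y j) \<le> M j" for j
    unfolding M(1) using bnd(1)[of j] y[of j]
    by (intro cSUP_upper) (auto simp: bounded_iff bdd_above_def)
  define b where "b j z = sqrt (measure P (I j)) * (K * gauss_density (sqrt 2 * \<sigma>) (y j - z))" for j z
  have b0: "0 \<le> b j z" for j z using K by (simp add: b_def gauss_density_nonneg)
  have [measurable]: "b j \<in> borel_measurable borel" for j unfolding b_def by measurable
  have sq: "ennreal ((root_kernel \<sigma> P z)\<^sup>2) \<le> (\<Sum>j. ennreal ((b j z)\<^sup>2))" for z
  proof -
    have "ennreal ((root_kernel \<sigma> P z)\<^sup>2) = (\<integral>\<^sup>+x. ennreal ((gauss_density \<sigma> (x - z))\<^sup>2) \<partial>P)"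
      by (rule root_kernel_sq_le(2)[OF P])
    also have "\<dots> = (\<integral>\<^sup>+x\<in>(\<Union>j. I j). ennreal ((gauss_density \<sigma> (x - z))\<^sup>2) \<partial>P)"
      by (simp add: I)
    also have "\<dots> = (\<Sum>j. \<integral>\<^sup>+x\<in>I j. ennreal ((gauss_density \<sigma> (x - z))\<^sup>2) \<partial>P)"
      using I by (intro nn_integral_disjoint_family) (auto simp: P)
    also have "\<dots> \<le> (\<Sum>j. ennreal ((b j z)\<^sup>2))"
    proof (intro suminf_le summableI)
      fix j
      have "(\<integral>\<^sup>+x\<in>I j. ennreal ((gauss_density \<sigma> (x - z))\<^sup>2) \<partial>P)
        \<le> (\<integral>\<^sup>+x. ennreal ((K * gauss_density (sqrt 2 * \<sigma>) (y j - z))\<^sup>2) * indicator (I j) x \<partial>P)"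
      proof (rule nn_integral_mono)
        fix x
        have "(gauss_density \<sigma> (x - z))\<^sup>2 \<le> (K * gauss_density (sqrt 2 * \<sigma>) (y j - z))\<^sup>2" if "x \<in> I j"
        proof (intro power_mono K(2) gauss_density_nonneg)
          show "dist x (y j) \<le> \<Delta>"
            using diameter_bounded_bound[OF bnd(1) that y] \<Delta>[of j] by linarith
        qed
        then show "ennreal ((gauss_density \<sigma> (x - z))\<^sup>2) * indicator (I j) x
          \<le> ennreal ((K * gauss_density (sqrt 2 * \<sigma>) (y j - z))\<^sup>2) * indicator (I j) x"
          by (auto split: split_indicator intro: ennreal_leI)
      qed
      also have "\<dots> = ennreal ((K * gauss_density (sqrt 2 * \<sigma>) (y j - z))\<^sup>2) * emeasure P (I j)"
        by (rule nn_integral_cmult_indicator) (simp add: P I)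
      also have "\<dots> = ennreal ((b j z)\<^sup>2)"
        by (simp add: b_def power_mult_distrib P.emeasure_eq_measure ennreal_mult[symmetric] mult.commute)
      finally show "(\<integral>\<^sup>+x\<in>I j. ennreal ((gauss_density \<sigma> (x - z))\<^sup>2) \<partial>P) \<le> ennreal ((b j z)\<^sup>2)" .
    qed
    finally show ?thesis .
  qed
  \<comment> \<open>The l2 norm of a nonnegative sequence is at most its l1 norm. When the sum on
    the right is infinite nothing has to be shown.\<close>
  have le: "ennreal (root_kernel \<sigma> P z) \<le> (\<Sum>j. ennreal (b j z))" for z
  proof (cases "\<Sum>j. ennreal (b j z)")
    case (real r)
    have "(\<Sum>j. ennreal ((b j z)\<^sup>2)) \<le> ennreal (r\<^sup>2)"
    proof (rule suminf_le_const)
      fix n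
      have "(\<Sum>j<n. ennreal (b j z)) \<le> (\<Sum>j. ennreal (b j z))"
        by (rule sum_le_suminf) auto
      then have "ennreal (\<Sum>j<n. b j z) \<le> ennreal r"
        using b0 real by (simp add: sum_ennreal)
      then have 1: "(\<Sum>j<n. b j z) \<le> r" using real by simp
      have "(\<Sum>j<n. (b j z)\<^sup>2) \<le> (\<Sum>j<n. b j z * (\<Sum>i<n. b i z))"
        unfolding power2_eq_square using b0
        by (intro sum_mono mult_left_mono member_le_sum) auto
      also have "\<dots> = (\<Sum>j<n. b j z)\<^sup>2" by (simp add: power2_eq_square sum_distrib_right)
      also have "\<dots> \<le> r\<^sup>2" using 1 b0 by (intro power_mono sum_nonneg) auto
      finally show "(\<Sum>j<n. ennreal ((b j z)\<^sup>2)) \<le> ennreal (r\<^sup>2)" by (simp add: ennreal_leI)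
    qed simp
    then have "ennreal ((root_kernel \<sigma> P z)\<^sup>2) \<le> ennreal (r\<^sup>2)" by (rule order_trans[OF sq])
    then have "(root_kernel \<sigma> P z)\<^sup>2 \<le> r\<^sup>2" by (rule iffD1[OF ennreal_le_iff, rotated]) simp
    then have "root_kernel \<sigma> P z \<le> r" using real(1) by (rule power2_le_imp_le)
    then show ?thesis unfolding real(2) by (rule ennreal_leI)
  qed simp
  define A where "A = (\<integral>\<^sup>+y. ennreal ((1 + norm y) ^ 1 * gauss_density (sqrt 2 * \<sigma>) y) \<partial>(lborel :: (real ^ 'd) measure))"
  have A: "A < \<infinity>"
    unfolding A_def by (rule nn_integral_gauss_moment_finite) (use \<sigma> in simp)
  have "(\<integral>\<^sup>+z. ennreal ((1 + norm z) * root_kernel \<sigma> P z) \<partial>lborel)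
    \<le> (\<integral>\<^sup>+z. (\<Sum>j. ennreal ((1 + norm z) * b j z)) \<partial>lborel)"
  proof (rule nn_integral_mono)
    fix z
    have "ennreal ((1 + norm z) * root_kernel \<sigma> P z) = ennreal (1 + norm z) * ennreal (root_kernel \<sigma> P z)"
      by (rule ennreal_mult) (auto simp: root_kernel_nonneg)
    also have "\<dots> \<le> ennreal (1 + norm z) * (\<Sum>j. ennreal (b j z))"
      using le by (intro mult_left_mono) auto
    also have "\<dots> = (\<Sum>j. ennreal (1 + norm z) * ennreal (b j z))"
      by (rule ennreal_suminf_cmult[symmetric])
    also have "\<dots> = (\<Sum>j. ennreal ((1 + norm z) * b j z))"
      using b0 by (intro suminf_cong ennreal_mult[symmetric]) auto
    finally show "ennreal ((1 + norm z) * root_kernel \<sigma> P z) \<le> (\<Sum>j. ennreal ((1 + norm z) * b j z))" .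
  qed
  also have "\<dots> = (\<Sum>j. \<integral>\<^sup>+z. ennreal ((1 + norm z) * b j z) \<partial>lborel)"
    by (rule nn_integral_suminf) measurable
  also have "\<dots> \<le> (\<Sum>j. ennreal (2 * K) * A * ennreal (M j * sqrt (measure P (I j))))"
  proof (intro suminf_le summableI)
    fix j
    have s: "(1 + norm z) * b j z = (sqrt (measure P (I j)) * K) *
        ((1 + norm z) ^ 1 * gauss_density (sqrt 2 * \<sigma>) (y j - z))" for z
      by (simp add: b_def)
    have "(\<integral>\<^sup>+z. ennreal ((1 + norm z) * b j z) \<partial>lborel) = ennreal (sqrt (measure P (I j)) * K) *
        (\<integral>\<^sup>+z. ennreal ((1 + norm z) ^ 1 * gauss_density (sqrt 2 * \<sigma>) (y j - z)) \<partial>lborel)"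
      unfolding s using K by (subst nn_integral_cmult[symmetric]) (auto simp: ennreal_mult gauss_density_nonneg)
    also have "\<dots> \<le> ennreal (sqrt (measure P (I j)) * K) * (ennreal ((1 + norm (y j)) ^ 1) * A)"
      unfolding A_def by (intro mult_left_mono nn_integral_weighted_gauss_shift) auto
    also have "\<dots> \<le> ennreal (sqrt (measure P (I j)) * K) * (ennreal (2 * M j) * A)"
      using yM[of j] M(2)[of j] by (intro mult_left_mono mult_right_mono ennreal_leI) auto
    also have "\<dots> = ennreal (2 * K) * A * ennreal (M j * sqrt (measure P (I j)))"
    proof -
      have "ennreal (sqrt (measure P (I j)) * K) * ennreal (2 * M j)
        = ennreal (2 * K) * ennreal (M j * sqrt (measure P (I j)))"
        using K M(2)[of j] by (simp add: ennreal_mult[symmetric] mult_ac)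
      then show ?thesis by (metis mult.assoc mult.commute)
    qed
    finally show "(\<integral>\<^sup>+z. ennreal ((1 + norm z) * b j z) \<partial>lborel)
      \<le> ennreal (2 * K) * A * ennreal (M j * sqrt (measure P (I j)))" .
  qed
  also have "\<dots> = ennreal (2 * K) * A * (\<Sum>j. ennreal (M j * sqrt (measure P (I j))))"
    by (rule ennreal_suminf_cmult)
  also have "\<dots> < \<infinity>"
  proof -
    have M0: "0 \<le> M j" for j
      by (rule order_trans[OF zero_le_one M(2)])
    have "(\<Sum>j. ennreal (M j * sqrt (measure P (I j)))) = ennreal (\<Sum>j. M j * sqrt (measure P (I j)))"
      by (rule suminf_ennreal2[OF mult_nonneg_nonneg[OF M0 real_sqrt_ge_zero[OF measure_nonneg]] sum])
    then have "(\<Sum>j. ennreal (M j * sqrt (measure P (I j)))) < \<infinity>"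
      by (simp only: infinity_ennreal_def ennreal_less_top)
    then show ?thesis
      using A by (auto intro!: ennreal_mult_less_top[THEN iffD2])
  qed
  finally show ?thesis .
qed

subsection \<open>Trigonometric polynomials and convergence of cosine integrals\<close>

text \<open>The common pattern of the limit theorems below: the approximating sequence and its limit
  may both depend on the tolerance.\<close>

lemma LIMSEQ_approx:
  fixes x :: "nat \<Rightarrow> real"
  assumes "\<And>e. e > 0 \<Longrightarrow> \<exists>y y'. (\<forall>\<^sub>F n in sequentially. \<bar>x n - y n\<bar> \<le> e) \<and> \<bar>x' - y'\<bar> \<le> e \<and> y \<longlonglongrightarrow> y'"
  shows "x \<longlonglongrightarrow> x'"
proof (rule tendstoI)
  fix e :: real assume "0 < e"
  then obtain y y' where y: "\<forall>\<^sub>F n in sequentially. \<bar>x n - y n\<bar> \<le> e / 4" "\<bar>x' - y'\<bar> \<le> e / 4" "y \<longlonglongrightarrow> y'"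
    using assms[of "e / 4"] by auto
  have "\<forall>\<^sub>F n in sequentially. dist (y n) y' < e / 4"
    using y(3) \<open>0 < e\<close> by (intro tendstoD) auto
  with y(1) show "\<forall>\<^sub>F n in sequentially. dist (x n) x' < e"
  proof eventually_elim
    case (elim n)
    with y(2) \<open>0 < e\<close> show ?case unfolding dist_real_def by linarith
  qed
qed

lemma abs_integral_le:
  fixes f g :: "'a \<Rightarrow> real"
  assumes "integrable M f" "integrable M g" "\<And>x. x \<in> space M \<Longrightarrow> \<bar>f x\<bar> \<le> g x"
  shows "\<bar>\<integral>x. f x \<partial>M\<bar> \<le> (\<integral>x. g x \<partial>M)"
  using integral_abs_bound[of M f] integral_mono[OF integrable_abs[OF assms(1)] assms(2,3)] by linarith

text \<open>The phase b lets cosines alone generate the class, sines being shifted cosines, and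
  makes it closed under products by the product-to-sum formula.\<close>

inductive trig_poly :: "'i set \<Rightarrow> (('i \<Rightarrow> real) \<Rightarrow> real) \<Rightarrow> bool" for I where
  cos: "trig_poly I (\<lambda>x. cos ((\<Sum>i\<in>I. a i * x i) + b))"
| add: "trig_poly I f \<Longrightarrow> trig_poly I g \<Longrightarrow> trig_poly I (\<lambda>x. f x + g x)"
| cmult: "trig_poly I f \<Longrightarrow> trig_poly I (\<lambda>x. c * f x)"

lemma trig_poly_mult:
  assumes "trig_poly I f" "trig_poly I g"
  shows "trig_poly I (\<lambda>x. f x * g x)"
  using assms(1)
proof induction
  case (cos a b)
  from assms(2) show ?case
  proof induction
    case (cos a' b')
    have "trig_poly I (\<lambda>x. (1 / 2) * (cos ((\<Sum>i\<in>I. (a i - a' i) * x i) + (b - b')) +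
        cos ((\<Sum>i\<in>I. (a i + a' i) * x i) + (b + b'))))"
      by (intro trig_poly.intros)
    moreover have "(\<Sum>i\<in>I. (a i - a' i) * x i) + (b - b') = ((\<Sum>i\<in>I. a i * x i) + b) - ((\<Sum>i\<in>I. a' i * x i) + b')"
      "(\<Sum>i\<in>I. (a i + a' i) * x i) + (b + b') = ((\<Sum>i\<in>I. a i * x i) + b) + ((\<Sum>i\<in>I. a' i * x i) + b')" for x
      by (simp_all add: algebra_simps sum.distrib sum_subtractf)
    ultimately show ?case by (simp add: cos_times_cos)
  next
    case (add f g)
    then show ?case by (auto simp: distrib_left intro: trig_poly.add)
  next
    case (cmult f c)
    then show ?case by (auto simp: mult.left_commute[of _ c] intro: trig_poly.cmult)
  qed
next
  case (add f g)
  then show ?case by (auto simp: distrib_right intro: trig_poly.add)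
next
  case (cmult f c)
  then show ?case by (auto simp: mult.assoc intro: trig_poly.cmult)
qed

lemma trig_poly_const: "trig_poly I (\<lambda>x. c)"
  using trig_poly.cmult[OF trig_poly.cos[of I "\<lambda>_. 0" 0], of c] by simp

lemma trig_poly_sin:
  assumes "finite I" "i \<in> I"
  shows "trig_poly I (\<lambda>x. sin (c * x i))"
proof -
  have "(\<lambda>x. cos ((\<Sum>j\<in>I. (if j = i then c else 0) * x j) + - (pi / 2))) = (\<lambda>x. sin (c * x i))"
    using assms by (simp add: if_distrib[of "\<lambda>t. t * _"] cos_diff cong: if_cong)
  then show ?thesis using trig_poly.cos[of I "\<lambda>j. if j = i then c else 0" "- (pi / 2)"] by simp
qed

lemma trig_poly_bounded:
  assumes "trig_poly I f"
  shows "\<exists>B. \<forall>x. \<bar>f x\<bar> \<le> B"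
  using assms
proof induction
  case (cos a b)
  show ?case by (rule exI[of _ 1]) simp
next
  case (add f g)
  then obtain B B' where "\<And>x. \<bar>f x\<bar> \<le> B" "\<And>x. \<bar>g x\<bar> \<le> B'" by blast
  then have "\<bar>f x + g x\<bar> \<le> B + B'" for x
    using abs_triangle_ineq[of "f x" "g x"] by (smt (verit))
  then show ?case by blast
next
  case (cmult f c)
  then obtain B where "\<And>x. \<bar>f x\<bar> \<le> B" by blast
  then have "\<bar>c * f x\<bar> \<le> \<bar>c\<bar> * B" for x by (simp add: abs_mult mult_left_mono)
  then show ?case by blast
qed

lemma trig_poly_measurable:
  assumes "trig_poly I f" and [measurable]: "\<And>i. i \<in> I \<Longrightarrow> (\<lambda>\<omega>. V \<omega> i) \<in> borel_measurable M"
  shows "(\<lambda>\<omega>. f (V \<omega>)) \<in> borel_measurable M"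
  using assms(1)
proof induction
  case (cos a b)
  have "(\<lambda>\<omega>. \<Sum>i\<in>I. a i * V \<omega> i) \<in> borel_measurable M"
    by (rule borel_measurable_sum) measurable
  then show ?case by measurable
next
  case (add f g)
  then show ?case by (intro borel_measurable_add)
next
  case (cmult f c)
  then show ?case by (intro borel_measurable_times borel_measurable_const)
qed

lemma trig_poly_integral_tendsto:
  assumes f: "trig_poly I f"
    and M: "\<And>n. prob_space (M n)" and N: "prob_space N"
    and V: "\<And>n i. i \<in> I \<Longrightarrow> (\<lambda>\<omega>. V n \<omega> i) \<in> borel_measurable (M n)"
    and U: "\<And>i. i \<in> I \<Longrightarrow> (\<lambda>\<omega>. U \<omega> i) \<in> borel_measurable N"
    and conv: "\<And>a b. (\<lambda>n. \<integral>\<omega>. cos ((\<Sum>i\<in>I. a i * V n \<omega> i) + b) \<partial>M n)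
      \<longlonglongrightarrow> (\<integral>\<omega>. cos ((\<Sum>i\<in>I. a i * U \<omega> i) + b) \<partial>N)"
  shows "(\<lambda>n. \<integral>\<omega>. f (V n \<omega>) \<partial>M n) \<longlonglongrightarrow> (\<integral>\<omega>. f (U \<omega>) \<partial>N)"
proof -
  have int: "integrable K (\<lambda>\<omega>. f (W \<omega>))"
    if f: "trig_poly I f" and K: "prob_space K" and W: "\<And>i. i \<in> I \<Longrightarrow> (\<lambda>\<omega>. W \<omega> i) \<in> borel_measurable K"
    for f K and W :: "'z \<Rightarrow> 'a \<Rightarrow> real"
  proof -
    interpret prob_space K by fact
    obtain B where B: "\<And>x. \<bar>f x\<bar> \<le> B" using trig_poly_bounded[OF f] by blast
    show ?thesis
      by (rule integrable_const_bound[where B=B]) (use B trig_poly_measurable[OF f W] in auto)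
  qed
  show ?thesis
    using f
  proof induction
    case (cos a b)
    show ?case by (rule conv)
  next
    case (add f g)
    have "(\<integral>\<omega>. f (V n \<omega>) + g (V n \<omega>) \<partial>M n) = (\<integral>\<omega>. f (V n \<omega>) \<partial>M n) + (\<integral>\<omega>. g (V n \<omega>) \<partial>M n)" for n
      by (rule Bochner_Integration.integral_add; rule int) (use add M V in auto)
    moreover have "(\<integral>\<omega>. f (U \<omega>) + g (U \<omega>) \<partial>N) = (\<integral>\<omega>. f (U \<omega>) \<partial>N) + (\<integral>\<omega>. g (U \<omega>) \<partial>N)"
      by (rule Bochner_Integration.integral_add; rule int) (use add N U in auto)
    ultimately show ?case using tendsto_add[OF add.IH] by simp
  next
    case (cmult f c)
    then show ?case by (simp add: tendsto_mult_left)
  qed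
qed

text \<open>Pinning the coordinates outside I to 0 keeps the box compact for the product topology
  and ensures that two distinct points are separated by a coordinate in I.\<close>

lemma compact_coordinate_box: "compact {s :: 'i \<Rightarrow> real. \<forall>i. s i \<in> (if i \<in> I then {- 1..1} else {0})}"
proof -
  have "compactin (product_topology (\<lambda>i. euclidean) UNIV)
    (\<Pi>\<^sub>E i\<in>UNIV. if i \<in> I then {- 1..1 :: real} else {0})"
    by (subst compactin_PiE) auto
  moreover have "(\<Pi>\<^sub>E i\<in>UNIV. if i \<in> I then {- 1..1 :: real} else {0}) =
    {s :: 'i \<Rightarrow> real. \<forall>i. s i \<in> (if i \<in> I then {- 1..1} else {0})}"
    by (auto simp: PiE_def extensional_def Pi_def)
  ultimately show ?thesis by (simp add: euclidean_product_topology)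
qed

text \<open>The sum runs over I only, so the hypothesis also says that F ignores every other
  coordinate; this is why finitely many coordinate maps suffice for continuity.\<close>

lemma continuous_on_l1_lipschitz:
  fixes F :: "('i \<Rightarrow> real) \<Rightarrow> real"
  assumes I: "finite I" and lip: "\<And>x y. \<bar>F x - F y\<bar> \<le> C * (\<Sum>i\<in>I. \<bar>x i - y i\<bar>)"
  shows "continuous_on UNIV F"
  unfolding continuous_on_def
proof
  fix x :: "'i \<Rightarrow> real"
  have "((\<lambda>y. y i) \<longlongrightarrow> x i) (at x within UNIV)" for i
    using continuous_on_product_coordinates[of i, where 'b=real] by (simp add: continuous_on_def)
  then have "((\<lambda>y. C * (\<Sum>i\<in>I. \<bar>y i - x i\<bar>)) \<longlongrightarrow> C * (\<Sum>i\<in>I. \<bar>x i - x i\<bar>)) (at x within UNIV)"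
    by (intro tendsto_intros)
  then have "((\<lambda>y. C * (\<Sum>i\<in>I. \<bar>y i - x i\<bar>)) \<longlongrightarrow> 0) (at x within UNIV)" by simp
  then have "((\<lambda>y. F y - F x) \<longlongrightarrow> 0) (at x within UNIV)"
    by (rule Lim_null_comparison[rotated]) (simp add: lip)
  then show "(F \<longlongrightarrow> F x) (at x within UNIV)" by (simp add: LIM_zero_iff)
qed

text \<open>Folding the box \<open>[-L, L]\<close> periodically by \<open>t \<mapsto> (2 L / \<pi>) arcsin (sin (\<pi> t / (2 L)))\<close> keeps the
  approximating trigonometric polynomial bounded outside the box.\<close>

lemma trig_poly_approximation:
  fixes F :: "('i::countable \<Rightarrow> real) \<Rightarrow> real"
  assumes I: "finite I" and lip: "\<And>x y. \<bar>F x - F y\<bar> \<le> C * (\<Sum>i\<in>I. \<bar>x i - y i\<bar>)"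
    and bounded: "\<And>x. \<bar>F x\<bar> \<le> B" and L: "0 < L" and e: "0 < e"
  shows "\<exists>T. trig_poly I T \<and> (\<forall>x. (\<forall>i\<in>I. \<bar>x i\<bar> \<le> L) \<longrightarrow> \<bar>F x - T x\<bar> \<le> e) \<and> (\<forall>x. \<bar>F x - T x\<bar> \<le> 2 * B + e)"
proof -
  define c where "c = pi / (2 * L)"
  have c: "0 < c" using L by (simp add: c_def)
  define S where "S = {s :: 'i \<Rightarrow> real. \<forall>i. s i \<in> (if i \<in> I then {- 1..1} else {0})}"
  \<comment> \<open>F expressed in the variable s = sin (c x). On the box the arcsine recovers x, so
    composing with \<open>w\<close> gives F back there.\<close>
  define \<Phi> where "\<Phi> s = F (\<lambda>i. arcsin (s i) / c)" for s :: "'i \<Rightarrow> real"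
  define w where "w x = (\<lambda>i. if i \<in> I then sin (c * x i) else 0)" for x :: "'i \<Rightarrow> real"
  have w: "w x \<in> S" for x by (auto simp: w_def S_def)
  have S1: "- 1 \<le> s i \<and> s i \<le> 1" if "s \<in> S" for s i
  proof -
    have "s i \<in> (if i \<in> I then {- 1..1} else {0})" using that by (simp add: S_def)
    then show ?thesis by (cases "i \<in> I") auto
  qed
  \<comment> \<open>The algebra for Stone--Weierstrass: continuous functions on the box that become
    trigonometric polynomials after the substitution \<open>w\<close>.\<close>
  define Pr where "Pr p \<longleftrightarrow> continuous_on S p \<and> trig_poly I (\<lambda>x. p (w x))" for p
  have "\<exists>p. Pr p \<and> (\<forall>s\<in>S. \<bar>\<Phi> s - p s\<bar> < e)"
  proof (rule Stone_Weierstrass_HOL)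
    show "compact S" unfolding S_def by (rule compact_coordinate_box)
    show "Pr (\<lambda>x. a)" for a by (auto simp: Pr_def trig_poly_const)
    show "Pr f \<Longrightarrow> continuous_on S f" for f by (simp add: Pr_def)
    show "Pr f \<and> Pr g \<Longrightarrow> Pr (\<lambda>x. f x + g x)" for f g
      by (auto simp: Pr_def intro: continuous_intros trig_poly.add)
    show "Pr f \<and> Pr g \<Longrightarrow> Pr (\<lambda>x. f x * g x)" for f g
      by (auto simp: Pr_def intro: continuous_intros trig_poly_mult)
    show "\<exists>f. Pr f \<and> f x \<noteq> f y" if xy: "x \<in> S \<and> y \<in> S \<and> x \<noteq> y" for x y
    proof -
      obtain i where i: "x i \<noteq> y i" using xy by auto
      have "i \<in> I"
      proof (rule ccontr)
        assume "i \<notin> I"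
        moreover have "x i \<in> (if i \<in> I then {- 1..1} else {0})" "y i \<in> (if i \<in> I then {- 1..1} else {0})"
          using xy by (simp_all add: S_def)
        ultimately show False using i by simp
      qed
      then have "Pr (\<lambda>s. s i)"
        using trig_poly_sin[OF I, of i c]
        by (auto simp: Pr_def w_def intro: continuous_on_subset[OF continuous_on_product_coordinates])
      then show ?thesis using i by blast
    qed
    show "continuous_on S \<Phi>"
      unfolding \<Phi>_def
      by (rule continuous_on_compose2[OF continuous_on_l1_lipschitz[OF I lip]])
        (use c S1 in \<open>auto intro!: continuous_intros continuous_on_subset[OF continuous_on_product_coordinates]\<close>)
    show "0 < e" by fact
  qed
  then obtain p where p: "Pr p" "\<And>s. s \<in> S \<Longrightarrow> \<bar>\<Phi> s - p s\<bar> < e" by blast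
  have close: "\<bar>\<Phi> (w x) - p (w x)\<bar> \<le> e" for x
    using p(2)[OF w[of x]] by simp
  have "F x = \<Phi> (w x)" if x: "\<forall>i\<in>I. \<bar>x i\<bar> \<le> L" for x
  proof -
    have "arcsin (sin (c * x i)) / c = x i" if "i \<in> I" for i
    proof -
      have "\<bar>c * x i\<bar> \<le> c * L" using x c that by (simp add: abs_mult)
      also have "c * L = pi / 2" using L by (simp add: c_def)
      finally have "arcsin (sin (c * x i)) = c * x i" by (intro arcsin_sin) (auto simp: abs_le_iff)
      then show ?thesis using c by simp
    qed
    then have "(\<Sum>i\<in>I. \<bar>x i - arcsin (w x i) / c\<bar>) = 0"
      by (intro sum.neutral) (simp add: w_def)
    then have "\<bar>F x - F (\<lambda>i. arcsin (w x i) / c)\<bar> \<le> C * 0"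
      using lip[of x "\<lambda>i. arcsin (w x i) / c"] by simp
    then show ?thesis by (simp add: \<Phi>_def)
  qed
  then have "\<bar>F x - p (w x)\<bar> \<le> e" if "\<forall>i\<in>I. \<bar>x i\<bar> \<le> L" for x
    using close that by simp
  \<comment> \<open>Outside the box the approximant is still within e of a value of F, since
    \<open>w\<close> maps every x into S; both values of F are bounded by B.\<close>
  moreover have "\<bar>F x - p (w x)\<bar> \<le> 2 * B + e" for x
    using close[of x] bounded[of x] bounded[of "\<lambda>i. arcsin (w x i) / c"] unfolding \<Phi>_def by linarith
  ultimately show ?thesis using p(1) unfolding Pr_def by blast
qed

text \<open>The Cramer--Wold step. On a box of large probability F is a trigonometric polynomial up
  to a small error, outside it the difference is bounded, and for trigonometric polynomials
  convergence is the hypothesis on cosines extended by linearity. Applied to constant sequences it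
  also shows that cosine integrals determine a measure.\<close>

lemma cos_convergence_imp_lipschitz_convergence:
  fixes F :: "('i::countable \<Rightarrow> real) \<Rightarrow> real"
  assumes I: "finite I"
    and M: "\<And>n. prob_space (M n)" and N: "prob_space N"
    and V: "\<And>n i. i \<in> I \<Longrightarrow> (\<lambda>\<omega>. V n \<omega> i) \<in> borel_measurable (M n)"
    and U: "\<And>i. i \<in> I \<Longrightarrow> (\<lambda>\<omega>. U \<omega> i) \<in> borel_measurable N"
    and conv: "\<And>a b. (\<lambda>n. \<integral>\<omega>. cos ((\<Sum>i\<in>I. a i * V n \<omega> i) + b) \<partial>M n)
      \<longlonglongrightarrow> (\<integral>\<omega>. cos ((\<Sum>i\<in>I. a i * U \<omega> i) + b) \<partial>N)"
    and tight: "\<And>e. e > 0 \<Longrightarrow> \<exists>L>0. (\<forall>\<^sub>F n in sequentially. measure (M n) {\<omega> \<in> space (M n). \<exists>i\<in>I. \<bar>V n \<omega> i\<bar> > L} \<le> e)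
      \<and> measure N {\<omega> \<in> space N. \<exists>i\<in>I. \<bar>U \<omega> i\<bar> > L} \<le> e"
    and lip: "\<And>x y. \<bar>F x - F y\<bar> \<le> C * (\<Sum>i\<in>I. \<bar>x i - y i\<bar>)"
    and bounded: "\<And>x. \<bar>F x\<bar> \<le> B"
  shows "(\<lambda>n. \<integral>\<omega>. F (V n \<omega>) \<partial>M n) \<longlonglongrightarrow> (\<integral>\<omega>. F (U \<omega>) \<partial>N)"
proof (rule LIMSEQ_approx)
  fix e :: real assume e: "0 < e"
  have B: "0 \<le> B" using bounded[of "\<lambda>_. 0"] by linarith
  \<comment> \<open>Chosen so that the bad event contributes 2 B d < e / 2; the summand 2 keeps the
    quotient meaningful when B is 0.\<close>
  define d where "d = e / (4 * B + 2)"
  have d: "0 < d" using e B by (simp add: d_def)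
  obtain L where L: "0 < L"
    "\<forall>\<^sub>F n in sequentially. measure (M n) {\<omega> \<in> space (M n). \<exists>i\<in>I. \<bar>V n \<omega> i\<bar> > L} \<le> d"
    "measure N {\<omega> \<in> space N. \<exists>i\<in>I. \<bar>U \<omega> i\<bar> > L} \<le> d"
    using tight[OF d] by blast
  obtain T where T: "trig_poly I T" "\<And>x. (\<forall>i\<in>I. \<bar>x i\<bar> \<le> L) \<Longrightarrow> \<bar>F x - T x\<bar> \<le> e / 2"
    "\<And>x. \<bar>F x - T x\<bar> \<le> 2 * B + e / 2"
    using trig_poly_approximation[OF I lip bounded L(1), of "e / 2"] e by auto
  have Bd: "2 * B * d + e / 2 \<le> e"
    using B e by (simp add: d_def field_simps)
  have close: "\<bar>(\<integral>\<omega>. F (W \<omega>) \<partial>K) - (\<integral>\<omega>. T (W \<omega>) \<partial>K)\<bar> \<le> e"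
    if K: "prob_space K" and W[measurable]: "\<And>i. i \<in> I \<Longrightarrow> (\<lambda>\<omega>. W \<omega> i) \<in> borel_measurable K"
      and small: "measure K {\<omega> \<in> space K. \<exists>i\<in>I. \<bar>W \<omega> i\<bar> > L} \<le> d" for K and W :: "'z \<Rightarrow> 'i \<Rightarrow> real"
  proof -
    interpret prob_space K by fact
    define Z where "Z = {\<omega> \<in> space K. \<exists>i\<in>I. \<bar>W \<omega> i\<bar> > L}"
    have Z: "Z \<in> sets K" unfolding Z_def using I by measurable
    \<comment> \<open>Measurability is known only for coordinates in I. The others are set to 0,
      which leaves F unchanged by the Lipschitz hypothesis.\<close>
    have "(\<lambda>\<omega> i. if i \<in> I then W \<omega> i else 0) \<in> borel_measurable K"
    proof (rule measurable_coordinatewise_then_product)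
      show "(\<lambda>\<omega>. if i \<in> I then W \<omega> i else 0) \<in> borel_measurable K" for i
        by (cases "i \<in> I") (simp_all add: W)
    qed
    then have "(\<lambda>\<omega>. F (\<lambda>i. if i \<in> I then W \<omega> i else 0)) \<in> borel_measurable K"
      by (rule measurable_compose[OF _ borel_measurable_continuous_onI[OF continuous_on_l1_lipschitz[OF I lip]]])
    moreover have "F (\<lambda>i. if i \<in> I then W \<omega> i else 0) = F (W \<omega>)" for \<omega>
    proof -
      have "(\<Sum>i\<in>I. \<bar>(if i \<in> I then W \<omega> i else 0) - W \<omega> i\<bar>) = 0"
        by (intro sum.neutral) simp
      then show ?thesis using lip[of "\<lambda>i. if i \<in> I then W \<omega> i else 0" "W \<omega>"] by simp
    qed
    ultimately have Fm: "(\<lambda>\<omega>. F (W \<omega>)) \<in> borel_measurable K" by simp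
    have Fint: "integrable K (\<lambda>\<omega>. F (W \<omega>))"
      by (rule integrable_const_bound[where B=B]) (use bounded Fm in auto)
    obtain B' where B': "\<And>x. \<bar>T x\<bar> \<le> B'" using trig_poly_bounded[OF T(1)] by blast
    have Tint: "integrable K (\<lambda>\<omega>. T (W \<omega>))"
      by (rule integrable_const_bound[where B=B']) (use B' trig_poly_measurable[OF T(1) W] in auto)
    have "\<bar>\<integral>\<omega>. F (W \<omega>) - T (W \<omega>) \<partial>K\<bar> \<le> (\<integral>\<omega>. 2 * B * indicator Z \<omega> + e / 2 \<partial>K)"
    proof (rule abs_integral_le)
      show "integrable K (\<lambda>\<omega>. 2 * B * indicator Z \<omega> + e / 2)"
        using Z by (intro Bochner_Integration.integrable_add integrable_mult_right integrable_real_indicator)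
          (auto simp: emeasure_eq_measure)
      show "\<bar>F (W \<omega>) - T (W \<omega>)\<bar> \<le> 2 * B * indicator Z \<omega> + e / 2" if "\<omega> \<in> space K" for \<omega>
      proof (cases "\<omega> \<in> Z")
        case True
        then show ?thesis using T(3)[of "W \<omega>"] by simp
      next
        case False
        then have "\<forall>i\<in>I. \<bar>W \<omega> i\<bar> \<le> L" using that by (auto simp: Z_def not_less)
        then show ?thesis using False T(2)[of "W \<omega>"] by simp
      qed
    qed (use Fint Tint in auto)
    also have "\<dots> = 2 * B * measure K Z + e / 2"
      using Z by (subst Bochner_Integration.integral_add) (auto simp: prob_space emeasure_eq_measure)
    also have "\<dots> \<le> 2 * B * d + e / 2"
      using small B by (intro add_right_mono mult_left_mono) (auto simp: Z_def)
    also have "\<dots> \<le> e" by (rule Bd)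
    finally show ?thesis using Fint Tint by simp
  qed
  have "\<forall>\<^sub>F n in sequentially. \<bar>(\<integral>\<omega>. F (V n \<omega>) \<partial>M n) - (\<integral>\<omega>. T (V n \<omega>) \<partial>M n)\<bar> \<le> e"
    using L(2) by eventually_elim (rule close[OF M V])
  moreover have "\<bar>(\<integral>\<omega>. F (U \<omega>) \<partial>N) - (\<integral>\<omega>. T (U \<omega>) \<partial>N)\<bar> \<le> e"
    by (rule close[OF N U L(3)])
  moreover have "(\<lambda>n. \<integral>\<omega>. T (V n \<omega>) \<partial>M n) \<longlonglongrightarrow> (\<integral>\<omega>. T (U \<omega>) \<partial>N)"
    by (rule trig_poly_integral_tendsto[OF T(1) M N V U conv])
  ultimately show "\<exists>y y'. (\<forall>\<^sub>F n in sequentially. \<bar>(\<integral>\<omega>. F (V n \<omega>) \<partial>M n) - y n\<bar> \<le> e) \<and>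
      \<bar>(\<integral>\<omega>. F (U \<omega>) \<partial>N) - y'\<bar> \<le> e \<and> y \<longlonglongrightarrow> y'"
    by (intro exI[of _ "\<lambda>n. \<integral>\<omega>. T (V n \<omega>) \<partial>M n"] exI[of _ "\<integral>\<omega>. T (U \<omega>) \<partial>N"] conjI)
qed

subsection \<open>Gaussian integrals and injectivity of smoothing\<close>

text \<open>An affine image of the standard normal law, which includes the point mass as the case s
  = 0 and so avoids a case distinction in moments and cosine integrals.\<close>

lemma normal_law_eq_distr:
  assumes "s \<ge> 0"
  shows "normal_law m s = distr std_normal_distribution borel (\<lambda>x. m + s * x)"
proof -
  interpret S: prob_space std_normal_distribution by (rule prob_space_normal_density) simp
  show ?thesis
  proof (cases "s = 0")
    case True
    then show ?thesis by (simp add: normal_law_def)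
  next
    case False
    have "distributed std_normal_distribution lborel (\<lambda>x. x) (normal_density 0 1)"
      by (auto simp: distributed_def intro!: measure_eqI simp: emeasure_distr)
    from S.normal_density_affine[OF this, of s m] False assms
    have "distributed std_normal_distribution lborel (\<lambda>x. m + s * x) (normal_density m s)" by simp
    then have "distr std_normal_distribution lborel (\<lambda>x. m + s * x) = density lborel (normal_density m s)"
      by (rule distributed_distr_eq_density)
    moreover have "distr std_normal_distribution lborel (\<lambda>x. m + s * x) = distr std_normal_distribution borel (\<lambda>x. m + s * x)"
      by (rule distr_cong) auto
    ultimately show ?thesis using False by (simp add: normal_law_def)
  qed
qed

lemma integral_lborel_prod:
  fixes f :: "'a::euclidean_space \<Rightarrow> real \<Rightarrow> complex"
  assumes f: "\<And>b. b \<in> Basis \<Longrightarrow> integrable lborel (f b)"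
  shows "(\<integral>x. (\<Prod>b\<in>Basis. f b (x \<bullet> b)) \<partial>lborel) = (\<Prod>b\<in>Basis. \<integral>x. f b x \<partial>lborel)"
proof -
  interpret product_sigma_finite "\<lambda>b :: 'a. lborel :: real measure" ..
  have [measurable]: "f b \<in> borel_measurable borel" if "b \<in> Basis" for b
    using borel_measurable_integrable[OF f[OF that]] by simp
  have [measurable]: "(\<lambda>x :: 'a. \<Prod>b\<in>Basis. f b (x \<bullet> b)) \<in> borel_measurable borel"
    by (rule borel_measurable_prod) measurable
  have "(\<integral>x. (\<Prod>b\<in>Basis. f b (x \<bullet> b)) \<partial>lborel) =
    (\<integral>x. (\<Prod>b\<in>Basis. f b ((\<Sum>i\<in>Basis. x i *\<^sub>R i) \<bullet> b)) \<partial>(\<Pi>\<^sub>M b\<in>(Basis :: 'a set). lborel))"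
    by (subst lborel_eq, subst integral_distr) auto
  also have "\<dots> = (\<integral>x. (\<Prod>b\<in>Basis. f b (x b)) \<partial>(\<Pi>\<^sub>M b\<in>(Basis :: 'a set). lborel))"
    by (intro Bochner_Integration.integral_cong prod.cong) (auto simp: inner_sum_left_Basis)
  also have "\<dots> = (\<Prod>b\<in>Basis. \<integral>x. f b x \<partial>lborel)"
    using f by (intro product_integral_prod) auto
  finally show ?thesis .
qed

lemma
  assumes \<sigma>: "\<sigma> > 0"
  shows integrable_iexp_normal: "integrable lborel (\<lambda>x. iexp (t * x) * of_real (normal_density 0 \<sigma> x))"
    and integral_iexp_normal: "(\<integral>x. iexp (t * x) * of_real (normal_density 0 \<sigma> x) \<partial>lborel) = of_real (exp (- (t * \<sigma>)\<^sup>2 / 2))"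
proof -
  interpret S: prob_space std_normal_distribution by (rule prob_space_normal_density) simp
  have int: "integrable lborel (\<lambda>x. normal_density 0 \<sigma> x)"
    by (rule integrable_normal_density[OF \<sigma>])
  show "integrable lborel (\<lambda>x. iexp (t * x) * of_real (normal_density 0 \<sigma> x))"
    by (rule Bochner_Integration.integrable_bound[OF int]) (auto simp: norm_mult)
  have "(\<integral>x. iexp (t * x) * of_real (normal_density 0 \<sigma> x) \<partial>lborel) = (\<integral>x. iexp (t * x) \<partial>normal_law 0 \<sigma>)"
    using \<sigma> by (simp add: normal_law_def) (subst integral_density; simp add: normal_density_nonneg scaleR_conv_of_real mult.commute)
  also have "\<dots> = (\<integral>x. iexp (t * (\<sigma> * x)) \<partial>std_normal_distribution)"
    using \<sigma> by (subst normal_law_eq_distr) (auto simp: integral_distr)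
  also have "\<dots> = char std_normal_distribution (t * \<sigma>)"
    by (simp add: char_def mult.assoc)
  also have "\<dots> = of_real (exp (- (t * \<sigma>)\<^sup>2 / 2))"
    by (simp add: char_std_normal_distribution)
  finally show "(\<integral>x. iexp (t * x) * of_real (normal_density 0 \<sigma> x) \<partial>lborel) = of_real (exp (- (t * \<sigma>)\<^sup>2 / 2))" .
qed

lemma integrable_gauss_density_bounded:
  fixes h :: "real ^ 'd \<Rightarrow> 'b::{banach, second_countable_topology, real_normed_algebra_1}"
  assumes \<sigma>: "\<sigma> > 0" and [measurable]: "h \<in> borel_measurable borel" and h: "\<And>y. norm (h y) \<le> B"
  shows "integrable lborel (\<lambda>y. h y * of_real (gauss_density \<sigma> y))"
proof (rule Bochner_Integration.integrable_bound[of _ "\<lambda>y. B * ((1 + norm y) * gauss_density \<sigma> y)"])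
  show "integrable lborel (\<lambda>y :: real ^ 'd. B * ((1 + norm y) * gauss_density \<sigma> y))"
    using integrable_gauss_density_moment[OF \<sigma>, where 'd='d] by simp
  show "AE y in lborel. norm (h y * of_real (gauss_density \<sigma> y)) \<le> norm (B * ((1 + norm y) * gauss_density \<sigma> y))"
  proof (rule AE_I2)
    fix y :: "real ^ 'd"
    have B: "0 \<le> B" using order_trans[OF norm_ge_zero h] .
    have "norm (h y * of_real (gauss_density \<sigma> y)) \<le> norm (h y) * norm (of_real (gauss_density \<sigma> y) :: 'b)"
      by (rule norm_mult_ineq)
    also have "\<dots> \<le> B * gauss_density \<sigma> y"
      using h[of y] by (simp add: mult_right_mono gauss_density_nonneg)
    also have "\<dots> \<le> B * ((1 + norm y) * gauss_density \<sigma> y)"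
      using B by (intro mult_left_mono) (simp_all add: algebra_simps gauss_density_nonneg)
    also have "\<dots> \<le> norm (B * ((1 + norm y) * gauss_density \<sigma> y))" by simp
    finally show "norm (h y * of_real (gauss_density \<sigma> y)) \<le> norm (B * ((1 + norm y) * gauss_density \<sigma> y))" .
  qed
qed measurable

text \<open>Cosines are eigenfunctions of Gaussian smoothing. The eigenvalue is the characteristic
  function of the Gaussian at u; the sine part vanishes because that function is real. Its
  positivity makes smoothing injective.\<close>

lemma gauss_smooth_cos:
  fixes u :: "real ^ 'd"
  assumes \<sigma>: "\<sigma> > 0"
  shows "\<exists>A>0. \<forall>x b. gauss_smooth \<sigma> (\<lambda>x. cos (u \<bullet> x + b)) x = A * cos (u \<bullet> x + b)"
proof -
  have int: "integrable lborel (\<lambda>y :: real ^ 'd. iexp (u \<bullet> y) * of_real (gauss_density \<sigma> y))"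
    by (rule integrable_gauss_density_bounded[OF \<sigma>, where B=1]) auto
  define A where "A = (\<Prod>b\<in>(Basis :: (real ^ 'd) set). exp (- ((u \<bullet> b) * \<sigma>)\<^sup>2 / 2))"
  have "(\<integral>y. iexp (u \<bullet> y) * of_real (gauss_density \<sigma> y) \<partial>(lborel :: (real ^ 'd) measure)) =
    (\<integral>y. (\<Prod>b\<in>Basis. iexp ((u \<bullet> b) * (y \<bullet> b)) * of_real (normal_density 0 \<sigma> (y \<bullet> b))) \<partial>(lborel :: (real ^ 'd) measure))"
  proof (rule Bochner_Integration.integral_cong[OF refl])
    fix y :: "real ^ 'd"
    show "iexp (u \<bullet> y) * of_real (gauss_density \<sigma> y) =
      (\<Prod>b\<in>Basis. iexp ((u \<bullet> b) * (y \<bullet> b)) * of_real (normal_density 0 \<sigma> (y \<bullet> b)))"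
      unfolding gauss_density_eq_prod[OF \<sigma>] prod.distrib euclidean_inner[of u y]
      by (simp add: exp_sum sum_distrib_left)
  qed
  also have "\<dots> = (\<Prod>b\<in>(Basis :: (real ^ 'd) set).
      \<integral>x. iexp ((u \<bullet> b) * x) * of_real (normal_density 0 \<sigma> x) \<partial>lborel)"
    by (rule integral_lborel_prod[where f="\<lambda>b x. iexp ((u \<bullet> b) * x) * of_real (normal_density 0 \<sigma> x)"])
      (rule integrable_iexp_normal[OF \<sigma>])
  also have "\<dots> = (\<Prod>b\<in>(Basis :: (real ^ 'd) set). of_real (exp (- ((u \<bullet> b) * \<sigma>)\<^sup>2 / 2)))"
    by (rule prod.cong[OF refl integral_iexp_normal[OF \<sigma>]])
  also have "\<dots> = of_real A"
    by (simp add: A_def)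
  finally have *: "(\<integral>y. iexp (u \<bullet> y) * of_real (gauss_density \<sigma> y) \<partial>(lborel :: (real ^ 'd) measure)) = of_real A" .
  have iexp: "Re (iexp t) = cos t" "Im (iexp t) = sin t" for t :: real
    by (simp_all add: cis_conv_exp[symmetric])
  have cos: "(\<integral>y. cos (u \<bullet> y) * gauss_density \<sigma> y \<partial>(lborel :: (real ^ 'd) measure)) = A"
    using arg_cong[OF *, of Re] integral_Re[OF int] by (simp add: iexp)
  have sin: "(\<integral>y. sin (u \<bullet> y) * gauss_density \<sigma> y \<partial>(lborel :: (real ^ 'd) measure)) = 0"
    using arg_cong[OF *, of Im] integral_Im[OF int] by (simp add: iexp)
  have ic: "integrable lborel (\<lambda>y :: real ^ 'd. cos (u \<bullet> y) * gauss_density \<sigma> y)"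
    using integrable_gauss_density_bounded[OF \<sigma>, of "\<lambda>y. cos (u \<bullet> y)" 1] by simp
  have isn: "integrable lborel (\<lambda>y :: real ^ 'd. sin (u \<bullet> y) * gauss_density \<sigma> y)"
    using integrable_gauss_density_bounded[OF \<sigma>, of "\<lambda>y. sin (u \<bullet> y)" 1] by simp
  have "gauss_smooth \<sigma> (\<lambda>x. cos (u \<bullet> x + b)) x = A * cos (u \<bullet> x + b)" for x b
  proof -
    have "cos (u \<bullet> (x - y) + b) * gauss_density \<sigma> y =
      cos (u \<bullet> x + b) * (cos (u \<bullet> y) * gauss_density \<sigma> y) +
      sin (u \<bullet> x + b) * (sin (u \<bullet> y) * gauss_density \<sigma> y)" for y
    proof -
      have "cos (u \<bullet> (x - y) + b) = cos ((u \<bullet> x + b) - u \<bullet> y)" by (simp add: inner_diff_right algebra_simps)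
      then show ?thesis by (simp only: cos_diff) (simp add: algebra_simps)
    qed
    then show ?thesis
      unfolding gauss_smooth_def using ic isn by (simp add: cos sin)
  qed
  moreover have "0 < A" unfolding A_def by (intro prod_pos) simp
  ultimately show ?thesis by blast
qed

text \<open>The threshold is given in a form stable under enlargement, so that thresholds for two
  laws can be merged by taking their maximum.\<close>

lemma tight_coordinates:
  assumes "prob_space N" and I: "finite I" and U: "\<And>i. i \<in> I \<Longrightarrow> (\<lambda>\<omega>. U \<omega> i :: real) \<in> borel_measurable N"
    and e: "e > 0"
  shows "\<exists>L0>0. \<forall>L\<ge>L0. measure N {\<omega> \<in> space N. \<exists>i\<in>I. \<bar>U \<omega> i\<bar> > L} \<le> e"
proof -
  interpret prob_space N by fact
  note [measurable] = U
  define Z where "Z L = {\<omega> \<in> space N. \<exists>i\<in>I. \<bar>U \<omega> i\<bar> > L}" for L :: real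
  have Z[measurable]: "Z L \<in> sets N" for L unfolding Z_def using I by measurable
  have "(\<lambda>n. measure N (Z (real n))) \<longlonglongrightarrow> measure N (\<Inter>n. Z (real n))"
  proof (rule finite_Lim_measure_decseq)
    show "decseq (\<lambda>n. Z (real n))"
    proof (intro decseq_SucI subsetI)
      fix n \<omega> assume "\<omega> \<in> Z (real (Suc n))"
      then obtain i where "\<omega> \<in> space N" "i \<in> I" "real (Suc n) < \<bar>U \<omega> i\<bar>" by (auto simp: Z_def)
      moreover then have "real n < \<bar>U \<omega> i\<bar>" by linarith
      ultimately show "\<omega> \<in> Z (real n)" unfolding Z_def by blast
    qed
  qed (use Z in auto)
  moreover have "(\<Inter>n. Z (real n)) = {}"
  proof (rule equals0I)
    fix \<omega> assume \<omega>: "\<omega> \<in> (\<Inter>n. Z (real n))"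
    obtain n where n: "(\<Sum>i\<in>I. \<bar>U \<omega> i\<bar>) \<le> real n" using real_arch_simple by blast
    from \<omega> obtain i where i: "i \<in> I" "\<bar>U \<omega> i\<bar> > real n" by (auto simp: Z_def)
    have "\<bar>U \<omega> i\<bar> \<le> (\<Sum>i\<in>I. \<bar>U \<omega> i\<bar>)" using i I by (intro member_le_sum) auto
    then show False using n i by linarith
  qed
  ultimately have "(\<lambda>n. measure N (Z (real n))) \<longlonglongrightarrow> 0" by simp
  then have "\<forall>\<^sub>F n in sequentially. measure N (Z (real n)) < e"
    using e by (intro order_tendstoD(2)) auto
  then obtain n where "\<forall>k\<ge>n. measure N (Z (real k)) < e"
    unfolding eventually_sequentially by blast
  then have n: "measure N (Z (real (Suc n))) < e" using le_SucI[OF order_refl] by blast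
  have "measure N (Z L) \<le> e" if "real (Suc n) \<le> L" for L
  proof -
    have "measure N (Z L) \<le> measure N (Z (real (Suc n)))"
    proof (rule finite_measure_mono[OF _ Z])
      show "Z L \<subseteq> Z (real (Suc n))"
        unfolding Z_def using le_less_trans[OF that] by blast
    qed
    then show ?thesis using n by simp
  qed
  then show ?thesis unfolding Z_def by (intro exI[of _ "real (Suc n)"]) auto
qed

text \<open>The indicator of a nonempty closed set is the limit of the truncated functions 1 - k
  dist(x, A), which are k-Lipschitz, and closed sets generate the Borel sets.\<close>

lemma measure_eqI_lipschitz:
  fixes Q1 Q2 :: "'a::metric_space measure"
  assumes Q1: "prob_space Q1" "sets Q1 = sets borel" and Q2: "prob_space Q2" "sets Q2 = sets borel"
    and eq: "\<And>C (h :: 'a \<Rightarrow> real). C-lipschitz_on UNIV h \<Longrightarrow> (\<And>x. \<bar>h x\<bar> \<le> 1) \<Longrightarrow> (\<integral>x. h x \<partial>Q1) = (\<integral>x. h x \<partial>Q2)"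
  shows "Q1 = Q2"
proof -
  interpret Q1: prob_space Q1 by fact
  interpret Q2: prob_space Q2 by fact
  have closed_eq: "emeasure Q1 A = emeasure Q2 A" if A: "closed A" for A
  proof (cases "A = {}")
    case False
    define h where "h k x = max 0 (1 - real k * infdist x A)" for k x
    have lip: "(real k)-lipschitz_on UNIV (h k)" for k
    proof (rule lipschitz_onI)
      fix x y
      have "\<bar>infdist x A - infdist y A\<bar> \<le> dist x y"
        using infdist_triangle_abs by blast
      then have "real k * \<bar>infdist x A - infdist y A\<bar> \<le> real k * dist x y"
        by (rule mult_left_mono) simp
      then have "\<bar>real k * infdist x A - real k * infdist y A\<bar> \<le> real k * dist x y"
        by (simp add: abs_mult right_diff_distrib[symmetric])
      then show "dist (h k x) (h k y) \<le> real k * dist x y"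
        unfolding h_def dist_real_def by linarith
    qed simp
    have h1: "\<bar>h k x\<bar> \<le> 1" for k x by (auto simp: h_def infdist_nonneg)
    have [measurable]: "h k \<in> borel_measurable borel" for k
      using lip by (rule borel_measurable_lipschitz)
    have lim: "(\<lambda>k. h k x) \<longlonglongrightarrow> indicator A x" for x
    proof (cases "x \<in> A")
      case True
      then show ?thesis by (simp add: h_def)
    next
      case x: False
      then have pos: "0 < infdist x A" using A False by (simp add: in_closed_iff_infdist_zero infdist_pos_not_in_closed)
      obtain n where n: "1 \<le> real n * infdist x A"
        using reals_Archimedean3[OF pos] by (metis less_imp_le)
      have "h k x = 0" if "n \<le> k" for k
      proof -
        have "real n * infdist x A \<le> real k * infdist x A" using that pos by simp
        then show ?thesis using n by (simp add: h_def)
      qed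
      then have "\<forall>\<^sub>F k in sequentially. h k x = 0" by (auto simp: eventually_sequentially)
      then show ?thesis using x by (simp add: tendsto_eventually)
    qed
    have *: "(\<lambda>k. \<integral>x. h k x \<partial>M) \<longlonglongrightarrow> measure M A"
      if "prob_space M" and [measurable_cong]: "sets M = sets borel" for M
    proof -
      interpret prob_space M by fact
      have [measurable]: "A \<in> sets M" using A that by auto
      have "(\<lambda>k. \<integral>x. h k x \<partial>M) \<longlonglongrightarrow> (\<integral>x. indicator A x \<partial>M)"
        by (rule integral_dominated_convergence[where w="\<lambda>_. 1"]) (use h1 lim in auto)
      then show ?thesis using sets.sets_into_space[of A M] by (simp add: Int_absorb2)
    qed
    have "(\<integral>x. h k x \<partial>Q1) = (\<integral>x. h k x \<partial>Q2)" for k by (rule eq[OF lip h1])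
    then have "measure Q1 A = measure Q2 A"
      using LIMSEQ_unique[OF *[OF Q1]] *[OF Q2] by simp
    then show ?thesis by (simp add: Q1.emeasure_eq_measure Q2.emeasure_eq_measure)
  qed simp
  show ?thesis
  proof (rule measure_eqI_generator_eq[where E="Collect closed" and \<Omega>=UNIV and A="\<lambda>_. UNIV"])
    show "Int_stable (Collect closed)" by (auto simp: Int_stable_def)
    show "sets Q1 = sigma_sets UNIV (Collect closed)" "sets Q2 = sigma_sets UNIV (Collect closed)"
      using Q1(2) Q2(2) by (simp_all add: borel_eq_closed)
  qed (use closed_eq in auto)
qed

text \<open>Only bounded test functions are used, because weak continuity of the model will say
  something about no others. Suitably normalised cosines are among them, and smoothing multiplies a
  cosine by a positive factor, so the two measures have the same cosine integrals.\<close>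

lemma gauss_smooth_injective:
  fixes Q1 Q2 :: "(real ^ 'd::finite) measure"
  assumes \<sigma>: "\<sigma> > 0" and Q1: "prob_space Q1" "sets Q1 = sets borel" and Q2: "prob_space Q2" "sets Q2 = sets borel"
    and eq: "\<And>f. bounded (range (lip_fun f)) \<Longrightarrow>
      (\<integral>x. gauss_smooth \<sigma> (lip_fun f) x \<partial>Q1) = (\<integral>x. gauss_smooth \<sigma> (lip_fun f) x \<partial>Q2)"
  shows "Q1 = Q2"
proof -
  interpret Q1: prob_space Q1 by fact
  interpret Q2: prob_space Q2 by fact
  note [measurable_cong] = Q1(2) Q2(2)
  have cos_eq: "(\<integral>x. cos (u \<bullet> x + b) \<partial>Q1) = (\<integral>x. cos (u \<bullet> x + b) \<partial>Q2)" for u :: "real ^ 'd" and b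
  proof -
    \<comment> \<open>Dividing by c makes the cosine 1-Lipschitz; the summand 1 keeps c positive
      when u is 0, and subtracting \<open>cos b\<close> below arranges the value 0 at the
      origin.\<close>
    define c where "c = 1 + norm u"
    have c: "0 < c" by (simp add: c_def add_pos_nonneg)
    define f where "f = Abs_lip10 (\<lambda>x. (cos (u \<bullet> x + b) - cos b) / c)"
    have "1-lipschitz_on UNIV (\<lambda>x. (cos (u \<bullet> x + b) - cos b) / c)"
    proof (rule lipschitz_onI)
      fix x y :: "real ^ 'd"
      have "\<bar>cos (u \<bullet> x + b) - cos (u \<bullet> y + b)\<bar> \<le> \<bar>(u \<bullet> x + b) - (u \<bullet> y + b)\<bar>"
      proof -
        have "\<bar>cos v - cos w\<bar> \<le> \<bar>v - w\<bar>" for v w :: real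
        proof -
          have "\<bar>cos v - cos w\<bar> = 2 * (\<bar>sin ((v + w) / 2)\<bar> * \<bar>sin ((w - v) / 2)\<bar>)"
            unfolding cos_diff_cos by (simp add: abs_mult)
          also have "\<dots> \<le> 2 * (1 * \<bar>(w - v) / 2\<bar>)"
            by (intro mult_left_mono mult_mono abs_sin_x_le_abs_x abs_sin_le_one) auto
          finally show ?thesis by simp
        qed
        then show ?thesis .
      qed
      also have "\<dots> = \<bar>u \<bullet> (x - y)\<bar>" by (simp add: inner_diff_right)
      also have "\<dots> \<le> norm u * dist x y" unfolding dist_norm by (rule Cauchy_Schwarz_ineq2)
      also have "\<dots> \<le> c * dist x y" by (simp add: c_def mult_right_mono)
      finally have "\<bar>cos (u \<bullet> x + b) - cos (u \<bullet> y + b)\<bar> / c \<le> dist x y"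
        using c by (simp add: field_simps)
      then show "dist ((cos (u \<bullet> x + b) - cos b) / c) ((cos (u \<bullet> y + b) - cos b) / c) \<le> 1 * dist x y"
        using c by (simp add: dist_real_def diff_divide_distrib[symmetric])
    qed simp
    then have f: "lip_fun f = (\<lambda>x. (cos (u \<bullet> x + b) - cos b) / c)"
      unfolding f_def by (subst Abs_lip10_inverse) auto
    have bd: "bounded (range (lip_fun f))"
    proof -
      have "\<bar>(cos (u \<bullet> x + b) - cos b) / c\<bar> \<le> 2 / c" for x
      proof -
        have "\<bar>cos (u \<bullet> x + b) - cos b\<bar> \<le> 2"
          using abs_cos_le_one[of "u \<bullet> x + b"] abs_cos_le_one[of b] by linarith
        then show ?thesis using c by (simp add: divide_right_mono)
      qed
      then show ?thesis unfolding f bounded_iff by auto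
    qed
    obtain A where A: "A > 0" "\<And>x b. gauss_smooth \<sigma> (\<lambda>x. cos (u \<bullet> x + b)) x = A * cos (u \<bullet> x + b)"
      using gauss_smooth_cos[OF \<sigma>, of u] by blast
    have int: "integrable lborel (\<lambda>y :: real ^ 'd. h y * gauss_density \<sigma> y)"
      if "h \<in> borel_measurable borel" "\<And>y. \<bar>h y\<bar> \<le> 1" for h :: "real ^ 'd \<Rightarrow> real"
      using integrable_gauss_density_bounded[OF \<sigma>, of h 1] that by simp
    have one: "(\<integral>y. gauss_density \<sigma> y \<partial>(lborel :: (real ^ 'd) measure)) = 1"
      using nn_integral_gauss_density[OF \<sigma>, where 'd='d] int[of "\<lambda>_. 1"]
      by (subst (asm) nn_integral_eq_integral) (auto simp: gauss_density_nonneg)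
    have gs: "gauss_smooth \<sigma> (lip_fun f) x = (A * cos (u \<bullet> x + b) - cos b) / c" for x
    proof -
      have "gauss_smooth \<sigma> (lip_fun f) x =
        (\<integral>y. (1 / c) * (cos (u \<bullet> (x - y) + b) * gauss_density \<sigma> y - cos b * gauss_density \<sigma> y) \<partial>lborel)"
        unfolding gauss_smooth_def f
        by (intro Bochner_Integration.integral_cong) (simp_all add: field_simps)
      also have "\<dots> = (1 / c) * (gauss_smooth \<sigma> (\<lambda>x. cos (u \<bullet> x + b)) x - cos b)"
        using int[of "\<lambda>y. cos (u \<bullet> (x - y) + b)"] int[of "\<lambda>_. 1"] one
        by (simp add: gauss_smooth_def)
      finally show ?thesis by (simp add: A(2))
    qed
    have ci: "integrable M (\<lambda>x. cos (u \<bullet> x + b))"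
      if "prob_space M" and [measurable_cong]: "sets M = sets borel" for M
    proof -
      interpret prob_space M by fact
      show ?thesis by (rule integrable_const_bound[where B=1]) auto
    qed
    have "(A * (\<integral>x. cos (u \<bullet> x + b) \<partial>Q1) - cos b) / c = (A * (\<integral>x. cos (u \<bullet> x + b) \<partial>Q2) - cos b) / c"
      using eq[OF bd] ci[OF Q1] ci[OF Q2] by (simp add: gs Q1.prob_space Q2.prob_space)
    then show ?thesis using A(1) c by simp
  qed
  show ?thesis
  proof (rule measure_eqI_lipschitz[OF Q1 Q2])
    fix C and h :: "real ^ 'd \<Rightarrow> real"
    assume h: "C-lipschitz_on UNIV h" "\<And>x. \<bar>h x\<bar> \<le> 1"
    have C: "0 \<le> C" by (rule lipschitz_on_nonneg[OF h(1)])
    \<comment> \<open>Both sequences are constant, so the convergence criterion collapses to an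
      equality of integrals of h.\<close>
    have "(\<lambda>n::nat. \<integral>x. h (\<chi> i. (\<lambda>i. x $ i) i) \<partial>Q1) \<longlonglongrightarrow> (\<integral>x. h (\<chi> i. (\<lambda>i. x $ i) i) \<partial>Q2)"
    proof (rule cos_convergence_imp_lipschitz_convergence[where I=UNIV and B=1 and C=C
          and F="\<lambda>v. h (\<chi> i. v i)" and V="\<lambda>n x i. x $ i" and U="\<lambda>x i. x $ i"])
      show "\<bar>h (\<chi> i. x i) - h (\<chi> i. y i)\<bar> \<le> C * (\<Sum>i\<in>UNIV. \<bar>x i - y i\<bar>)" for x y :: "'d \<Rightarrow> real"
      proof -
        have "\<bar>h (\<chi> i. x i) - h (\<chi> i. y i)\<bar> \<le> C * norm ((\<chi> i. x i) - (\<chi> i. y i))"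
          using lipschitz_onD[OF h(1), of "\<chi> i. x i" "\<chi> i. y i"] by (simp add: dist_norm)
        also have "\<dots> \<le> C * (\<Sum>i\<in>UNIV. \<bar>x i - y i\<bar>)"
          using C norm_le_l1_cart[of "(\<chi> i. x i) - (\<chi> i. y i)"] by (intro mult_left_mono) auto
        finally show ?thesis .
      qed
      have ip: "(\<Sum>i\<in>UNIV. a i * x $ i) = (\<chi> i. a i) \<bullet> x" for a and x :: "real ^ 'd"
        by (simp add: inner_vec_def)
      show "(\<lambda>n::nat. \<integral>x. cos ((\<Sum>i\<in>UNIV. a i * x $ i) + b) \<partial>Q1) \<longlonglongrightarrow> (\<integral>x. cos ((\<Sum>i\<in>UNIV. a i * x $ i) + b) \<partial>Q2)" for a b
        unfolding ip cos_eq by simp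
      fix e :: real assume e: "0 < e"
      obtain L1 where L1: "L1 > 0" "\<And>L. L \<ge> L1 \<Longrightarrow> measure Q1 {x \<in> space Q1. \<exists>i\<in>UNIV. \<bar>x $ i\<bar> > L} \<le> e"
        using tight_coordinates[OF Q1(1), of "UNIV :: 'd set" "\<lambda>x i. x $ i" e] e by auto
      obtain L2 where L2: "L2 > 0" "\<And>L. L \<ge> L2 \<Longrightarrow> measure Q2 {x \<in> space Q2. \<exists>i\<in>UNIV. \<bar>x $ i\<bar> > L} \<le> e"
        using tight_coordinates[OF Q2(1), of "UNIV :: 'd set" "\<lambda>x i. x $ i" e] e by auto
      define L where "L = max L1 L2"
      have L: "0 < L" "L1 \<le> L" "L2 \<le> L" using L1(1) by (auto simp: L_def)
      show "\<exists>L>0. (\<forall>\<^sub>F n::nat in sequentially. measure Q1 {\<omega> \<in> space Q1. \<exists>i\<in>UNIV. L < \<bar>\<omega> $ i\<bar>} \<le> e) \<and>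
          measure Q2 {\<omega> \<in> space Q2. \<exists>i\<in>UNIV. L < \<bar>\<omega> $ i\<bar>} \<le> e"
        using L(1) L1(2)[OF L(2)] L2(2)[OF L(3)] by (intro exI[of _ L]) simp
    qed (use Q1 Q2 h in auto)
    then show "(\<integral>x. h x \<partial>Q1) = (\<integral>x. h x \<partial>Q2)"
      by (simp add: LIMSEQ_const_iff)
  qed
qed

subsection \<open>Minimum distance functionals\<close>

text \<open>Finite dimension of the parameter space enters here: the norm of A t has a positive
  minimum on the compact unit sphere.\<close>

lemma linear_injective_bounded_below:
  fixes A :: "'a::euclidean_space \<Rightarrow> 'b::real_normed_vector"
  assumes "linear A" "\<And>t. t \<noteq> 0 \<Longrightarrow> A t \<noteq> 0"
  shows "\<exists>c>0. \<forall>t. c * norm t \<le> norm (A t)"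
proof -
  interpret A: bounded_linear A using assms(1) by (simp add: linear_linear)
  have "compact (sphere (0::'a) 1)" by simp
  moreover have "sphere (0::'a) 1 \<noteq> {}" by simp
  moreover have "continuous_on (sphere 0 1) (\<lambda>t. norm (A t))"
    by (intro continuous_intros A.continuous_on)
  ultimately obtain t0 where t0: "t0 \<in> sphere 0 1" "\<And>t. t \<in> sphere 0 1 \<Longrightarrow> norm (A t0) \<le> norm (A t)"
    by (meson continuous_attains_inf)
  have "t0 \<noteq> 0" using t0(1) by auto
  then have pos: "0 < norm (A t0)" using assms(2) by simp
  moreover have "norm (A t0) * norm t \<le> norm (A t)" for t
  proof (cases "t = 0")
    case False
    have "norm (A t0) \<le> norm (A (t /\<^sub>R norm t))" using False by (intro t0(2)) simp
    also have "\<dots> = norm (A t) / norm t" by (simp add: A.scaleR divide_inverse mult.commute)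
    finally show ?thesis using False by (simp add: field_simps)
  qed (simp add: A.zero)
  ultimately show ?thesis by blast
qed

text \<open>Write t for the rescaled displacement sqrt n (\<theta> - \<theta>0). If \<theta> is far
  from \<theta>0, or near it with t large, the criterion is at least |E|, a value already attained
  at \<theta>0 and at t = 0. Only bounded t remain, and there the error of linearisation is
  uniformly small. Uniformity in E is what later allows a random E.\<close>

lemma minimum_distance_expansion:
  fixes q :: "'a::euclidean_space \<Rightarrow> 'b::real_normed_vector" and A :: "'a \<Rightarrow> 'b"
  assumes A: "linear A" "\<And>t. t \<noteq> 0 \<Longrightarrow> A t \<noteq> 0"
    and \<theta>0: "\<theta>0 \<in> interior \<Theta>"
    and diff: "\<And>\<eta>. \<eta> > 0 \<Longrightarrow> \<exists>\<delta>>0. \<forall>\<theta>\<in>\<Theta>. dist \<theta> \<theta>0 < \<delta> \<longrightarrow> norm (q \<theta> - q \<theta>0 - A (\<theta> - \<theta>0)) \<le> \<eta> * norm (\<theta> - \<theta>0)"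
    and sep: "\<And>\<delta>. \<delta> > 0 \<Longrightarrow> \<exists>\<kappa>>0. \<forall>\<theta>\<in>\<Theta>. dist \<theta> \<theta>0 \<ge> \<delta> \<longrightarrow> norm (q \<theta> - q \<theta>0) \<ge> \<kappa>"
    and R: "R \<ge> 0" and e: "e > 0"
  shows "\<exists>n0. \<forall>n\<ge>n0. \<forall>E. norm E \<le> R \<longrightarrow>
    \<bar>(INF \<theta>\<in>\<Theta>. norm (E - sqrt (real n) *\<^sub>R (q \<theta> - q \<theta>0))) - (INF t. norm (E - A t))\<bar> \<le> e"
proof -
  interpret A: bounded_linear A using A(1) by (simp add: linear_linear)
  obtain c where c: "c > 0" "\<And>t. c * norm t \<le> norm (A t)"
    using linear_injective_bounded_below[OF A] by blast
  \<comment> \<open>Beyond T the linear map exceeds 4 R. Only half of its slope survives the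
    remainder, which still leaves more than 2 R, twice the bound on |E|.\<close>
  define T where "T = 4 * R / c + 1"
  have T: "T > 0" using R c by (simp add: T_def add_nonneg_pos)
  have cT: "c * T > 4 * R" using c by (simp add: T_def field_simps)
  \<comment> \<open>The first bound keeps half of the slope c after linearisation; the second makes
    the remainder at most e for |t| \<le> T.\<close>
  define \<eta> where "\<eta> = min (c / 2) (e / T)"
  have \<eta>: "\<eta> > 0" "\<eta> \<le> c / 2" "\<eta> * T \<le> e"
    using c e T by (auto simp: \<eta>_def min_def field_simps)
  obtain \<delta> where \<delta>: "\<delta> > 0"
    "\<And>\<theta>. \<theta> \<in> \<Theta> \<Longrightarrow> dist \<theta> \<theta>0 < \<delta> \<Longrightarrow> norm (q \<theta> - q \<theta>0 - A (\<theta> - \<theta>0)) \<le> \<eta> * norm (\<theta> - \<theta>0)"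
    using diff[OF \<eta>(1)] by blast
  obtain \<kappa> where \<kappa>: "\<kappa> > 0" "\<And>\<theta>. \<theta> \<in> \<Theta> \<Longrightarrow> dist \<theta> \<theta>0 \<ge> \<delta> \<Longrightarrow> norm (q \<theta> - q \<theta>0) \<ge> \<kappa>"
    using sep[OF \<delta>(1)] by blast
  obtain \<rho> where \<rho>: "\<rho> > 0" "ball \<theta>0 \<rho> \<subseteq> \<Theta>"
    using \<theta>0 by (auto simp: mem_interior)
  have \<theta>0': "\<theta>0 \<in> \<Theta>" using \<theta>0 interior_subset by blast
  \<comment> \<open>Once sqrt n exceeds m, parameters outside the \<delta>-ball have a rescaled
    difference of at least 2 R, and every t with |t| \<le> T comes from a point of \<Theta> inside
    that ball.\<close>
  define m where "m = max (2 * R / \<kappa>) (T / min \<delta> \<rho>) + 1"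
  obtain n0 where n0: "real n0 > m\<^sup>2" using reals_Archimedean2 by blast
  have m0: "0 < m" using R \<kappa> by (simp add: m_def add_nonneg_pos le_max_iff_disj)
  show ?thesis
  proof (intro exI[of _ n0] allI impI)
    fix n and E :: 'b assume n: "n \<ge> n0" and E: "norm E \<le> R"
    define s where "s = sqrt (real n)"
    have "m\<^sup>2 < real n" using n0 n by simp
    then have ms: "m < s" unfolding s_def by (rule real_less_rsqrt)
    then have s: "s > 0" using m0 by linarith
    have s\<kappa>: "s * \<kappa> \<ge> 2 * R"
    proof -
      have "2 * R / \<kappa> \<le> s" using ms by (simp add: m_def)
      then show ?thesis using \<kappa> by (simp add: field_simps)
    qed
    have sT: "T / s < \<delta>" "T / s < \<rho>"
    proof -
      define \<mu> where "\<mu> = min \<delta> \<rho>"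
      have "\<mu> > 0" using \<delta>(1) \<rho>(1) by (simp add: \<mu>_def)
      moreover have "T / \<mu> < s" using ms by (simp add: m_def \<mu>_def)
      ultimately have "T / s < \<mu>" using s by (simp add: field_simps)
      then show "T / s < \<delta>" "T / s < \<rho>" by (simp_all add: \<mu>_def)
    qed
    define F where "F \<theta> = norm (E - s *\<^sub>R (q \<theta> - q \<theta>0))" for \<theta>
    define L where "L t = norm (E - A t)" for t
    have bddF: "bdd_below (F ` \<Theta>)" and bddL: "bdd_below (range L)"
      by (auto simp: F_def L_def intro!: bdd_belowI[of _ 0])
    have F_le: "(INF \<theta>\<in>\<Theta>. F \<theta>) \<le> F \<theta>" if "\<theta> \<in> \<Theta>" for \<theta>
      using bddF that by (rule cINF_lower)
    have L_le: "(INF t. L t) \<le> L t" for t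
      using bddL by (rule cINF_lower) simp
    have F0: "(INF \<theta>\<in>\<Theta>. F \<theta>) \<le> norm E" using F_le[OF \<theta>0'] by (simp add: F_def)
    have L0: "(INF t. L t) \<le> norm E" using L_le[of 0] by (simp add: L_def A.zero)
    have tri: "norm y - norm x \<le> norm (x - y)" for x y :: 'b
      by (metis norm_minus_commute norm_triangle_ineq2)
    have "(INF \<theta>\<in>\<Theta>. F \<theta>) - e \<le> (INF t. L t)"
    proof (rule cINF_greatest)
      fix t
      show "(INF \<theta>\<in>\<Theta>. F \<theta>) - e \<le> L t"
      proof (cases "norm t \<le> T")
        case True
        define \<theta> where "\<theta> = \<theta>0 + t /\<^sub>R s"
        have d: "dist \<theta> \<theta>0 \<le> T / s"
          using True s by (simp add: \<theta>_def dist_norm divide_inverse mult.commute mult_right_mono)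
        have "\<theta> \<in> \<Theta>" using \<rho>(2) d sT(2) by (auto simp: dist_commute)
        have "A t = s *\<^sub>R A (\<theta> - \<theta>0)" using s by (simp add: \<theta>_def A.scaleR)
        then have "E - s *\<^sub>R (q \<theta> - q \<theta>0) = (E - A t) - s *\<^sub>R (q \<theta> - q \<theta>0 - A (\<theta> - \<theta>0))"
          by (simp add: scaleR_diff_right)
        then have "F \<theta> \<le> L t + norm (s *\<^sub>R (q \<theta> - q \<theta>0 - A (\<theta> - \<theta>0)))"
          unfolding F_def L_def by (metis norm_triangle_ineq4)
        also have "norm (s *\<^sub>R (q \<theta> - q \<theta>0 - A (\<theta> - \<theta>0))) \<le> s * (\<eta> * norm (\<theta> - \<theta>0))"
          using \<delta>(2)[OF \<open>\<theta> \<in> \<Theta>\<close>] d sT(1) s by (simp add: mult_left_mono)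
        also have "\<dots> = \<eta> * norm t" using s by (simp add: \<theta>_def)
        also have "\<dots> \<le> \<eta> * T" using True \<eta> by (intro mult_left_mono) auto
        also have "\<dots> \<le> e" by (rule \<eta>)
        finally show ?thesis using F_le[OF \<open>\<theta> \<in> \<Theta>\<close>] by linarith
      next
        case False
        have "4 * R < c * norm t" using cT False c by (smt (verit) mult_left_mono)
        also have "\<dots> \<le> norm (A t)" by (rule c)
        finally have "norm E \<le> L t"
          using tri[where x=E and y="A t"] E R unfolding L_def by linarith
        then show ?thesis using F0 e by linarith
      qed
    qed simp
    moreover have "(INF t. L t) - e \<le> (INF \<theta>\<in>\<Theta>. F \<theta>)"
    proof (rule cINF_greatest)
      show "\<Theta> \<noteq> {}" using \<theta>0' by auto
      fix \<theta> assume \<theta>: "\<theta> \<in> \<Theta>"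
      show "(INF t. L t) - e \<le> F \<theta>"
      proof (cases "dist \<theta> \<theta>0 < \<delta>")
        case True
        define r where "r = q \<theta> - q \<theta>0 - A (\<theta> - \<theta>0)"
        have r: "norm r \<le> \<eta> * norm (\<theta> - \<theta>0)" unfolding r_def by (rule \<delta>(2)[OF \<theta> True])
        define t where "t = s *\<^sub>R (\<theta> - \<theta>0)"
        have nt: "norm t = s * norm (\<theta> - \<theta>0)" using s by (simp add: t_def)
        have sr: "norm (s *\<^sub>R r) \<le> \<eta> * norm t"
          using r s by (simp add: nt mult.left_commute[of \<eta>] mult_left_mono)
        have q: "s *\<^sub>R (q \<theta> - q \<theta>0) = A t + s *\<^sub>R r"
          unfolding t_def r_def A.scaleR by (simp add: scaleR_diff_right)
        show ?thesis
        proof (cases "norm t \<le> T")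
          case True
          have "L t \<le> F \<theta> + norm (s *\<^sub>R r)"
            unfolding L_def F_def q by (metis diff_add_eq_diff_diff_swap diff_add_cancel norm_triangle_ineq add.commute)
          also have "norm (s *\<^sub>R r) \<le> \<eta> * T"
            using sr mult_left_mono[OF True, of \<eta>] \<eta>(1) by linarith
          finally show ?thesis using L_le[of t] \<eta>(3) by linarith
        next
          case False
          have "c / 2 * norm t \<le> norm (A t) - norm (s *\<^sub>R r)"
          proof -
            have "\<eta> * norm t \<le> c / 2 * norm t" using \<eta>(2) by (rule mult_right_mono) simp
            then show ?thesis using sr c(2)[of t] by (simp add: field_simps)
          qed
          also have "\<dots> \<le> norm (s *\<^sub>R (q \<theta> - q \<theta>0))"
            unfolding q using norm_diff_ineq[of "A t" "s *\<^sub>R r"] by simp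
          finally have "c / 2 * norm t \<le> norm (s *\<^sub>R (q \<theta> - q \<theta>0))" .
          moreover have "2 * R < c / 2 * norm t" using cT False c by (smt (verit) mult_left_mono field_sum_of_halves mult.commute times_divide_eq_left)
          ultimately have "norm E \<le> F \<theta>"
            unfolding F_def using tri[where x=E and y="s *\<^sub>R (q \<theta> - q \<theta>0)"] E by linarith
          then show ?thesis using L0 e by linarith
        qed
      next
        case False
        then have "\<kappa> \<le> norm (q \<theta> - q \<theta>0)" using \<kappa>(2)[OF \<theta>] by simp
        then have "s * \<kappa> \<le> norm (s *\<^sub>R (q \<theta> - q \<theta>0))" using s by (simp add: mult_left_mono)
        then have "norm E \<le> F \<theta>"
          unfolding F_def using tri[where x=E and y="s *\<^sub>R (q \<theta> - q \<theta>0)"] E s\<kappa> by linarith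
        then show ?thesis using L0 e by linarith
      qed
    qed
    ultimately show "\<bar>(INF \<theta>\<in>\<Theta>. norm (E - sqrt (real n) *\<^sub>R (q \<theta> - q \<theta>0))) - (INF t. norm (E - A t))\<bar> \<le> e"
      unfolding F_def L_def s_def by linarith
  qed
qed

text \<open>Continuity in norm of the smoothed model is not assumed, so a minimum over the compact
  set cannot simply be taken. Instead a sequence violating separation accumulates at some \<theta>1
  other than \<theta>0; weak continuity carries the bounded smoothed test functions to the limit,
  and injectivity of smoothing contradicts identifiability.\<close>

lemma smoothed_functional_separation:
  fixes Q :: "'p::metric_space \<Rightarrow> (real ^ 'd::finite) measure"
  assumes \<sigma>: "\<sigma> > 0" and \<Theta>: "compact \<Theta>" "\<theta>0 \<in> \<Theta>"
    and Q: "\<And>\<theta>. \<theta> \<in> \<Theta> \<Longrightarrow> prob_space (Q \<theta>) \<and> sets (Q \<theta>) = sets borel \<and> integrable (Q \<theta>) norm"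
    and weak: "\<And>h :: real ^ 'd \<Rightarrow> real. continuous_on UNIV h \<Longrightarrow> bounded (range h) \<Longrightarrow>
         continuous_on \<Theta> (\<lambda>\<theta>. \<integral>x. h x \<partial>(Q \<theta>))"
    and ident: "\<And>\<theta>. \<theta> \<in> \<Theta> \<Longrightarrow> \<theta> \<noteq> \<theta>0 \<Longrightarrow> Q \<theta>0 \<noteq> Q \<theta>"
    and \<delta>: "\<delta> > 0"
  shows "\<exists>\<kappa>>0. \<forall>\<theta>\<in>\<Theta>. dist \<theta> \<theta>0 \<ge> \<delta> \<longrightarrow> norm (smoothed_functional \<sigma> (Q \<theta>) - smoothed_functional \<sigma> (Q \<theta>0)) \<ge> \<kappa>"
proof (rule ccontr)
  define z where "z \<theta> = smoothed_functional \<sigma> (Q \<theta>) - smoothed_functional \<sigma> (Q \<theta>0)" for \<theta>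
  assume "\<not> ?thesis"
  then have "\<exists>\<theta>\<in>\<Theta>. dist \<theta> \<theta>0 \<ge> \<delta> \<and> norm (z \<theta>) < \<kappa>" if "\<kappa> > 0" for \<kappa>
    using that by (auto simp: z_def not_le)
  then have "\<exists>\<theta>\<in>\<Theta>. dist \<theta> \<theta>0 \<ge> \<delta> \<and> norm (z \<theta>) < inverse (real (Suc k))" for k
    by simp
  then obtain t where t: "\<And>k. t k \<in> \<Theta>" "\<And>k. dist (t k) \<theta>0 \<ge> \<delta>" "\<And>k. norm (z (t k)) < inverse (real (Suc k))"
    by metis
  obtain \<theta>1 r where r: "\<theta>1 \<in> \<Theta>" "strict_mono r" "(t \<circ> r) \<longlonglongrightarrow> \<theta>1"
    using \<Theta>(1) t(1) unfolding compact_def by blast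
  have "(\<lambda>k. dist ((t \<circ> r) k) \<theta>0) \<longlonglongrightarrow> dist \<theta>1 \<theta>0"
    by (intro tendsto_intros r)
  then have "\<delta> \<le> dist \<theta>1 \<theta>0"
    by (rule LIMSEQ_le_const) (auto simp: t)
  then have ne: "\<theta>1 \<noteq> \<theta>0" using \<delta> by auto
  have "(\<lambda>k. norm (z (t k))) \<longlonglongrightarrow> 0"
    by (rule tendsto_sandwich[OF _ _ tendsto_const LIMSEQ_inverse_real_of_nat];
        intro always_eventually allI norm_ge_zero less_imp_le[OF t(3)])
  then have z0: "(\<lambda>k. norm (z ((t \<circ> r) k))) \<longlonglongrightarrow> 0"
    using LIMSEQ_subseq_LIMSEQ[OF _ r(2)] by (simp add: o_def)
  have "Q \<theta>0 = Q \<theta>1"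
  proof (rule gauss_smooth_injective[OF \<sigma>])
    fix f :: "'d lip10" assume "bounded (range (lip_fun f))"
    then obtain B where B: "\<And>x. \<bar>lip_fun f x\<bar> \<le> B" by (auto simp: bounded_iff)
    define h where "h = gauss_smooth \<sigma> (lip_fun f)"
    have cont: "continuous_on UNIV h"
      unfolding h_def by (rule lipschitz_on_continuous_on[OF gauss_smooth_lipschitz[OF \<sigma> lip_fun_lipschitz]])
    have "\<bar>h x\<bar> \<le> B" for x
    proof -
      interpret G: prob_space "gauss_measure \<sigma> :: (real ^ 'd) measure"
        by (rule prob_space_gauss_measure[OF \<sigma>])
      have "\<bar>\<integral>y. lip_fun f (x + y) \<partial>gauss_measure \<sigma>\<bar> \<le> (\<integral>y. B \<partial>(gauss_measure \<sigma> :: (real ^ 'd) measure))"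
        by (rule abs_integral_le[OF integrable_gauss_lipschitz[OF \<sigma> lip_fun_lipschitz]]) (auto simp: B)
      then show ?thesis using G.prob_space by (simp add: h_def gauss_smooth_eq_plus[OF \<sigma>])
    qed
    then have bdd: "bounded (range h)" by (auto simp: bounded_iff)
    define J where "J \<theta> = (\<integral>x. h x \<partial>Q \<theta>)" for \<theta>
    have Jz: "J \<theta> - J \<theta>0 = z \<theta> f" if "\<theta> \<in> \<Theta>" for \<theta>
      using Q[OF that] Q[OF \<Theta>(2)]
      by (simp add: J_def z_def h_def smoothed_functional_apply[OF \<sigma>])
    have "(\<lambda>k. J ((t \<circ> r) k)) \<longlonglongrightarrow> J \<theta>1"
      unfolding J_def
      by (rule continuous_on_tendsto_compose[OF weak[OF cont bdd] r(3,1)]) (simp add: t(1))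
    moreover have "(\<lambda>k. J ((t \<circ> r) k) - J \<theta>0) \<longlonglongrightarrow> 0"
    proof (rule Lim_null_comparison[OF always_eventually z0], rule allI)
      fix k
      have "(t \<circ> r) k \<in> \<Theta>" using t(1) by simp
      from Jz[OF this] show "norm (J ((t \<circ> r) k) - J \<theta>0) \<le> norm (z ((t \<circ> r) k))"
        using norm_bounded[of "z ((t \<circ> r) k)" f] by simp
    qed
    then have "(\<lambda>k. J ((t \<circ> r) k)) \<longlonglongrightarrow> J \<theta>0" by (simp add: LIM_zero_iff)
    ultimately show "(\<integral>x. gauss_smooth \<sigma> (lip_fun f) x \<partial>Q \<theta>0) = (\<integral>x. gauss_smooth \<sigma> (lip_fun f) x \<partial>Q \<theta>1)"
      using LIMSEQ_unique unfolding J_def h_def by blast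
  qed (use Q[OF \<Theta>(2)] Q[OF r(1)] in auto)
  then show False using ident[OF r(1) ne] by simp
qed

subsection \<open>The scalar central limit theorem\<close>

lemma normal_law_moments:
  assumes Z: "Z \<in> borel_measurable N" and law: "distr N borel Z = normal_law m s" and s: "s \<ge> 0"
  shows "integrable N Z" "integrable N (\<lambda>\<omega>. (Z \<omega>)\<^sup>2)" "(\<integral>\<omega>. Z \<omega> \<partial>N) = m" "(\<integral>\<omega>. (Z \<omega> - m)\<^sup>2 \<partial>N) = s\<^sup>2"
proof -
  let ?S = std_normal_distribution
  interpret S: prob_space ?S by (rule prob_space_normal_density) simp
  have D: "distr N borel Z = distr ?S borel (\<lambda>x. m + s * x)"
    using law normal_law_eq_distr[OF s] by simp
  have int: "integrable N (\<lambda>\<omega>. g (Z \<omega>)) \<longleftrightarrow> integrable ?S (\<lambda>x. g (m + s * x))"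
    and eq: "(\<integral>\<omega>. g (Z \<omega>) \<partial>N) = (\<integral>x. g (m + s * x) \<partial>?S)"
    if g: "g \<in> borel_measurable borel" for g :: "real \<Rightarrow> real"
  proof -
    have "integrable (distr N borel Z) g \<longleftrightarrow> integrable N (\<lambda>\<omega>. g (Z \<omega>))"
      by (rule integrable_distr_eq[OF Z g])
    moreover have "integrable (distr ?S borel (\<lambda>x. m + s * x)) g \<longleftrightarrow> integrable ?S (\<lambda>x. g (m + s * x))"
      by (rule integrable_distr_eq[OF _ g]) simp
    ultimately show "integrable N (\<lambda>\<omega>. g (Z \<omega>)) \<longleftrightarrow> integrable ?S (\<lambda>x. g (m + s * x))" using D by simp
    have "(\<integral>x. g x \<partial>distr N borel Z) = (\<integral>\<omega>. g (Z \<omega>) \<partial>N)" by (rule integral_distr[OF Z g])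
    moreover have "(\<integral>x. g x \<partial>distr ?S borel (\<lambda>x. m + s * x)) = (\<integral>x. g (m + s * x) \<partial>?S)"
      by (rule integral_distr[OF _ g]) simp
    ultimately show "(\<integral>\<omega>. g (Z \<omega>) \<partial>N) = (\<integral>x. g (m + s * x) \<partial>?S)" using D by simp
  qed
  have i1: "integrable ?S (\<lambda>x. x)" using integrable_std_normal_distribution_moment[of 1] by simp
  have i2: "integrable ?S (\<lambda>x. x\<^sup>2)" using integrable_std_normal_distribution_moment[of 2] .
  have e1: "(\<integral>x. x \<partial>?S) = 0" using integral_std_normal_distribution_moment_odd[of 1] by simp
  have e2: "(\<integral>x. x\<^sup>2 \<partial>?S) = 1" using std_normal_distribution_even_moments(1)[of 1] by simp
  have one: "measure ?S UNIV = 1" using S.prob_space by simp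
  have "integrable ?S (\<lambda>x. m + s * x)" using i1 by simp
  then show "integrable N Z" by (rule iffD2[OF int[of "\<lambda>x. x"], rotated]) simp
  have "integrable ?S (\<lambda>x. m\<^sup>2 + 2 * m * s * x + s\<^sup>2 * x\<^sup>2)" using i1 i2 by simp
  moreover have "(m + s * x)\<^sup>2 = m\<^sup>2 + 2 * m * s * x + s\<^sup>2 * x\<^sup>2" for x
    by (simp add: power2_sum power_mult_distrib)
  ultimately have "integrable ?S (\<lambda>x. (m + s * x)\<^sup>2)" by presburger
  then show "integrable N (\<lambda>\<omega>. (Z \<omega>)\<^sup>2)"
    by (subst int[of "\<lambda>x. x\<^sup>2"]) auto
  have "(\<integral>\<omega>. Z \<omega> \<partial>N) = (\<integral>x. m + s * x \<partial>?S)" by (rule eq[of "\<lambda>x. x"]) simp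
  also have "\<dots> = m" using i1 e1 one by simp
  finally show "(\<integral>\<omega>. Z \<omega> \<partial>N) = m" .
  have "(\<integral>\<omega>. (Z \<omega> - m)\<^sup>2 \<partial>N) = (\<integral>x. (m + s * x - m)\<^sup>2 \<partial>?S)" by (rule eq[of "\<lambda>x. (x - m)\<^sup>2"]) simp
  also have "\<dots> = s\<^sup>2" using i2 e2 by (simp add: power_mult_distrib)
  finally show "(\<integral>\<omega>. (Z \<omega> - m)\<^sup>2 \<partial>N) = s\<^sup>2" .
qed

text \<open>Put in the form that the cosine criterion consumes: an integral of a cosine with
  arbitrary phase, and a variance that may be 0.\<close>

lemma scalar_clt_cos:
  fixes u :: "'b::topological_space \<Rightarrow> real"
  assumes "prob_space \<Omega>" and indep: "prob_space.indep_vars \<Omega> (\<lambda>_. borel) X UNIV"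
    and law: "\<And>i::nat. distr \<Omega> borel (X i) = P"
    and u[measurable]: "u \<in> borel_measurable borel" and u2: "integrable P (\<lambda>x. (u x)\<^sup>2)"
    and \<mu>: "\<mu> = (\<integral>x. u x \<partial>P)" and s: "s \<ge> 0" "s\<^sup>2 = (\<integral>x. (u x - \<mu>)\<^sup>2 \<partial>P)"
  shows "(\<lambda>n. \<integral>\<omega>. cos ((\<Sum>k<n. u (X k \<omega>) - \<mu>) / sqrt (real n) + b) \<partial>\<Omega>)
    \<longlonglongrightarrow> (\<integral>x. cos (s * x + b) \<partial>std_normal_distribution)"
proof -
  interpret prob_space \<Omega> by fact
  have X[measurable]: "X i \<in> borel_measurable \<Omega>" for i
    using indep by (auto simp: indep_vars_def2)
  interpret P: prob_space P unfolding law[of 0, symmetric] by (rule prob_space_distr) simp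
  have [measurable_cong]: "sets P = sets borel" unfolding law[of 0, symmetric] by simp
  have spP: "space P = UNIV" unfolding law[of 0, symmetric] by simp
  have u1: "integrable P u" by (rule P.square_integrable_imp_integrable[OF _ u2]) simp
  have c2: "integrable P (\<lambda>x. (u x - \<mu>)\<^sup>2)"
    using u1 u2 by (simp add: power2_diff)
  have tr_i: "integrable \<Omega> (\<lambda>\<omega>. g (X i \<omega>)) \<longleftrightarrow> integrable P g" if "g \<in> borel_measurable borel" for g :: "'b \<Rightarrow> real" and i
    unfolding law[of i, symmetric] by (rule integrable_distr_eq[symmetric]) (use that in auto)
  have tr: "(\<integral>\<omega>. g (X i \<omega>) \<partial>\<Omega>) = (\<integral>x. g x \<partial>P)" if "g \<in> borel_measurable borel" for g :: "'b \<Rightarrow> real" and i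
    unfolding law[of i, symmetric] by (rule integral_distr[symmetric]) (use that in auto)
  define Y where "Y k \<omega> = u (X k \<omega>)" for k \<omega>
  have [measurable]: "Y k \<in> borel_measurable \<Omega>" for k unfolding Y_def by measurable
  show ?thesis
  proof (cases "s = 0")
    case True
    \<comment> \<open>Normalisation by s is impossible here, but then u equals its mean almost
      surely and all sums vanish.\<close>
    have "AE x in P. (u x - \<mu>)\<^sup>2 = 0"
      using s(2) True integral_nonneg_eq_0_iff_AE[OF c2] by simp
    then have ae: "AE x in P. u x = \<mu>" by simp
    have "AE \<omega> in \<Omega>. u (X k \<omega>) = \<mu>" for k
      using ae unfolding law[of k, symmetric] by (rule AE_distrD[rotated]) simp
    then have "AE \<omega> in \<Omega>. \<forall>k. u (X k \<omega>) = \<mu>" by (simp add: AE_all_countable)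
    then have "AE \<omega> in \<Omega>. cos ((\<Sum>k<n. u (X k \<omega>) - \<mu>) / sqrt (real n) + b) = cos b" for n
      by eventually_elim simp
    then have "(\<integral>\<omega>. cos ((\<Sum>k<n. u (X k \<omega>) - \<mu>) / sqrt (real n) + b) \<partial>\<Omega>) = (\<integral>\<omega>. cos b \<partial>\<Omega>)" for n
      by (intro integral_cong_AE) auto
    moreover have "measure std_normal_distribution UNIV = 1"
      using prob_space.prob_space[OF prob_space_normal_density[of 1 0]] by simp
    ultimately show ?thesis using True by (simp add: prob_space)
  next
    case False
    then have spos: "s > 0" using s(1) by simp
    have "weak_conv_m (\<lambda>n. distr \<Omega> borel (\<lambda>\<omega>. (\<Sum>k<n. Y k \<omega> - \<mu>) / sqrt (n * s\<^sup>2))) std_normal_distribution"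
    proof (rule central_limit_theorem)
      show "indep_vars (\<lambda>i. borel) Y UNIV"
        unfolding Y_def[abs_def] using indep_vars_compose2[OF indep, of "\<lambda>_. u"] by simp
      show "expectation (Y n) = \<mu>" for n
        unfolding Y_def[abs_def] by (simp add: tr \<mu>)
      show "0 < s" by fact
      show "integrable \<Omega> (\<lambda>\<omega>. (Y n \<omega>)\<^sup>2)" for n
        unfolding Y_def using u2 by (subst tr_i[of "\<lambda>x. (u x)\<^sup>2"]) auto
      have EY: "expectation (Y n) = \<mu>" for n
        unfolding Y_def[abs_def] by (simp add: tr \<mu>)
      show "variance (Y n) = s\<^sup>2" for n
        unfolding EY unfolding Y_def s(2) by (rule tr[of "\<lambda>x. (u x - \<mu>)\<^sup>2"]) simp
      show "distr \<Omega> borel (Y n) = distr P borel u" for n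
        unfolding Y_def[abs_def] law[of n, symmetric] by (subst distr_distr) (auto simp: o_def)
    qed
    then have "(\<lambda>n. \<integral>x. cos (s * x + b) \<partial>distr \<Omega> borel (\<lambda>\<omega>. (\<Sum>k<n. Y k \<omega> - \<mu>) / sqrt (n * s\<^sup>2)))
      \<longlonglongrightarrow> (\<integral>x. cos (s * x + b) \<partial>std_normal_distribution)"
      by (intro weak_conv_imp_integral_bdd_continuous_conv[where B=1] real_distribution_distr
          real_dist_normal_dist) (auto intro!: continuous_intros)
    moreover have "(\<integral>x. cos (s * x + b) \<partial>distr \<Omega> borel (\<lambda>\<omega>. (\<Sum>k<n. Y k \<omega> - \<mu>) / sqrt (n * s\<^sup>2)))
      = (\<integral>\<omega>. cos ((\<Sum>k<n. u (X k \<omega>) - \<mu>) / sqrt (real n) + b) \<partial>\<Omega>)" for n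
      using spos by (subst integral_distr) (auto simp: Y_def real_sqrt_mult)
    ultimately show ?thesis by simp
  qed
qed

text \<open>Rounding every value a f / \<delta> down to an integer classifies the points f.
  Boundedness leaves finitely many classes, and \<open>\<pi>\<close> selects one representative of
  each.\<close>

lemma finite_range_approx:
  fixes A :: "('x \<Rightarrow> real) set"
  assumes A: "finite A" and bdd: "\<And>a. a \<in> A \<Longrightarrow> bounded (range a)" and \<delta>: "\<delta> > 0"
  shows "\<exists>\<pi> :: 'x \<Rightarrow> 'x. finite (range \<pi>) \<and> (\<forall>a\<in>A. \<forall>f. \<bar>a f - a (\<pi> f)\<bar> \<le> \<delta>)"
proof -
  define \<kappa> where "\<kappa> f = (\<lambda>a\<in>A. \<lfloor>a f / \<delta>\<rfloor>)" for f
  have fin: "finite ((\<lambda>f. \<lfloor>a f / \<delta>\<rfloor>) ` UNIV)" if a: "a \<in> A" for a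
  proof -
    obtain B where B: "\<And>f. \<bar>a f\<bar> \<le> B" using bdd[OF a] by (auto simp: bounded_iff)
    have "\<lfloor>a f / \<delta>\<rfloor> \<in> {\<lfloor>- B / \<delta>\<rfloor>..\<lfloor>B / \<delta>\<rfloor>}" for f
    proof -
      have "- B \<le> a f" "a f \<le> B" using B[of f] by (auto simp: abs_le_iff)
      then have "- B / \<delta> \<le> a f / \<delta>" "a f / \<delta> \<le> B / \<delta>"
        using \<delta> by (auto intro: divide_right_mono simp only: less_imp_le)
      then show ?thesis unfolding atLeastAtMost_iff by (intro conjI floor_mono)
    qed
    then have "range (\<lambda>f. \<lfloor>a f / \<delta>\<rfloor>) \<subseteq> {\<lfloor>- B / \<delta>\<rfloor>..\<lfloor>B / \<delta>\<rfloor>}" by blast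
    then show ?thesis by (rule finite_subset) (rule finite_atLeastAtMost_int)
  qed
  have "range \<kappa> \<subseteq> (\<Pi>\<^sub>E a\<in>A. (\<lambda>f. \<lfloor>a f / \<delta>\<rfloor>) ` UNIV)"
    unfolding \<kappa>_def by auto
  moreover have "finite (\<Pi>\<^sub>E a\<in>A. (\<lambda>f. \<lfloor>a f / \<delta>\<rfloor>) ` UNIV)"
    using A fin by (intro finite_PiE) auto
  ultimately have "finite (range \<kappa>)" by (rule finite_subset)
  define \<pi> where "\<pi> f = (SOME g. \<kappa> g = \<kappa> f)" for f
  have \<kappa>\<pi>: "\<kappa> (\<pi> f) = \<kappa> f" for f
    unfolding \<pi>_def by (rule someI[of _ f]) simp
  have "range \<pi> = (\<lambda>k. SOME g. \<kappa> g = k) ` range \<kappa>"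
    unfolding \<pi>_def by auto
  then have "finite (range \<pi>)" using \<open>finite (range \<kappa>)\<close> by simp
  moreover have "\<bar>a f - a (\<pi> f)\<bar> \<le> \<delta>" if "a \<in> A" for a f
  proof -
    have "\<lfloor>a (\<pi> f) / \<delta>\<rfloor> = \<lfloor>a f / \<delta>\<rfloor>"
      using fun_cong[OF \<kappa>\<pi>[of f], of a] that by (simp add: \<kappa>_def)
    then have "\<bar>a f / \<delta> - a (\<pi> f) / \<delta>\<bar> \<le> 1" by linarith
    then have "\<bar>a f - a (\<pi> f)\<bar> / \<delta> \<le> 1" using \<delta> by (simp add: diff_divide_distrib[symmetric] abs_divide)
    then show ?thesis using \<delta> by simp
  qed
  ultimately show ?thesis by blast
qed

text \<open>Dominated convergence with R = n + 1 and \<delta> = 1 / (n + 1). Inside the ball the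
  weight is a constant without a factor |z|, which is why the dominating weight is 1 + |z|.\<close>

lemma small_weight:
  fixes k :: "real ^ 'd \<Rightarrow> real"
  assumes k[measurable]: "k \<in> borel_measurable borel" and k0: "\<And>z. 0 \<le> k z"
    and fin: "(\<integral>\<^sup>+z. ennreal ((1 + norm z) * k z) \<partial>lborel) < \<infinity>" and e: "e > 0"
  shows "\<exists>R>0. \<exists>\<delta>>0. (\<integral>\<^sup>+z. ennreal ((if norm z \<le> R then \<delta> else 2 * norm z) * k z) \<partial>lborel) < ennreal e"
proof -
  define w where "w n z = (if norm z \<le> real (Suc n) then 1 / real (Suc n) else 2 * norm z)" for n and z :: "real ^ 'd"
  have [measurable]: "w n \<in> borel_measurable borel" for n unfolding w_def by measurable
  have "(\<lambda>n. \<integral>\<^sup>+z. ennreal (w n z * k z) \<partial>lborel) \<longlonglongrightarrow> (\<integral>\<^sup>+z. 0 \<partial>(lborel :: (real ^ 'd) measure))"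
  proof (rule nn_integral_dominated_convergence[where w="\<lambda>z. ennreal 2 * ennreal ((1 + norm z) * k z)"])
    show "AE z in lborel. ennreal (w j z * k z) \<le> ennreal 2 * ennreal ((1 + norm z) * k z)" for j
    proof (rule AE_I2)
      fix z :: "real ^ 'd"
      have "w j z \<le> 2 * (1 + norm z)"
      proof (cases "norm z \<le> real (Suc j)")
        case True
        then have "w j z \<le> 1" by (simp add: w_def)
        moreover have "1 \<le> 2 * (1 + norm z)" by (simp add: add_increasing2)
        ultimately show ?thesis by (rule order_trans)
      qed (simp add: w_def)
      then have "w j z * k z \<le> 2 * (1 + norm z) * k z" using k0 by (rule mult_right_mono)
      then have "ennreal (w j z * k z) \<le> ennreal (2 * ((1 + norm z) * k z))"
        by (simp only: mult.assoc ennreal_leI)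
      also have "\<dots> = ennreal 2 * ennreal ((1 + norm z) * k z)"
        using k0[of z] by (intro ennreal_mult) auto
      finally show "ennreal (w j z * k z) \<le> ennreal 2 * ennreal ((1 + norm z) * k z)" .
    qed
    show "(\<integral>\<^sup>+z. ennreal 2 * ennreal ((1 + norm z) * k z) \<partial>lborel) < \<infinity>"
      using fin by (subst nn_integral_cmult) (auto simp: ennreal_mult_less_top)
    show "AE z in lborel. (\<lambda>n. ennreal (w n z * k z)) \<longlonglongrightarrow> 0"
    proof (rule AE_I2)
      fix z :: "real ^ 'd"
      have "\<forall>\<^sub>F n in sequentially. w n z * k z = (1 / real (Suc n)) * k z"
      proof -
        obtain n0 where "norm z \<le> real n0" using real_arch_simple by blast
        then have "w n z = 1 / real (Suc n)" if "n \<ge> n0" for n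
          using that unfolding w_def by auto
        then show ?thesis unfolding eventually_sequentially by (intro exI[of _ n0] allI impI) simp
      qed
      moreover have "(\<lambda>n. (1 / real (Suc n)) * k z) \<longlonglongrightarrow> 0 * k z"
        using LIMSEQ_inverse_real_of_nat by (intro tendsto_intros) (simp add: inverse_eq_divide)
      ultimately have "(\<lambda>n. w n z * k z) \<longlonglongrightarrow> 0"
        by (simp add: tendsto_cong)
      then show "(\<lambda>n. ennreal (w n z * k z)) \<longlonglongrightarrow> 0"
        using tendsto_ennrealI[of "\<lambda>n. w n z * k z" 0] by simp
    qed
  qed measurable
  then have "\<forall>\<^sub>F n in sequentially. (\<integral>\<^sup>+z. ennreal (w n z * k z) \<partial>lborel) < ennreal e"
    using e by (intro order_tendstoD(2)[of _ 0]) (simp_all add: ennreal_less_zero_iff)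
  then obtain n where "(\<integral>\<^sup>+z. ennreal (w n z * k z) \<partial>lborel) < ennreal e"
    using eventually_happens'[OF sequentially_bot] by blast
  then show ?thesis unfolding w_def by (intro exI[of _ "real (Suc n)"] conjI exI[of _ "1 / real (Suc n)"]) auto
qed

lemma integral_quadratic_form:
  fixes g :: "nat \<Rightarrow> nat \<Rightarrow> 'a \<Rightarrow> real"
  assumes "\<And>i j. integrable M (g i j)"
  shows "(\<integral>x. (\<Sum>i<r. \<Sum>j<r. a i * a j * g i j x) \<partial>M) = (\<Sum>i<r. \<Sum>j<r. a i * a j * (\<integral>x. g i j x \<partial>M))"
  using assms by simp

text \<open>The definition of a Gaussian process sums over a set of indices, so an enumeration must
  be injective for its coefficients to be transported. Centredness and bilinearity of the covariance
  then identify the variance of the combination with that of u under P, the one in the scalar limit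
  theorem.\<close>

lemma limit_process_cos:
  fixes P :: "(real ^ 'd::finite) measure" and G :: "'v \<Rightarrow> 'd linf_lip10" and e :: "nat \<Rightarrow> 'd lip10"
  assumes \<sigma>: "\<sigma> > 0" and P: "prob_space P" "sets P = sets borel" and P2: "integrable P (\<lambda>x. (norm x)\<^sup>2)"
    and G: "is_limit_process \<sigma> P N G" and inj: "inj_on e {..<r}"
    and u: "u = (\<lambda>x. \<Sum>i<r. a i * gauss_smooth \<sigma> (lip_fun (e i)) x)"
  shows "\<exists>s\<ge>0. s\<^sup>2 = (\<integral>x. (u x - (\<integral>y. u y \<partial>P))\<^sup>2 \<partial>P) \<and>
    (\<integral>\<omega>. cos ((\<Sum>i<r. a i * G \<omega> (e i)) + b) \<partial>N) = (\<integral>x. cos (s * x + b) \<partial>std_normal_distribution)"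
    and "integrable P (\<lambda>x. (u x)\<^sup>2)" "u \<in> borel_measurable borel"
proof -
  interpret P: prob_space P by fact
  interpret N: prob_space N using G by (simp add: is_limit_process_def)
  note [measurable_cong] = P(2)
  note [measurable] = borel_measurable_gauss_smooth[OF \<sigma>, where 'd='d]
  define v where "v i = gauss_smooth \<sigma> (lip_fun (e i))" for i
  have [measurable]: "v i \<in> borel_measurable borel" for i unfolding v_def by measurable
  have v2: "integrable P (\<lambda>x. (v i x)\<^sup>2)" for i
  proof -
    have "\<bar>v i x\<bar> \<le> norm x + \<bar>v i 0\<bar>" for x
      using lipschitz_onD[OF gauss_smooth_lipschitz[OF \<sigma> lip_fun_lipschitz, of "e i"], of x 0]
      by (simp add: dist_real_def v_def)
    then have "(v i x)\<^sup>2 \<le> (norm x + \<bar>v i 0\<bar>)\<^sup>2" for x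
      using power_mono[of "\<bar>v i x\<bar>" "norm x + \<bar>v i 0\<bar>" 2] by simp
    also have "(norm x + \<bar>v i 0\<bar>)\<^sup>2 \<le> 2 * (norm x)\<^sup>2 + 2 * \<bar>v i 0\<bar>\<^sup>2" for x
      using sum_squares_bound[of "norm x" "\<bar>v i 0\<bar>"] by (simp add: power2_sum)
    finally have le: "(v i x)\<^sup>2 \<le> 2 * (norm x)\<^sup>2 + 2 * \<bar>v i 0\<bar>\<^sup>2" for x .
    show ?thesis
      by (rule Bochner_Integration.integrable_bound[of P "\<lambda>x. 2 * (norm x)\<^sup>2 + 2 * \<bar>v i 0\<bar>\<^sup>2"])
        (use P2 le in \<open>auto intro!: AE_I2\<close>)
  qed
  have prod: "integrable K (\<lambda>x. g x * h x)"
    if "g \<in> borel_measurable K" "h \<in> borel_measurable K"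
      "integrable K (\<lambda>x. (g x)\<^sup>2)" "integrable K (\<lambda>x. (h x)\<^sup>2)" for g h :: "'z \<Rightarrow> real" and K
  proof (rule Bochner_Integration.integrable_bound[of K "\<lambda>x. (g x)\<^sup>2 + (h x)\<^sup>2"])
    show "AE x in K. norm (g x * h x) \<le> norm ((g x)\<^sup>2 + (h x)\<^sup>2)"
    proof (rule AE_I2)
      fix x
      have "2 * (\<bar>g x\<bar> * \<bar>h x\<bar>) \<le> (g x)\<^sup>2 + (h x)\<^sup>2"
        using sum_squares_bound[of "\<bar>g x\<bar>" "\<bar>h x\<bar>"] by (simp only: power2_abs mult.assoc)
      moreover have "0 \<le> \<bar>g x\<bar> * \<bar>h x\<bar>" by simp
      ultimately have "\<bar>g x * h x\<bar> \<le> (g x)\<^sup>2 + (h x)\<^sup>2" unfolding abs_mult by linarith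
      then show "norm (g x * h x) \<le> norm ((g x)\<^sup>2 + (h x)\<^sup>2)"
        unfolding real_norm_def by (rule order_trans[OF _ abs_ge_self])
    qed
  qed (use that in auto)
  have v1: "integrable P (v i)" for i
    by (rule P.square_integrable_imp_integrable[OF _ v2]) simp
  define c where "c i = (\<lambda>x. v i x - (\<integral>y. v i y \<partial>P))" for i
  have [measurable]: "c i \<in> borel_measurable borel" for i unfolding c_def by measurable
  have c2: "integrable P (\<lambda>x. (c i x)\<^sup>2)" for i
    unfolding c_def using v1 v2 by (simp add: power2_diff)
  have uv: "u x = (\<Sum>i<r. a i * v i x)" for x by (simp add: u v_def)
  show um: "u \<in> borel_measurable borel" unfolding u by measurable
  have u2_eq: "(u x)\<^sup>2 = (\<Sum>i<r. \<Sum>j<r. a i * a j * (v i x * v j x))" for x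
    by (simp add: uv power2_eq_square sum_product mult_ac)
  show "integrable P (\<lambda>x. (u x)\<^sup>2)"
    unfolding u2_eq using prod[OF _ _ v2 v2] by (intro Bochner_Integration.integrable_sum) auto
  have Eu: "(\<integral>y. u y \<partial>P) = (\<Sum>i<r. a i * (\<integral>y. v i y \<partial>P))"
    unfolding uv using v1 by simp
  have cen: "(u x - (\<integral>y. u y \<partial>P))\<^sup>2 = (\<Sum>i<r. \<Sum>j<r. a i * a j * (c i x * c j x))" for x
  proof -
    have "u x - (\<integral>y. u y \<partial>P) = (\<Sum>i<r. a i * c i x)"
      unfolding Eu c_def uv[of x] by (simp add: sum_subtractf[symmetric] right_diff_distrib)
    then show ?thesis by (simp add: power2_eq_square sum_product mult_ac)
  qed
  have var: "(\<integral>x. (u x - (\<integral>y. u y \<partial>P))\<^sup>2 \<partial>P) = (\<Sum>i<r. \<Sum>j<r. a i * a j * (\<integral>x. c i x * c j x \<partial>P))"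
    unfolding cen by (rule integral_quadratic_form) (rule prod; simp add: c2)
  have Gm: "(\<lambda>\<omega>. G \<omega> f) \<in> borel_measurable N" for f
    using G by (simp add: is_limit_process_def gaussian_process_def)
  note [measurable] = Gm
  have gp: "finite F \<Longrightarrow> \<exists>\<mu> s. s \<ge> 0 \<and> distr N borel (\<lambda>\<omega>. \<Sum>f\<in>F. a f * G \<omega> f) = normal_law \<mu> s" for F a
    using G by (simp add: is_limit_process_def gaussian_process_def)
  have mean0: "(\<integral>\<omega>. G \<omega> f \<partial>N) = 0" for f
    using G by (simp add: is_limit_process_def)
  have cov: "(\<integral>\<omega>. G \<omega> (e i) * G \<omega> (e j) \<partial>N) = (\<integral>x. c i x * c j x \<partial>P)" for i j
  proof -
    have "covariance N (\<lambda>\<omega>. G \<omega> (e i)) (\<lambda>\<omega>. G \<omega> (e j)) =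
      covariance P (gauss_smooth \<sigma> (lip_fun (e i))) (gauss_smooth \<sigma> (lip_fun (e j)))"
      using G by (simp add: is_limit_process_def)
    then show ?thesis by (simp add: covariance_def mean0 c_def v_def)
  qed
  have G12: "integrable N (\<lambda>\<omega>. G \<omega> f)" "integrable N (\<lambda>\<omega>. (G \<omega> f)\<^sup>2)" for f
  proof -
    obtain \<mu> s where "s \<ge> 0" "distr N borel (\<lambda>\<omega>. G \<omega> f) = normal_law \<mu> s"
      using gp[of "{f}" "\<lambda>_. 1"] by auto
    then show "integrable N (\<lambda>\<omega>. G \<omega> f)" "integrable N (\<lambda>\<omega>. (G \<omega> f)\<^sup>2)"
      using normal_law_moments[OF Gm] by blast+
  qed
  define Z where "Z \<omega> = (\<Sum>i<r. a i * G \<omega> (e i))" for \<omega>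
  have Zm: "Z \<in> borel_measurable N" unfolding Z_def by measurable
  have "\<exists>\<mu> s. s \<ge> 0 \<and> distr N borel Z = normal_law \<mu> s"
  proof -
    have "(\<Sum>f\<in>e ` {..<r}. a (inv_into {..<r} e f) * G \<omega> f) = Z \<omega>" for \<omega>
      unfolding Z_def by (subst sum.reindex[OF inj]) (auto simp: inv_into_f_f[OF inj] intro!: sum.cong)
    then show ?thesis using gp[of "e ` {..<r}" "\<lambda>f. a (inv_into {..<r} e f)"] by simp
  qed
  then obtain \<mu> s where s: "s \<ge> 0" and Zlaw: "distr N borel Z = normal_law \<mu> s" by blast
  note mom = normal_law_moments[OF Zm Zlaw s]
  have \<mu>: "\<mu> = 0"
    unfolding mom(3)[symmetric] unfolding Z_def using G12(1) by (simp add: mean0)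
  have Z2: "(Z \<omega>)\<^sup>2 = (\<Sum>i<r. \<Sum>j<r. a i * a j * (G \<omega> (e i) * G \<omega> (e j)))" for \<omega>
    by (simp add: Z_def power2_eq_square sum_product mult_ac)
  have "s\<^sup>2 = (\<integral>\<omega>. (Z \<omega>)\<^sup>2 \<partial>N)" using mom(4) \<mu> by simp
  also have "\<dots> = (\<Sum>i<r. \<Sum>j<r. a i * a j * (\<integral>\<omega>. G \<omega> (e i) * G \<omega> (e j) \<partial>N))"
    unfolding Z2 by (rule integral_quadratic_form) (rule prod[OF Gm Gm G12(2) G12(2)])
  also have "\<dots> = (\<integral>x. (u x - (\<integral>y. u y \<partial>P))\<^sup>2 \<partial>P)" unfolding var cov ..
  finally have s2: "s\<^sup>2 = (\<integral>x. (u x - (\<integral>y. u y \<partial>P))\<^sup>2 \<partial>P)" .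
  have "(\<integral>\<omega>. cos (Z \<omega> + b) \<partial>N) = (\<integral>x. cos (x + b) \<partial>distr N borel Z)"
    using Zm by (subst integral_distr) auto
  also have "\<dots> = (\<integral>x. cos (s * x + b) \<partial>std_normal_distribution)"
    unfolding Zlaw normal_law_eq_distr[OF s] \<mu> by (subst integral_distr) auto
  finally show "\<exists>s\<ge>0. s\<^sup>2 = (\<integral>x. (u x - (\<integral>y. u y \<partial>P))\<^sup>2 \<partial>P) \<and>
    (\<integral>\<omega>. cos ((\<Sum>i<r. a i * G \<omega> (e i)) + b) \<partial>N) = (\<integral>x. cos (s * x + b) \<partial>std_normal_distribution)"
    using s s2 unfolding Z_def by blast
qed

subsection \<open>The central limit theorem for the smoothed empirical process\<close>

text \<open>On a compact ball a 1-Lipschitz function is determined up to a small error by its values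
  on a net; the three errors add up to 3 \<delta> / 4.\<close>

lemma lip_ball_net:
  assumes R: "0 < R" and \<delta>: "0 < \<delta>"
  shows "\<exists>S :: (real ^ 'd::finite) set. finite S \<and> (\<forall>f g. (\<forall>x\<in>S. \<bar>lip_fun f x - lip_fun g x\<bar> \<le> \<delta> / 4) \<longrightarrow>
    (\<forall>z. norm z \<le> R \<longrightarrow> \<bar>lip_fun f z - lip_fun g z\<bar> \<le> \<delta>))"
proof -
  have "compact (cball (0 :: real ^ 'd) R)" by simp
  then have "\<exists>S. finite S \<and> S \<subseteq> cball 0 R \<and> cball (0 :: real ^ 'd) R \<subseteq> (\<Union>x\<in>S. ball x (\<delta> / 4))"
    using \<delta> by (intro seq_compact_imp_totally_bounded[OF compact_imp_seq_compact, rule_format]) simp_all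
  then obtain S where S: "finite S" "cball (0 :: real ^ 'd) R \<subseteq> (\<Union>x\<in>S. ball x (\<delta> / 4))" by blast
  have "\<bar>lip_fun f z - lip_fun g z\<bar> \<le> \<delta>"
    if fg: "\<forall>x\<in>S. \<bar>lip_fun f x - lip_fun g x\<bar> \<le> \<delta> / 4" and z: "norm z \<le> R" for f g z
  proof -
    have "z \<in> cball 0 R" using z by simp
    then obtain x where x: "x \<in> S" "dist x z < \<delta> / 4" using S(2) by fastforce
    have "\<bar>lip_fun h x - lip_fun h z\<bar> \<le> \<delta> / 4" for h :: "'d lip10"
      using lipschitz_onD[OF lip_fun_lipschitz, of x z h] x(2) by (simp add: dist_real_def)
    from this[of f] this[of g] have "\<bar>lip_fun f z - lip_fun g z\<bar> \<le> \<delta> / 4 + \<bar>lip_fun f x - lip_fun g x\<bar> + \<delta> / 4"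
      by linarith
    moreover have "\<bar>lip_fun f x - lip_fun g x\<bar> \<le> \<delta> / 4" using fg x(1) by blast
    ultimately show ?thesis using \<delta> by linarith
  qed
  with S(1) show ?thesis by blast
qed

text \<open>Composition with an index map. When \<open>\<pi>\<close> has finite range the result
  depends on finitely many coordinates of z, which reduces the problem to finite dimension without
  leaving the function space.\<close>

definition coarsen :: "('d::finite lip10 \<Rightarrow> 'd lip10) \<Rightarrow> 'd linf_lip10 \<Rightarrow> 'd linf_lip10" where
  "coarsen \<pi> z = Bcontfun (\<lambda>f. z (\<pi> f))"

lemma coarsen_apply: "coarsen \<pi> z f = z (\<pi> f)"
proof -
  have "(\<lambda>f. z (\<pi> f)) \<in> bcontfun"
    using norm_bounded[of z] by (auto simp: bcontfun_def bounded_iff)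
  then show ?thesis by (simp add: coarsen_def Bcontfun_inverse)
qed

lemma dist_coarsen: "dist (coarsen \<pi> y) (coarsen \<pi> z) \<le> dist y z"
  by (rule dist_bound) (simp add: coarsen_apply dist_bounded)

text \<open>One finite partition of the index set serves both the empirical process (a net of
  the Lipschitz ball on a large ball of \<open>\<real>\<^sup>d\<close>) and the limit (a net of a compact set carrying most
  of its mass); this replaces asymptotic equicontinuity.\<close>

lemma common_partition:
  fixes G :: "'v \<Rightarrow> 'd::finite linf_lip10"
  assumes tight: "tight_random_element N G" and e: "0 < e" and R: "0 < R" and \<delta>: "0 < \<delta>"
  shows "\<exists>\<pi> K. finite (range \<pi>) \<and> K \<in> sets borel \<and> measure N {\<omega> \<in> space N. G \<omega> \<in> K} \<ge> 1 - e \<and>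
    (\<forall>z\<in>K. dist z (coarsen \<pi> z) \<le> e) \<and>
    (\<forall>f z. \<bar>lip_fun f z - lip_fun (\<pi> f) z\<bar> \<le> (if norm z \<le> R then \<delta> else 2 * norm z))"
proof -
  obtain K where K: "compact K" "K \<in> sets borel" "measure N {\<omega> \<in> space N. G \<omega> \<in> K} \<ge> 1 - e"
    using tight e by (auto simp: tight_random_element_def)
  have "\<exists>Z. finite Z \<and> Z \<subseteq> K \<and> K \<subseteq> (\<Union>z\<in>Z. ball z (e / 4))"
    using e by (intro seq_compact_imp_totally_bounded[OF compact_imp_seq_compact[OF K(1)], rule_format]) simp
  then obtain Z where Z: "finite Z" "K \<subseteq> (\<Union>z\<in>Z. ball z (e / 4))" by blast
  obtain S :: "(real ^ 'd) set" where S: "finite S"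
    "\<forall>f g. (\<forall>x\<in>S. \<bar>lip_fun f x - lip_fun g x\<bar> \<le> \<delta> / 4) \<longrightarrow>
      (\<forall>z. norm z \<le> R \<longrightarrow> \<bar>lip_fun f z - lip_fun g z\<bar> \<le> \<delta>)"
    using lip_ball_net[OF R \<delta>, where 'd='d] by (elim exE conjE)
  \<comment> \<open>Evaluations at net points and the net elements of K are both bounded real
    functions on the index set, so one partition makes all of them nearly constant on its
    classes.\<close>
  define A where "A = (\<lambda>x f. lip_fun f x) ` S \<union> apply_bcontfun ` Z"
  have "finite A" using S Z by (simp add: A_def)
  moreover have "bounded (range a)" if "a \<in> A" for a
  proof -
    from that consider x where "a = (\<lambda>f. lip_fun f x)" | z where "a = apply_bcontfun z"
      by (auto simp: A_def)
    then show ?thesis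
    proof cases
      case 1
      then show ?thesis using lip_fun_bound by (auto simp: bounded_iff)
    next
      case 2
      then show ?thesis using norm_bounded[of z] by (auto simp: bounded_iff)
    qed
  qed
  ultimately obtain \<pi> where \<pi>: "finite (range \<pi>)" "\<And>a f. a \<in> A \<Longrightarrow> \<bar>a f - a (\<pi> f)\<bar> \<le> min (\<delta> / 4) (e / 4)"
    using finite_range_approx[of A "min (\<delta> / 4) (e / 4)"] e \<delta> by auto
  have "dist z (coarsen \<pi> z) \<le> e" if zK: "z \<in> K" for z
  proof (rule dist_bound)
    fix f
    obtain z0 where z0: "z0 \<in> Z" "dist z0 z < e / 4" using Z(2) zK by auto
    have "\<bar>z0 g - z g\<bar> \<le> e / 4" for g
      using dist_bounded[of z0 g z] z0(2) by (simp add: dist_real_def)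
    from this[of f] this[of "\<pi> f"]
    have "\<bar>z f - z (\<pi> f)\<bar> \<le> e / 4 + \<bar>z0 f - z0 (\<pi> f)\<bar> + e / 4" by linarith
    moreover have "\<bar>z0 f - z0 (\<pi> f)\<bar> \<le> e / 4"
      using \<pi>(2)[of "apply_bcontfun z0" f] z0(1) by (simp add: A_def)
    ultimately show "dist (z f) (coarsen \<pi> z f) \<le> e"
      using e unfolding coarsen_apply dist_real_def by linarith
  qed
  moreover have "\<bar>lip_fun f z - lip_fun (\<pi> f) z\<bar> \<le> (if norm z \<le> R then \<delta> else 2 * norm z)" for f z
  proof (cases "norm z \<le> R")
    case True
    have "\<bar>lip_fun f z - lip_fun (\<pi> f) z\<bar> \<le> \<delta>"
    proof (rule S(2)[rule_format, OF _ True])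
      fix x assume "x \<in> S"
      then have "(\<lambda>f. lip_fun f x) \<in> A" by (simp add: A_def)
      from \<pi>(2)[OF this, of f] show "\<bar>lip_fun f x - lip_fun (\<pi> f) x\<bar> \<le> \<delta> / 4" by simp
    qed
    then show ?thesis using True by simp
  next
    case False
    then show ?thesis using lip_fun_bound[of f z] lip_fun_bound[of "\<pi> f" z] by simp
  qed
  ultimately show ?thesis using \<pi>(1) K by blast
qed

definition empirical_process ::
  "real \<Rightarrow> (real ^ 'd) measure \<Rightarrow> nat \<Rightarrow> (nat \<Rightarrow> real ^ 'd) \<Rightarrow> 'd::finite linf_lip10" where
  "empirical_process \<sigma> P n x = sqrt (real n) *\<^sub>R (empirical_functional \<sigma> n x - smoothed_functional \<sigma> P)"

lemma borel_measurable_lipschitz_dist: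
  fixes H :: "'a::metric_space \<Rightarrow> real"
  assumes "\<And>y z. \<bar>H y - H z\<bar> \<le> C * dist y z"
  shows "H \<in> borel_measurable borel"
proof (rule borel_measurable_lipschitz)
  have "\<bar>H y - H z\<bar> \<le> max C 0 * dist y z" for y z
    using assms[of y z] mult_right_mono[OF max.cobounded1[of C 0] zero_le_dist[of y z]] by linarith
  then show "(max C 0)-lipschitz_on UNIV H" by (intro lipschitz_onI) (auto simp: dist_real_def)
qed

text \<open>The partition enters the limit theorem through \<open>kernel\<close>, and the second
  moment through the variances of the finite-dimensional limits.\<close>

locale smoothed_sampling =
  fixes \<sigma> :: real and P :: "(real ^ 'd::finite) measure" and \<Omega> :: "'w measure" and X :: "nat \<Rightarrow> 'w \<Rightarrow> real ^ 'd"
  assumes \<sigma>: "\<sigma> > 0" and P: "prob_space P" "sets P = sets borel" "integrable P norm"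
    and P2: "integrable P (\<lambda>x. (norm x)\<^sup>2)"
    and kernel: "(\<integral>\<^sup>+z. ennreal ((1 + norm z) * root_kernel \<sigma> P z) \<partial>lborel) < \<infinity>"
    and \<Omega>: "prob_space \<Omega>" and indep: "prob_space.indep_vars \<Omega> (\<lambda>_. borel) X UNIV"
    and law: "\<And>i. distr \<Omega> borel (X i) = P"
begin

sublocale \<Omega>: prob_space \<Omega> by (rule \<Omega>)

lemma X_measurable [measurable]: "X i \<in> borel_measurable \<Omega>"
  using indep by (auto simp: \<Omega>.indep_vars_def2)

definition E :: "nat \<Rightarrow> 'w \<Rightarrow> 'd linf_lip10" where
  "E n \<omega> = empirical_process \<sigma> P n (\<lambda>i. X i \<omega>)"

lemma E_measurable: "n \<ge> 1 \<Longrightarrow> E n \<in> borel_measurable \<Omega>"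
proof -
  assume n: "n \<ge> 1"
  have "continuous_on UNIV (\<lambda>z :: 'd linf_lip10. sqrt (real n) *\<^sub>R (z - smoothed_functional \<sigma> P))"
    by (intro continuous_intros)
  then have "(\<lambda>z :: 'd linf_lip10. sqrt (real n) *\<^sub>R (z - smoothed_functional \<sigma> P)) \<in> borel_measurable borel"
    by (rule borel_measurable_continuous_onI)
  from measurable_compose[OF measurable_empirical_functional[OF \<sigma> n, of X \<Omega>] this] show ?thesis
    unfolding E_def[abs_def] empirical_process_def by simp
qed

lemma indep_n: "prob_space.indep_vars \<Omega> (\<lambda>_. borel) X {..<n}"
  by (rule \<Omega>.indep_vars_subset[OF indep]) auto

lemma nn_integral_norm_E:
  assumes n: "n \<ge> 1"
  shows "(\<integral>\<^sup>+\<omega>. ennreal (norm (E n \<omega>)) \<partial>\<Omega>) \<le> (\<integral>\<^sup>+z. ennreal (norm z * root_kernel \<sigma> P z) \<partial>lborel)"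
proof -
  define D where "D \<omega> = norm (empirical_functional \<sigma> n (\<lambda>i. X i \<omega>) - smoothed_functional \<sigma> P)" for \<omega>
  have "(\<integral>\<^sup>+\<omega>. ennreal (norm (E n \<omega>)) \<partial>\<Omega>) = (\<integral>\<^sup>+\<omega>. ennreal (sqrt (real n)) * ennreal (D \<omega>) \<partial>\<Omega>)"
    by (simp add: E_def empirical_process_def D_def ennreal_mult)
  also have "\<dots> = ennreal (sqrt (real n)) * (\<integral>\<^sup>+\<omega>. ennreal (D \<omega>) \<partial>\<Omega>)"
  proof (rule nn_integral_cmult)
    have "(\<lambda>z. norm (z - smoothed_functional \<sigma> P)) \<in> borel_measurable borel"
      by (intro borel_measurable_continuous_onI continuous_intros)
    from measurable_compose[OF measurable_empirical_functional[OF \<sigma> n, of X \<Omega>] this]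
    show "(\<lambda>\<omega>. ennreal (D \<omega>)) \<in> borel_measurable \<Omega>" unfolding D_def by simp
  qed
  also have "\<dots> \<le> ennreal (sqrt (real n)) *
      (ennreal (1 / sqrt (real n)) * (\<integral>\<^sup>+z. ennreal (norm z * root_kernel \<sigma> P z) \<partial>lborel))"
    unfolding D_def
    by (intro mult_left_mono nn_integral_norm_empirical_deviation[OF \<sigma> \<Omega> n indep_n law P]) auto
  also have "\<dots> = (\<integral>\<^sup>+z. ennreal (norm z * root_kernel \<sigma> P z) \<partial>lborel)"
    using n by (simp add: mult.assoc[symmetric] ennreal_mult[symmetric])
  finally show ?thesis .
qed

lemma norm_moment_finite: "(\<integral>\<^sup>+z. ennreal (norm z * root_kernel \<sigma> P z) \<partial>lborel) < \<infinity>"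
proof (rule le_less_trans[OF nn_integral_mono kernel])
  fix z :: "real ^ 'd"
  show "ennreal (norm z * root_kernel \<sigma> P z) \<le> ennreal ((1 + norm z) * root_kernel \<sigma> P z)"
    by (intro ennreal_leI mult_right_mono root_kernel_nonneg) simp
qed

lemma E_tight:
  assumes e: "e > 0"
  shows "\<exists>R0>0. \<forall>R\<ge>R0. \<forall>n\<ge>1. measure \<Omega> {\<omega> \<in> space \<Omega>. norm (E n \<omega>) > R} \<le> e"
proof -
  define c where "c = enn2real (\<integral>\<^sup>+z. ennreal (norm z * root_kernel \<sigma> P z) \<partial>lborel)"
  have c: "(\<integral>\<^sup>+z. ennreal (norm z * root_kernel \<sigma> P z) \<partial>lborel) = ennreal c" "0 \<le> c"
    using norm_moment_finite by (auto simp: c_def less_top)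
  \<comment> \<open>Markov's inequality needs R \<ge> c / e; the summand 1 keeps the threshold
    positive when c is 0.\<close>
  define R0 where "R0 = c / e + 1"
  have R0: "R0 > 0" using c e by (simp add: R0_def add_nonneg_pos)
  have "measure \<Omega> {\<omega> \<in> space \<Omega>. norm (E n \<omega>) > R} \<le> e" if R: "R \<ge> R0" and n: "n \<ge> 1" for R n
  proof -
    note [measurable] = E_measurable[OF n]
    have nm: "(\<lambda>\<omega>. norm (E n \<omega>)) \<in> borel_measurable \<Omega>"
      by (rule measurable_compose[OF E_measurable[OF n] borel_measurable_continuous_onI]) (intro continuous_intros)
    have Rp: "R > 0" using R R0 by linarith
    have "emeasure \<Omega> {\<omega> \<in> space \<Omega>. norm (E n \<omega>) > R}
      \<le> emeasure \<Omega> {\<omega> \<in> space \<Omega>. 1 \<le> ennreal (1 / R) * ennreal (norm (E n \<omega>))}"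
    proof (rule emeasure_mono)
      show "{\<omega> \<in> space \<Omega>. norm (E n \<omega>) > R} \<subseteq> {\<omega> \<in> space \<Omega>. 1 \<le> ennreal (1 / R) * ennreal (norm (E n \<omega>))}"
        using Rp by (auto simp: ennreal_mult[symmetric] field_simps)
      show "{\<omega> \<in> space \<Omega>. 1 \<le> ennreal (1 / R) * ennreal (norm (E n \<omega>))} \<in> sets \<Omega>"
        using nm by measurable
    qed
    also have "\<dots> \<le> ennreal (1 / R) * (\<integral>\<^sup>+\<omega>. ennreal (norm (E n \<omega>)) * indicator (space \<Omega>) \<omega> \<partial>\<Omega>)"
      by (rule nn_integral_Markov_inequality) (use nm in auto)
    also have "(\<integral>\<^sup>+\<omega>. ennreal (norm (E n \<omega>)) * indicator (space \<Omega>) \<omega> \<partial>\<Omega>) = (\<integral>\<^sup>+\<omega>. ennreal (norm (E n \<omega>)) \<partial>\<Omega>)"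
      by (intro nn_integral_cong) simp
    also have "ennreal (1 / R) * \<dots> \<le> ennreal (1 / R) * ennreal c"
      using nn_integral_norm_E[OF n] c(1) by (intro mult_left_mono) auto
    also have "\<dots> = ennreal (c / R)" using Rp c by (simp add: ennreal_mult[symmetric])
    also have "\<dots> \<le> ennreal e"
    proof (rule ennreal_leI)
      have "c / e \<le> R" using R by (simp add: R0_def)
      then show "c / R \<le> e" using e Rp by (simp add: field_simps)
    qed
    finally show ?thesis using e by (simp add: \<Omega>.emeasure_eq_measure)
  qed
  then show ?thesis using R0 by blast
qed

text \<open>The scaling of the process cancels the rate of the deviation bound, so the coarsening
  error is controlled by the weight alone, uniformly in n.\<close>

lemma nn_integral_coarsen_E:
  assumes n: "n \<ge> 1" and w: "w \<in> borel_measurable borel" "\<And>z. 0 \<le> w z"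
    and \<pi>: "\<And>f z. \<bar>lip_fun f z - lip_fun (\<pi> f) z\<bar> \<le> w z"
  shows "(\<integral>\<^sup>+\<omega>. ennreal (dist (E n \<omega>) (coarsen \<pi> (E n \<omega>))) \<partial>\<Omega>)
    \<le> (\<integral>\<^sup>+z. ennreal (w z * root_kernel \<sigma> P z) \<partial>lborel)"
proof -
  define c where "c = sqrt (real n)"
  have c: "0 < c" using n by (simp add: c_def)
  define J where "J \<omega> = (\<integral>\<^sup>+z. ennreal ((c * w z) *
      \<bar>smoothed_density \<sigma> (empirical_measure n (\<lambda>i. X i \<omega>)) z - smoothed_density \<sigma> P z\<bar>) \<partial>lborel)" for \<omega>
  have "(\<integral>\<^sup>+\<omega>. ennreal (dist (E n \<omega>) (coarsen \<pi> (E n \<omega>))) \<partial>\<Omega>) \<le> (\<integral>\<^sup>+\<omega>. J \<omega> \<partial>\<Omega>)"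
    unfolding dist_norm
  proof (intro nn_integral_mono norm_functional_le_of_coordinates)
    fix \<omega> f
    have M: "prob_space (empirical_measure n (\<lambda>i. X i \<omega>))" "sets (empirical_measure n (\<lambda>i. X i \<omega>)) = sets borel"
      "integrable (empirical_measure n (\<lambda>i. X i \<omega>)) norm"
      using n by (auto simp: prob_space_empirical_measure sets_empirical_measure integrable_empirical_measure)
    note [measurable] = w(1) borel_measurable_smoothed_density(1)[OF M(1,2)] borel_measurable_smoothed_density(1)[OF P(1,2)]
    define u where "u = empirical_functional \<sigma> n (\<lambda>i. X i \<omega>) - smoothed_functional \<sigma> P"
    have "\<bar>(E n \<omega> - coarsen \<pi> (E n \<omega>)) f\<bar> = c * \<bar>u f - u (\<pi> f)\<bar>"
      using c by (simp add: coarsen_apply E_def empirical_process_def u_def c_def right_diff_distrib[symmetric] abs_mult)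
    then have "ennreal \<bar>(E n \<omega> - coarsen \<pi> (E n \<omega>)) f\<bar> = ennreal c * ennreal \<bar>u f - u (\<pi> f)\<bar>"
      using c by (simp add: ennreal_mult)
    also have "\<dots> \<le> ennreal c * (\<integral>\<^sup>+z. ennreal (w z *
      \<bar>smoothed_density \<sigma> (empirical_measure n (\<lambda>i. X i \<omega>)) z - smoothed_density \<sigma> P z\<bar>) \<partial>lborel)"
      unfolding u_def empirical_functional_def
      by (intro mult_left_mono smoothed_functional_diff_bound[OF \<sigma> M P \<pi>]) auto
    also have "\<dots> = J \<omega>"
      unfolding J_def using c w(2)
      by (subst nn_integral_cmult[symmetric]) (auto simp: ennreal_mult[symmetric] mult.assoc)
    finally show "ennreal \<bar>(E n \<omega> - coarsen \<pi> (E n \<omega>)) f\<bar> \<le> J \<omega>" .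
  qed
  also have "\<dots> \<le> ennreal (1 / sqrt (real n)) * (\<integral>\<^sup>+z. ennreal ((c * w z) * root_kernel \<sigma> P z) \<partial>lborel)"
    unfolding J_def
    by (rule nn_integral_empirical_density_bound[OF \<sigma> \<Omega> n indep_n law P(1,2)]) (use w c in auto)
  also have "\<dots> = (\<integral>\<^sup>+z. ennreal (w z * root_kernel \<sigma> P z) \<partial>lborel)"
  proof -
    note [measurable] = w(1) borel_measurable_smoothed_density(2)[OF P(1,2)]
    show ?thesis
      using c w(2) root_kernel_nonneg[of \<sigma> P]
      by (subst nn_integral_cmult[symmetric]) (auto simp: ennreal_mult[symmetric] c_def[symmetric] mult.assoc[symmetric])
  qed
  finally show ?thesis .
qed

text \<open>By linearity a combination of coordinates of the process is the normalised centred sum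
  of one function of the sample, which makes the scalar limit theorem sufficient.\<close>

lemma E_apply_sum:
  assumes n: "n \<ge> 1"
  shows "(\<Sum>i<r. a i * E n \<omega> (e i)) =
    (\<Sum>k<n. (\<Sum>i<r. a i * gauss_smooth \<sigma> (lip_fun (e i)) (X k \<omega>)) -
      (\<integral>x. (\<Sum>i<r. a i * gauss_smooth \<sigma> (lip_fun (e i)) x) \<partial>P)) / sqrt (real n)"
proof -
  define v where "v i = gauss_smooth \<sigma> (lip_fun (e i))" for i
  have vi: "integrable P (v i)" for i
    unfolding v_def by (rule integrable_lipschitz[OF P gauss_smooth_lipschitz[OF \<sigma> lip_fun_lipschitz]])
  define \<nu> where "\<nu> = empirical_measure n (\<lambda>i. X i \<omega>)"
  have E: "E n \<omega> (e i) = sqrt (real n) * ((\<Sum>k<n. v i (X k \<omega>)) / n - (\<integral>x. v i x \<partial>P))" for i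
  proof -
    have [measurable]: "v i \<in> borel_measurable borel"
      unfolding v_def by (rule borel_measurable_gauss_smooth[OF \<sigma>])
    have "smoothed_functional \<sigma> \<nu> (e i) = (\<integral>x. v i x \<partial>\<nu>)"
      unfolding \<nu>_def v_def using n
      by (intro smoothed_functional_apply[OF \<sigma>])
        (auto simp: prob_space_empirical_measure sets_empirical_measure integrable_empirical_measure)
    also have "\<dots> = (\<Sum>k<n. v i (X k \<omega>)) / n"
      unfolding \<nu>_def using n by (intro integral_empirical_measure) auto
    finally show ?thesis
      by (simp add: E_def empirical_process_def empirical_functional_def \<nu>_def[symmetric]
          smoothed_functional_apply[OF \<sigma> P] v_def[symmetric])
  qed
  have sq: "sqrt (real n) * (c / real n - d) = (c - real n * d) / sqrt (real n)" for c d
    using n by (simp add: field_simps)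
  have "(\<Sum>i<r. a i * E n \<omega> (e i)) = (\<Sum>i<r. a i * ((\<Sum>k<n. v i (X k \<omega>)) - real n * (\<integral>x. v i x \<partial>P))) / sqrt (real n)"
    unfolding E sq by (simp add: sum_divide_distrib)
  also have "(\<Sum>i<r. a i * ((\<Sum>k<n. v i (X k \<omega>)) - real n * (\<integral>x. v i x \<partial>P))) =
    (\<Sum>k<n. (\<Sum>i<r. a i * v i (X k \<omega>)) - (\<Sum>i<r. a i * (\<integral>x. v i x \<partial>P)))"
  proof -
    have "(\<Sum>k<n. \<Sum>i<r. a i * v i (X k \<omega>)) = (\<Sum>i<r. \<Sum>k<n. a i * v i (X k \<omega>))" by (rule sum.swap)
    then show ?thesis
      by (simp add: sum_subtractf right_diff_distrib sum_distrib_left mult_ac)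
  qed
  also have "(\<Sum>i<r. a i * (\<integral>x. v i x \<partial>P)) = (\<integral>x. (\<Sum>i<r. a i * v i x) \<partial>P)"
    using vi by simp
  finally show ?thesis by (simp add: v_def)
qed

text \<open>Both the process and its limit are compared with their coarsened versions, for which the
  claim is finite-dimensional. The index is \<open>Suc n\<close> because the empirical measure
  requires a nonempty sample.\<close>

lemma empirical_process_clt:
  fixes H :: "'d linf_lip10 \<Rightarrow> real" and G :: "'v \<Rightarrow> 'd linf_lip10"
  assumes G: "is_limit_process \<sigma> P N G"
    and lip: "\<And>y z. \<bar>H y - H z\<bar> \<le> C * dist y z" and bounded: "\<And>z. \<bar>H z\<bar> \<le> B"
  shows "(\<lambda>n. \<integral>\<omega>. H (E (Suc n) \<omega>) \<partial>\<Omega>) \<longlonglongrightarrow> (\<integral>\<omega>. H (G \<omega>) \<partial>N)"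
proof (rule LIMSEQ_approx)
  fix e :: real assume e: "0 < e"
  interpret N: prob_space N using G by (simp add: is_limit_process_def)
  have tight: "tight_random_element N G" using G by (simp add: is_limit_process_def)
  then have Gm: "G \<in> borel_measurable N" by (simp add: tight_random_element_def)
  have B: "0 \<le> B" using bounded[of 0] by linarith
  define C' where "C' = max C 0"
  have C': "0 \<le> C'" and lip': "\<bar>H y - H z\<bar> \<le> C' * dist y z" for y z
    using lip[of y z] mult_right_mono[OF max.cobounded1[of C 0] zero_le_dist[of y z]]
    by (auto simp: C'_def)
  have Hm: "H \<in> borel_measurable borel" by (rule borel_measurable_lipschitz_dist[OF lip])
  \<comment> \<open>The comparison for the process costs at most \<open>C'\<close> times \<epsilon>;
    the one for the limit adds 2 B times the mass outside K.\<close>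
  define \<epsilon> where "\<epsilon> = e / (C' + 2 * B + 1)"
  have \<epsilon>: "0 < \<epsilon>" "(C' + 2 * B) * \<epsilon> \<le> e"
    using e B C' by (auto simp: \<epsilon>_def field_simps)
  obtain R \<delta> where R: "R > 0" "\<delta> > 0"
    and small: "(\<integral>\<^sup>+z. ennreal ((if norm z \<le> R then \<delta> else 2 * norm z) * root_kernel \<sigma> P z) \<partial>lborel) < ennreal \<epsilon>"
    using small_weight[OF borel_measurable_smoothed_density(2)[OF P(1,2)] root_kernel_nonneg kernel \<epsilon>(1)] by blast
  obtain \<pi> K where \<pi>: "finite (range \<pi>)" and K: "K \<in> sets borel" "measure N {\<omega> \<in> space N. G \<omega> \<in> K} \<ge> 1 - \<epsilon>"
    "\<And>z. z \<in> K \<Longrightarrow> dist z (coarsen \<pi> z) \<le> \<epsilon>"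
    and \<pi>w: "\<And>f z. \<bar>lip_fun f z - lip_fun (\<pi> f) z\<bar> \<le> (if norm z \<le> R then \<delta> else 2 * norm z)"
    using common_partition[OF tight \<epsilon>(1) R] by blast
  have Hc: "\<bar>H (coarsen \<pi> y) - H (coarsen \<pi> z)\<bar> \<le> C' * dist y z" for y z
    using order_trans[OF lip' mult_left_mono[OF dist_coarsen C']] .
  have Hcm: "(\<lambda>z. H (coarsen \<pi> z)) \<in> borel_measurable borel" by (rule borel_measurable_lipschitz_dist[OF Hc])
  have E_close: "\<bar>(\<integral>\<omega>. H (E (Suc n) \<omega>) \<partial>\<Omega>) - (\<integral>\<omega>. H (coarsen \<pi> (E (Suc n) \<omega>)) \<partial>\<Omega>)\<bar> \<le> e" for n
  proof -
    have n: "Suc n \<ge> 1" by simp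
    have i1: "integrable \<Omega> (\<lambda>\<omega>. H (E (Suc n) \<omega>))"
      by (rule \<Omega>.integrable_const_bound[where B=B])
        (use bounded measurable_compose[OF E_measurable[OF n] Hm] in auto)
    have i2: "integrable \<Omega> (\<lambda>\<omega>. H (coarsen \<pi> (E (Suc n) \<omega>)))"
      by (rule \<Omega>.integrable_const_bound[where B=B])
        (use bounded measurable_compose[OF E_measurable[OF n] Hcm] in auto)
    have "ennreal \<bar>\<integral>\<omega>. H (E (Suc n) \<omega>) - H (coarsen \<pi> (E (Suc n) \<omega>)) \<partial>\<Omega>\<bar>
      \<le> (\<integral>\<^sup>+\<omega>. ennreal (norm (H (E (Suc n) \<omega>) - H (coarsen \<pi> (E (Suc n) \<omega>)))) \<partial>\<Omega>)"
      using integral_norm_bound_ennreal[OF Bochner_Integration.integrable_diff[OF i1 i2]] by simp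
    also have "\<dots> \<le> (\<integral>\<^sup>+\<omega>. ennreal C' * ennreal (dist (E (Suc n) \<omega>) (coarsen \<pi> (E (Suc n) \<omega>))) \<partial>\<Omega>)"
      using lip' C' by (intro nn_integral_mono) (simp add: ennreal_mult[symmetric] ennreal_leI)
    also have "\<dots> = ennreal C' * (\<integral>\<^sup>+\<omega>. ennreal (dist (E (Suc n) \<omega>) (coarsen \<pi> (E (Suc n) \<omega>))) \<partial>\<Omega>)"
    proof (rule nn_integral_cmult)
      have "continuous_on UNIV (coarsen \<pi>)"
        by (rule lipschitz_on_continuous_on[of 1]) (auto intro: lipschitz_onI simp: dist_coarsen)
      then have "continuous_on UNIV (\<lambda>z. dist z (coarsen \<pi> z))"
        by (intro continuous_on_dist continuous_on_id)
      from measurable_compose[OF E_measurable[OF n] borel_measurable_continuous_onI[OF this]]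
      show "(\<lambda>\<omega>. ennreal (dist (E (Suc n) \<omega>) (coarsen \<pi> (E (Suc n) \<omega>)))) \<in> borel_measurable \<Omega>" by simp
    qed
    also have "\<dots> \<le> ennreal C' * ennreal \<epsilon>"
    proof (intro mult_left_mono)
      have "(\<integral>\<^sup>+\<omega>. ennreal (dist (E (Suc n) \<omega>) (coarsen \<pi> (E (Suc n) \<omega>))) \<partial>\<Omega>)
        \<le> (\<integral>\<^sup>+z. ennreal ((if norm z \<le> R then \<delta> else 2 * norm z) * root_kernel \<sigma> P z) \<partial>lborel)"
        by (rule nn_integral_coarsen_E[OF n _ _ \<pi>w]) (use R in auto)
      then show "(\<integral>\<^sup>+\<omega>. ennreal (dist (E (Suc n) \<omega>) (coarsen \<pi> (E (Suc n) \<omega>))) \<partial>\<Omega>) \<le> ennreal \<epsilon>"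
        using small by (meson less_imp_le order_trans)
    qed simp
    also have "\<dots> = ennreal (C' * \<epsilon>)" using C' \<epsilon> by (simp add: ennreal_mult)
    finally have "\<bar>\<integral>\<omega>. H (E (Suc n) \<omega>) - H (coarsen \<pi> (E (Suc n) \<omega>)) \<partial>\<Omega>\<bar> \<le> C' * \<epsilon>"
      using C' \<epsilon>(1) by (subst (asm) ennreal_le_iff) auto
    also have "\<dots> \<le> (C' + 2 * B) * \<epsilon>" using B \<epsilon>(1) by (intro mult_right_mono) auto
    also have "\<dots> \<le> e" by (rule \<epsilon>)
    finally show ?thesis using i1 i2 by simp
  qed
  have G_close: "\<bar>(\<integral>\<omega>. H (G \<omega>) \<partial>N) - (\<integral>\<omega>. H (coarsen \<pi> (G \<omega>)) \<partial>N)\<bar> \<le> e"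
  proof -
    define A where "A = {\<omega> \<in> space N. G \<omega> \<notin> K}"
    have GK: "{\<omega> \<in> space N. G \<omega> \<in> K} \<in> sets N"
    proof -
      have "{\<omega> \<in> space N. G \<omega> \<in> K} = G -` K \<inter> space N" by blast
      then show ?thesis using measurable_sets[OF Gm K(1)] by simp
    qed
    have A_eq: "A = space N - {\<omega> \<in> space N. G \<omega> \<in> K}" by (auto simp: A_def)
    have A: "A \<in> sets N" unfolding A_eq using GK by blast
    have mA: "measure N A \<le> \<epsilon>" unfolding A_eq using N.prob_compl[OF GK] K(2) by simp
    have i1: "integrable N (\<lambda>\<omega>. H (G \<omega>))"
      by (rule N.integrable_const_bound[where B=B]) (use bounded measurable_compose[OF Gm Hm] in auto)
    have i2: "integrable N (\<lambda>\<omega>. H (coarsen \<pi> (G \<omega>)))"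
      by (rule N.integrable_const_bound[where B=B]) (use bounded measurable_compose[OF Gm Hcm] in auto)
    have i3: "integrable N (\<lambda>\<omega>. C' * \<epsilon> + 2 * B * indicator A \<omega>)"
      using A by (intro Bochner_Integration.integrable_add integrable_mult_right integrable_real_indicator)
        (auto simp: N.emeasure_eq_measure)
    have "\<bar>\<integral>\<omega>. H (G \<omega>) - H (coarsen \<pi> (G \<omega>)) \<partial>N\<bar> \<le> (\<integral>\<omega>. C' * \<epsilon> + 2 * B * indicator A \<omega> \<partial>N)"
    proof (rule abs_integral_le[OF Bochner_Integration.integrable_diff[OF i1 i2] i3])
      fix \<omega> assume \<omega>: "\<omega> \<in> space N"
      show "\<bar>H (G \<omega>) - H (coarsen \<pi> (G \<omega>))\<bar> \<le> C' * \<epsilon> + 2 * B * indicator A \<omega>"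
      proof (cases "G \<omega> \<in> K")
        case True
        then have "\<bar>H (G \<omega>) - H (coarsen \<pi> (G \<omega>))\<bar> \<le> C' * \<epsilon>"
          using order_trans[OF lip' mult_left_mono[OF K(3) C']] by blast
        then show ?thesis using True by (simp add: A_def)
      next
        case False
        then have "indicator A \<omega> = (1 :: real)" using \<omega> by (simp add: A_def)
        then show ?thesis
          using bounded[of "G \<omega>"] bounded[of "coarsen \<pi> (G \<omega>)"] mult_nonneg_nonneg[OF C' less_imp_le[OF \<epsilon>(1)]]
          by simp
      qed
    qed
    also have "\<dots> = C' * \<epsilon> + 2 * B * measure N A"
      using A by (subst Bochner_Integration.integral_add) (auto simp: N.prob_space N.emeasure_eq_measure)
    also have "\<dots> \<le> C' * \<epsilon> + 2 * B * \<epsilon>" using mA B by (intro add_left_mono mult_left_mono) auto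
    also have "\<dots> \<le> e" using \<epsilon>(2) by (simp add: distrib_right)
    finally show ?thesis using i1 i2 by simp
  qed
  have "(\<lambda>n. \<integral>\<omega>. H (coarsen \<pi> (E (Suc n) \<omega>)) \<partial>\<Omega>) \<longlonglongrightarrow> (\<integral>\<omega>. H (coarsen \<pi> (G \<omega>)) \<partial>N)"
  proof -
    define r where "r = card (range \<pi>)"
    obtain c where c: "bij_betw c {..<r} (range \<pi>)"
      using ex_bij_betw_nat_finite[OF \<pi>] unfolding r_def by (metis lessThan_atLeast0)
    define idx where "idx f = inv_into {..<r} c (\<pi> f)" for f
    have idx: "idx f < r" "c (idx f) = \<pi> f" for f
    proof -
      have "\<pi> f \<in> c ` {..<r}" using c by (auto simp: bij_betw_def)
      then show "idx f < r" "c (idx f) = \<pi> f"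
        unfolding idx_def using inv_into_into[of "\<pi> f" c "{..<r}"] by (auto simp: f_inv_into_f)
    qed
    \<comment> \<open>Rebuilds a coarsened functional from its r coordinates. It is 1-Lipschitz for
      the sum norm, so H composed with it meets the hypotheses of the cosine criterion.\<close>
    define L where "L x = (Bcontfun (\<lambda>f. x (idx f)) :: 'd linf_lip10)" for x :: "nat \<Rightarrow> real"
    have L: "L x f = x (idx f)" for x f
    proof -
      have "range (\<lambda>f. x (idx f)) \<subseteq> x ` {..<r}" using idx(1) by auto
      then have "bounded (range (\<lambda>f. x (idx f)))"
        by (rule bounded_subset[OF finite_imp_bounded, rotated]) simp
      then have "(\<lambda>f. x (idx f)) \<in> bcontfun" by (simp add: bcontfun_def)
      then show ?thesis by (simp add: L_def Bcontfun_inverse)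
    qed
    have LE: "L (\<lambda>i. z (c i)) = coarsen \<pi> z" for z :: "'d linf_lip10"
      by (rule bcontfun_eqI) (simp add: L coarsen_apply idx(2))
    have eval: "(\<lambda>z :: 'd linf_lip10. z f) \<in> borel_measurable borel" for f
      by (rule borel_measurable_lipschitz_dist[of _ 1])
        (metis dist_bounded dist_real_def mult_1)
    have Em: "(\<lambda>\<omega>. E (Suc n) \<omega> f) \<in> borel_measurable \<Omega>" for n f
      by (rule measurable_compose[OF E_measurable eval]) simp
    have Gfm: "(\<lambda>\<omega>. G \<omega> f) \<in> borel_measurable N" for f
      by (rule measurable_compose[OF Gm eval])
    have "(\<lambda>n. \<integral>\<omega>. H (L (\<lambda>i. E (Suc n) \<omega> (c i))) \<partial>\<Omega>) \<longlonglongrightarrow> (\<integral>\<omega>. H (L (\<lambda>i. G \<omega> (c i))) \<partial>N)"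
    proof (rule cos_convergence_imp_lipschitz_convergence[where I="{..<r}" and B=B and C=C'
        and F="\<lambda>x. H (L x)" and V="\<lambda>n \<omega> i. E (Suc n) \<omega> (c i)" and U="\<lambda>\<omega> i. G \<omega> (c i)"])
      show "\<bar>H (L x) - H (L y)\<bar> \<le> C' * (\<Sum>i<r. \<bar>x i - y i\<bar>)" for x y
      proof -
        have "dist (L x) (L y) \<le> (\<Sum>i<r. \<bar>x i - y i\<bar>)"
        proof (rule dist_bound)
          fix f
          show "dist (L x f) (L y f) \<le> (\<Sum>i<r. \<bar>x i - y i\<bar>)"
            unfolding L dist_real_def using idx(1)[of f]
            by (intro member_le_sum[where f="\<lambda>i. \<bar>x i - y i\<bar>"]) auto
        qed
        from order_trans[OF lip' mult_left_mono[OF this C']] show ?thesis .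
      qed
      show "(\<lambda>n. \<integral>\<omega>. cos ((\<Sum>i<r. a i * E (Suc n) \<omega> (c i)) + b) \<partial>\<Omega>)
        \<longlonglongrightarrow> (\<integral>\<omega>. cos ((\<Sum>i<r. a i * G \<omega> (c i)) + b) \<partial>N)" for a b
      proof -
        define u where "u = (\<lambda>x. \<Sum>i<r. a i * gauss_smooth \<sigma> (lip_fun (c i)) x)"
        define \<mu> where "\<mu> = (\<integral>x. u x \<partial>P)"
        have inj: "inj_on c {..<r}" using c by (simp add: bij_betw_def)
        note lp = limit_process_cos[OF \<sigma> P(1,2) P2 G inj u_def]
        obtain s where s: "s \<ge> 0" "s\<^sup>2 = (\<integral>x. (u x - \<mu>)\<^sup>2 \<partial>P)"
          "(\<integral>\<omega>. cos ((\<Sum>i<r. a i * G \<omega> (c i)) + b) \<partial>N) = (\<integral>x. cos (s * x + b) \<partial>std_normal_distribution)"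
          using lp(1)[of b] unfolding \<mu>_def by blast
        have "(\<lambda>n. \<integral>\<omega>. cos ((\<Sum>k<n. u (X k \<omega>) - \<mu>) / sqrt (real n) + b) \<partial>\<Omega>)
          \<longlonglongrightarrow> (\<integral>x. cos (s * x + b) \<partial>std_normal_distribution)"
          by (rule scalar_clt_cos[OF \<Omega> indep law lp(3,2) \<mu>_def s(1,2)])
        from LIMSEQ_Suc[OF this] show ?thesis
          unfolding s(3) by (subst E_apply_sum) (simp_all add: u_def \<mu>_def)
      qed
      fix d :: real assume d: "0 < d"
      obtain R1 where R1: "R1 > 0" "\<And>R n. R \<ge> R1 \<Longrightarrow> n \<ge> 1 \<Longrightarrow> measure \<Omega> {\<omega> \<in> space \<Omega>. norm (E n \<omega>) > R} \<le> d"
        using E_tight[OF d] by blast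
      obtain R2 where R2: "R2 > 0" "\<And>R. R \<ge> R2 \<Longrightarrow> measure N {\<omega> \<in> space N. \<exists>i\<in>{..<r}. \<bar>G \<omega> (c i)\<bar> > R} \<le> d"
        using tight_coordinates[OF N.prob_space_axioms, of "{..<r}" "\<lambda>\<omega> i. G \<omega> (c i)" d] Gfm d by auto
      define M where "M = max R1 R2"
      have M: "M > 0" "R1 \<le> M" "R2 \<le> M" using R1(1) by (auto simp: M_def)
      have "measure \<Omega> {\<omega> \<in> space \<Omega>. \<exists>i\<in>{..<r}. \<bar>E (Suc n) \<omega> (c i)\<bar> > M} \<le> d" for n
      proof -
        have "{\<omega> \<in> space \<Omega>. norm (E (Suc n) \<omega>) > M} \<in> sets \<Omega>"
        proof -
          have "(\<lambda>\<omega>. norm (E (Suc n) \<omega>)) \<in> borel_measurable \<Omega>"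
            by (rule measurable_compose[OF E_measurable borel_measurable_continuous_onI])
              (auto intro!: continuous_intros)
          then show ?thesis by measurable
        qed
        moreover have "{\<omega> \<in> space \<Omega>. \<exists>i\<in>{..<r}. \<bar>E (Suc n) \<omega> (c i)\<bar> > M} \<subseteq> {\<omega> \<in> space \<Omega>. norm (E (Suc n) \<omega>) > M}"
          using norm_bounded[of "E (Suc n) _"] by (auto intro: less_le_trans)
        ultimately have "measure \<Omega> {\<omega> \<in> space \<Omega>. \<exists>i\<in>{..<r}. \<bar>E (Suc n) \<omega> (c i)\<bar> > M}
          \<le> measure \<Omega> {\<omega> \<in> space \<Omega>. norm (E (Suc n) \<omega>) > M}"
          by (intro \<Omega>.finite_measure_mono)
        also have "\<dots> \<le> d" by (rule R1(2)[OF M(2)]) simp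
        finally show ?thesis .
      qed
      then show "\<exists>L>0. (\<forall>\<^sub>F n in sequentially. measure \<Omega> {\<omega> \<in> space \<Omega>. \<exists>i\<in>{..<r}. L < \<bar>E (Suc n) \<omega> (c i)\<bar>} \<le> d) \<and>
          measure N {\<omega> \<in> space N. \<exists>i\<in>{..<r}. L < \<bar>G \<omega> (c i)\<bar>} \<le> d"
        using M R2(2)[OF M(3)] by (intro exI[of _ M]) simp
    qed (use \<Omega> N.prob_space_axioms Em Gfm bounded in auto)
    then show ?thesis by (simp add: LE)
  qed
  with E_close G_close show "\<exists>y y'. (\<forall>\<^sub>F n in sequentially. \<bar>(\<integral>\<omega>. H (E (Suc n) \<omega>) \<partial>\<Omega>) - y n\<bar> \<le> e) \<and>
      \<bar>(\<integral>\<omega>. H (G \<omega>) \<partial>N) - y'\<bar> \<le> e \<and> y \<longlonglongrightarrow> y'"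
    by (intro exI[of _ "\<lambda>n. \<integral>\<omega>. H (coarsen \<pi> (E (Suc n) \<omega>)) \<partial>\<Omega>"]
        exI[of _ "\<integral>\<omega>. H (coarsen \<pi> (G \<omega>)) \<partial>N"] conjI always_eventually allI)
qed

end

subsection \<open>Minimum expected distance\<close>

lemma enn2real_INF_le:
  assumes ne: "\<Theta> \<noteq> {}" and W: "\<And>\<theta>. \<theta> \<in> \<Theta> \<Longrightarrow> W \<theta> \<le> ennreal (f \<theta> + c)"
    and f: "\<And>\<theta>. \<theta> \<in> \<Theta> \<Longrightarrow> 0 \<le> f \<theta>" and c: "0 \<le> c"
  shows "enn2real (INF \<theta>\<in>\<Theta>. W \<theta>) \<le> (INF \<theta>\<in>\<Theta>. f \<theta>) + c"
proof -
  have "enn2real (INF \<theta>\<in>\<Theta>. W \<theta>) - c \<le> (INF \<theta>\<in>\<Theta>. f \<theta>)"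
  proof (rule cINF_greatest[OF ne])
    fix \<theta> assume \<theta>: "\<theta> \<in> \<Theta>"
    have "(INF \<theta>\<in>\<Theta>. W \<theta>) \<le> ennreal (f \<theta> + c)"
      by (rule order_trans[OF INF_lower[where f=W, OF \<theta>] W[OF \<theta>]])
    then have "enn2real (INF \<theta>\<in>\<Theta>. W \<theta>) \<le> f \<theta> + c"
      using f[OF \<theta>] c by (intro enn2real_leI) auto
    then show "enn2real (INF \<theta>\<in>\<Theta>. W \<theta>) - c \<le> f \<theta>" by simp
  qed
  then show ?thesis by simp
qed

text \<open>Since \<open>enn2real\<close> sends infinity to 0, a lower bound needs W to be finite.
  Truncation by \<open>ennreal\<close> takes care of a possibly negative difference.\<close>

lemma le_enn2real_INF:
  assumes ne: "\<Theta> \<noteq> {}" and W: "\<And>\<theta>. \<theta> \<in> \<Theta> \<Longrightarrow> ennreal (f \<theta>) \<le> W \<theta> + ennreal c"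
    and f: "\<And>\<theta>. \<theta> \<in> \<Theta> \<Longrightarrow> 0 \<le> f \<theta>" and c: "0 \<le> c" and fin: "\<And>\<theta>. \<theta> \<in> \<Theta> \<Longrightarrow> W \<theta> < \<infinity>"
  shows "(INF \<theta>\<in>\<Theta>. f \<theta>) \<le> enn2real (INF \<theta>\<in>\<Theta>. W \<theta>) + c"
proof -
  have bdd: "bdd_below (f ` \<Theta>)" using f by (auto intro!: bdd_belowI[of _ 0])
  have "ennreal ((INF \<theta>\<in>\<Theta>. f \<theta>) - c) \<le> (INF \<theta>\<in>\<Theta>. W \<theta>)"
  proof (rule INF_greatest)
    fix \<theta> assume \<theta>: "\<theta> \<in> \<Theta>"
    obtain w where w: "W \<theta> = ennreal w" "0 \<le> w" using fin[OF \<theta>] by (cases "W \<theta>") auto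
    have "ennreal (f \<theta>) \<le> ennreal (w + c)" using W[OF \<theta>] w c by simp
    then have "f \<theta> \<le> w + c" using w c by (subst (asm) ennreal_le_iff) auto
    moreover have "(INF \<theta>\<in>\<Theta>. f \<theta>) \<le> f \<theta>" by (rule cINF_lower[OF bdd \<theta>])
    ultimately show "ennreal ((INF \<theta>\<in>\<Theta>. f \<theta>) - c) \<le> W \<theta>" unfolding w(1) by (intro ennreal_leI) simp
  qed
  moreover obtain \<theta> where \<theta>: "\<theta> \<in> \<Theta>" using ne by auto
  have "(INF \<theta>\<in>\<Theta>. W \<theta>) < \<infinity>" by (rule le_less_trans[OF INF_lower[where f=W, OF \<theta>] fin[OF \<theta>]])
  then obtain v where v: "(INF \<theta>\<in>\<Theta>. W \<theta>) = ennreal v" "0 \<le> v" by (cases "INF \<theta>\<in>\<Theta>. W \<theta>") auto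
  ultimately have "(INF \<theta>\<in>\<Theta>. f \<theta>) - c \<le> v" by (simp add: ennreal_le_iff)
  then show ?thesis using v by simp
qed

lemma mult_cINF:
  fixes f :: "'a \<Rightarrow> real"
  assumes ne: "\<Theta> \<noteq> {}" and f: "\<And>\<theta>. \<theta> \<in> \<Theta> \<Longrightarrow> 0 \<le> f \<theta>" and c: "0 < c"
  shows "c * (INF \<theta>\<in>\<Theta>. f \<theta>) = (INF \<theta>\<in>\<Theta>. c * f \<theta>)"
proof (rule antisym)
  have bdd: "bdd_below (f ` \<Theta>)" "bdd_below ((\<lambda>\<theta>. c * f \<theta>) ` \<Theta>)"
    using f c by (auto intro!: bdd_belowI[of _ 0])
  show "c * (INF \<theta>\<in>\<Theta>. f \<theta>) \<le> (INF \<theta>\<in>\<Theta>. c * f \<theta>)"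
    using c by (intro cINF_greatest[OF ne] mult_left_mono cINF_lower[OF bdd(1)]) auto
  have "(INF \<theta>\<in>\<Theta>. c * f \<theta>) / c \<le> (INF \<theta>\<in>\<Theta>. f \<theta>)"
  proof (rule cINF_greatest[OF ne])
    fix \<theta> assume "\<theta> \<in> \<Theta>"
    from cINF_lower[OF bdd(2) this] show "(INF \<theta>\<in>\<Theta>. c * f \<theta>) / c \<le> f \<theta>"
      using c by (simp add: field_simps)
  qed
  then show "(INF \<theta>\<in>\<Theta>. c * f \<theta>) \<le> c * (INF \<theta>\<in>\<Theta>. f \<theta>)" using c by (simp add: field_simps)
qed

text \<open>The first bound makes the expected distance 1-Lipschitz in z. The second, with the
  smoothed model for z', compares it with the distance to the model, without forming a mean of Y in
  the function space.\<close>

lemma nn_integral_norm_shift_le: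
  fixes Y :: "'w \<Rightarrow> 'b::real_normed_vector"
  assumes "prob_space K" and Y: "Y \<in> borel_measurable K"
  shows "(\<integral>\<^sup>+y. ennreal (norm (z - Y y)) \<partial>K) \<le> ennreal (norm (z - z')) + (\<integral>\<^sup>+y. ennreal (norm (z' - Y y)) \<partial>K)"
    and "ennreal (norm (z - z')) \<le> (\<integral>\<^sup>+y. ennreal (norm (z - Y y)) \<partial>K) + (\<integral>\<^sup>+y. ennreal (norm (Y y - z')) \<partial>K)"
proof -
  interpret prob_space K by fact
  have m: "(\<lambda>y. ennreal (norm (a - Y y))) \<in> borel_measurable K" for a
  proof -
    have "(\<lambda>y. norm (a - y)) \<in> borel_measurable borel"
      by (intro borel_measurable_continuous_onI continuous_intros)
    from measurable_compose[OF Y this] show ?thesis by simp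
  qed
  have "(\<integral>\<^sup>+y. ennreal (norm (z - Y y)) \<partial>K) \<le> (\<integral>\<^sup>+y. ennreal (norm (z - z')) + ennreal (norm (z' - Y y)) \<partial>K)"
  proof (rule nn_integral_mono)
    fix y
    show "ennreal (norm (z - Y y)) \<le> ennreal (norm (z - z')) + ennreal (norm (z' - Y y))"
      using norm_triangle_ineq[of "z - z'" "z' - Y y"]
      by (simp add: ennreal_plus[symmetric] ennreal_leI del: ennreal_plus)
  qed
  also have "\<dots> = ennreal (norm (z - z')) + (\<integral>\<^sup>+y. ennreal (norm (z' - Y y)) \<partial>K)"
    by (subst nn_integral_add[OF _ m]) (simp_all add: emeasure_space_1)
  finally show "(\<integral>\<^sup>+y. ennreal (norm (z - Y y)) \<partial>K) \<le> ennreal (norm (z - z')) + (\<integral>\<^sup>+y. ennreal (norm (z' - Y y)) \<partial>K)" .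
  have "ennreal (norm (z - z')) = (\<integral>\<^sup>+y. ennreal (norm (z - z')) \<partial>K)" by (simp add: emeasure_space_1)
  also have "\<dots> \<le> (\<integral>\<^sup>+y. ennreal (norm (z - Y y)) + ennreal (norm (z' - Y y)) \<partial>K)"
  proof (rule nn_integral_mono)
    fix y
    show "ennreal (norm (z - z')) \<le> ennreal (norm (z - Y y)) + ennreal (norm (z' - Y y))"
      using norm_triangle_ineq[of "z - Y y" "Y y - z'"]
      by (simp add: ennreal_plus[symmetric] ennreal_leI norm_minus_commute del: ennreal_plus)
  qed
  also have "\<dots> = (\<integral>\<^sup>+y. ennreal (norm (z - Y y)) \<partial>K) + (\<integral>\<^sup>+y. ennreal (norm (z' - Y y)) \<partial>K)"
    by (rule nn_integral_add[OF m m])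
  finally show "ennreal (norm (z - z')) \<le> (\<integral>\<^sup>+y. ennreal (norm (z - Y y)) \<partial>K) + (\<integral>\<^sup>+y. ennreal (norm (Y y - z')) \<partial>K)"
    by (simp add: norm_minus_commute)
qed

lemma expected_smoothed_wasserstein1_eq:
  fixes Q :: "(real ^ 'd::finite) measure"
  assumes \<sigma>: "\<sigma> > 0" and n: "n \<ge> 1" and m: "m \<ge> 1"
  shows "expected_smoothed_wasserstein1 \<sigma> n x m Q =
    (\<integral>\<^sup>+y. ennreal (norm (empirical_functional \<sigma> n x - empirical_functional \<sigma> m y)) \<partial>(\<Pi>\<^sub>M i\<in>{..<m}. Q))"
  unfolding expected_smoothed_wasserstein1_def empirical_functional_def
  using n m by (intro nn_integral_cong smoothed_wasserstein1_eq_norm[OF \<sigma>])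
    (auto simp: prob_space_empirical_measure sets_empirical_measure integrable_empirical_measure)

lemma measurable_empirical_functional_PiM:
  fixes Q :: "(real ^ 'd::finite) measure"
  assumes \<sigma>: "\<sigma> > 0" and m: "m \<ge> 1" and Q: "sets Q = sets borel"
  shows "empirical_functional \<sigma> m \<in> borel_measurable (\<Pi>\<^sub>M i\<in>{..<m}. Q)"
proof -
  have "(\<lambda>y. empirical_functional \<sigma> m (\<lambda>i. y i)) \<in> borel_measurable (\<Pi>\<^sub>M i\<in>{..<m}. Q)"
  proof (rule measurable_empirical_functional[OF \<sigma> m])
    fix i assume "i < m"
    then have "(\<lambda>y. y i) \<in> (\<Pi>\<^sub>M i\<in>{..<m}. Q) \<rightarrow>\<^sub>M Q" by (intro measurable_component_singleton) auto
    then show "(\<lambda>y. y i) \<in> borel_measurable (\<Pi>\<^sub>M i\<in>{..<m}. Q)"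
      using measurable_cong_sets[OF refl Q] by blast
  qed
  then show ?thesis by simp
qed

lemma linear_pairing: "linear (\<lambda>t. pairing t D)"
  by (rule linearI) (simp_all add: pairing_def scaleR_left_distrib sum.distrib scaleR_sum_right)

lemma INF_norm_lipschitz:
  fixes A :: "'t \<Rightarrow> 'b::real_normed_vector"
  shows "\<bar>(INF t. norm (y - A t)) - (INF t. norm (z - A t))\<bar> \<le> dist y z"
proof -
  have "(INF t. norm (y - A t)) - dist y z \<le> (INF t. norm (z - A t))" for y z
  proof (rule cINF_greatest)
    fix t
    have "(INF t. norm (y - A t)) \<le> norm (y - A t)"
      by (rule cINF_lower) (auto intro!: bdd_belowI[of _ 0])
    also have "\<dots> \<le> dist y z + norm (z - A t)"
      using norm_triangle_ineq[of "y - z" "z - A t"] by (simp add: dist_norm)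
    finally show "(INF t. norm (y - A t)) - dist y z \<le> norm (z - A t)" by simp
  qed simp
  from this[of y z] this[of z y] show ?thesis by (simp add: abs_le_iff dist_commute)
qed

lemma cts_step_lipschitz:
  assumes "a < b"
  shows "\<bar>cts_step a b u - cts_step a b v\<bar> \<le> 1 / (b - a) * \<bar>u - v\<bar>"
proof -
  have "cts_step a b u = max 0 (min 1 ((b - u) / (b - a)))" for u
    using assms by (auto simp: cts_step_def max_def min_def field_simps)
  then have "\<bar>cts_step a b u - cts_step a b v\<bar> \<le> \<bar>(b - u) / (b - a) - (b - v) / (b - a)\<bar>"
    by (simp add: max_def min_def)
  also have "\<dots> = 1 / (b - a) * \<bar>u - v\<bar>"
    using assms by (simp add: diff_divide_distrib[symmetric] abs_minus_commute)
  finally show ?thesis .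
qed

theorem theorem7:
  fixes \<sigma> :: real
    and \<Theta> :: "(real ^ 'k) set"
    and Q :: "real ^ 'k \<Rightarrow> (real ^ 'd) measure"
    and \<theta>\<^sub>0 :: "real ^ 'k"
    and P :: "(real ^ 'd) measure"
    and I :: "nat \<Rightarrow> (real ^ 'd) set"
    and M :: "nat \<Rightarrow> real"
    and D :: "('d linf_lip10) ^ 'k"
    and m :: "nat \<Rightarrow> nat"
    and \<Omega> :: "'w measure" and X :: "nat \<Rightarrow> 'w \<Rightarrow> real ^ 'd"
    and N :: "'v measure" and G :: "'v \<Rightarrow> 'd linf_lip10"
  assumes "\<sigma> > 0"
    and "compact \<Theta>" and "interior \<Theta> \<noteq> {}"
    and "\<And>\<theta>. \<theta> \<in> \<Theta> \<Longrightarrow>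
           prob_space (Q \<theta>) \<and> sets (Q \<theta>) = sets borel \<and> integrable (Q \<theta>) norm"
    and "\<theta>\<^sub>0 \<in> interior \<Theta>" and "P = Q \<theta>\<^sub>0"
    and "integrable P (\<lambda>x. (norm x)\<^sup>2)"
    and "disjoint_family I" and "(\<Union>j. I j) = UNIV"
    and "\<And>j. I j \<in> sets borel"
    and "\<And>j. bounded (I j) \<and> convex (I j) \<and> interior (I j) \<noteq> {}"
    and "bdd_above (range (\<lambda>j. diameter (I j)))"
    and "\<And>j. M j = (SUP x\<in>I j. norm x)" and "\<And>j. M j \<ge> 1"
    and "summable (\<lambda>j. M j * sqrt (measure P (I j)))"
    and weakly_continuous:
      "\<And>h :: real ^ 'd \<Rightarrow> real. continuous_on UNIV h \<Longrightarrow> bounded (range h) \<Longrightarrow>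
         continuous_on \<Theta> (\<lambda>\<theta>. \<integral>x. h x \<partial>(Q \<theta>))"
    and identifiable: "\<And>\<theta>. \<theta> \<in> \<Theta> \<Longrightarrow> \<theta> \<noteq> \<theta>\<^sub>0 \<Longrightarrow> P \<noteq> Q \<theta>"
    and differentiable:
      "(\<lambda>\<theta>. norm (smoothed_functional \<sigma> (Q \<theta>) - smoothed_functional \<sigma> (Q \<theta>\<^sub>0)
                    - pairing (\<theta> - \<theta>\<^sub>0) D))
         \<in> o[at \<theta>\<^sub>0 within \<Theta>](\<lambda>\<theta>. norm (\<theta> - \<theta>\<^sub>0))"
    and nonsingular: "\<And>t. t \<noteq> 0 \<Longrightarrow> pairing t D \<noteq> 0"
    and "\<And>n. n \<ge> 1 \<Longrightarrow> m n \<ge> 1"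
    and "(\<lambda>n. real n / real (m n)) \<longlonglongrightarrow> 0"
    and "\<exists>q > 2 * (real CARD('d) + 1).
           (SUP \<theta>\<in>\<Theta>. \<integral>\<^sup>+x. ennreal (norm x powr q) \<partial>(Q \<theta>)) < \<infinity>"
    and "prob_space \<Omega>"
    and "prob_space.indep_vars \<Omega> (\<lambda>_. borel) X UNIV"
    and "\<And>i. distr \<Omega> borel (X i) = P"
    and "is_limit_process \<sigma> P N G"
  shows "converges_in_distribution \<Omega>
           (\<lambda>n \<omega>. sqrt (real n) *
              enn2real (INF \<theta>\<in>\<Theta>. expected_smoothed_wasserstein1 \<sigma> n (\<lambda>i. X i \<omega>) (m n) (Q \<theta>)))
           N
           (\<lambda>\<omega>. INF t. norm (G \<omega> - pairing t D))"
proof -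
  note \<sigma> = assms(1) and Qp = assms(4)
  have \<theta>0: "\<theta>\<^sub>0 \<in> \<Theta>" using assms(5) interior_subset by blast
  then have ne: "\<Theta> \<noteq> {}" by auto
  have P: "prob_space P" "sets P = sets borel" "integrable P norm"
    using Qp[OF \<theta>0] assms(6) by auto
  have I_ne: "I j \<noteq> {}" for j
    using assms(11)[of j] by (metis interior_empty)
  interpret smoothed_sampling \<sigma> P \<Omega> X
  proof (rule smoothed_sampling.intro)
    show "(\<integral>\<^sup>+z. ennreal ((1 + norm z) * root_kernel \<sigma> P z) \<partial>lborel) < \<infinity>"
      by (rule root_kernel_partition_bound[OF \<sigma> P(1,2) assms(8,9,10) _ I_ne assms(12,13,14,15)])
        (use assms(11) in auto)
  qed (rule \<sigma> P assms(7,23,24,25))+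
  interpret N: prob_space N using assms(26) by (simp add: is_limit_process_def)
  have Gm: "G \<in> borel_measurable N"
    using assms(26) by (simp add: is_limit_process_def tight_random_element_def)

  \<comment> \<open>The criterion as a function on the space of bounded functionals\<close>
  define q where "q \<theta> = smoothed_functional \<sigma> (Q \<theta>)" for \<theta>
  have Pq: "smoothed_functional \<sigma> P = q \<theta>\<^sub>0" by (simp add: q_def assms(6))
  define A where "A t = pairing t D" for t
  define \<Phi> where "\<Phi> z = (INF t. norm (z - A t))" for z :: "'d linf_lip10"
  have \<Phi>_lip: "\<bar>\<Phi> y - \<Phi> z\<bar> \<le> dist y z" for y z
    unfolding \<Phi>_def by (rule INF_norm_lipschitz)
  have \<Phi>m: "\<Phi> \<in> borel_measurable borel"
    by (rule borel_measurable_lipschitz_dist[of _ 1]) (simp add: \<Phi>_lip)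
  obtain p where p: "p > 2 * (real CARD('d) + 1)" "(SUP \<theta>\<in>\<Theta>. \<integral>\<^sup>+x. ennreal (norm x powr p) \<partial>(Q \<theta>)) < \<infinity>"
    using assms(22) by blast
  have "\<exists>C\<ge>0. \<forall>\<theta>\<in>\<Theta>. (\<integral>\<^sup>+z. ennreal (norm z * root_kernel \<sigma> (Q \<theta>) z) \<partial>lborel) \<le> ennreal C"
    by (rule root_kernel_uniform_bound[OF \<sigma> _ p]) (use Qp in auto)
  then obtain C where C: "0 \<le> C"
    "\<And>\<theta>. \<theta> \<in> \<Theta> \<Longrightarrow> (\<integral>\<^sup>+z. ennreal (norm z * root_kernel \<sigma> (Q \<theta>) z) \<partial>lborel) \<le> ennreal C"
    by blast
  \<comment> \<open>The cost of replacing a model measure by its sample, uniform over \<Theta>.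
    Multiplied by sqrt n it becomes C sqrt (n / m n), which tends to 0.\<close>
  define c where "c n = C / sqrt (real (m n))" for n
  have c0: "0 \<le> c n" for n using C by (simp add: c_def)
  \<comment> \<open>The conditional expectation with an arbitrary functional z in place of the
    smoothed empirical measure; freeing z makes Lipschitz continuity in z available.\<close>
  define W where "W n \<theta> z = (\<integral>\<^sup>+y. ennreal (norm (z - empirical_functional \<sigma> (m n) y)) \<partial>(\<Pi>\<^sub>M i\<in>{..<m n}. Q \<theta>))"
    for n \<theta> and z :: "'d linf_lip10"
  have W_q: "W n \<theta> z \<le> ennreal (norm (z - q \<theta>) + c n)" "ennreal (norm (z - q \<theta>)) \<le> W n \<theta> z + ennreal (c n)"
    and W_shift: "W n \<theta> z \<le> ennreal (norm (z - z')) + W n \<theta> z'"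
    if n: "n \<ge> 1" and \<theta>: "\<theta> \<in> \<Theta>" for n \<theta> z z'
  proof -
    have Q\<theta>: "prob_space (Q \<theta>)" "sets (Q \<theta>) = sets borel" "integrable (Q \<theta>) norm" using Qp[OF \<theta>] by auto
    have m: "m n \<ge> 1" using assms(20)[OF n] .
    note PiM = indep_vars_PiM_coordinates[OF Q\<theta>(1,2) m]
    note Y = measurable_empirical_functional_PiM[OF \<sigma> m Q\<theta>(2)]
    have "(\<integral>\<^sup>+y. ennreal (norm (empirical_functional \<sigma> (m n) y - q \<theta>)) \<partial>(\<Pi>\<^sub>M i\<in>{..<m n}. Q \<theta>))
      \<le> ennreal (1 / sqrt (real (m n))) * (\<integral>\<^sup>+z. ennreal (norm z * root_kernel \<sigma> (Q \<theta>) z) \<partial>lborel)"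
      using nn_integral_norm_empirical_deviation[OF \<sigma> PiM(1) m PiM(2,3) Q\<theta>] by (simp add: q_def)
    also have "\<dots> \<le> ennreal (1 / sqrt (real (m n))) * ennreal C"
      using C(2)[OF \<theta>] by (intro mult_left_mono) auto
    also have "\<dots> = ennreal (c n)" using C(1) by (simp add: ennreal_mult[symmetric] c_def)
    finally have dev: "(\<integral>\<^sup>+y. ennreal (norm (empirical_functional \<sigma> (m n) y - q \<theta>)) \<partial>(\<Pi>\<^sub>M i\<in>{..<m n}. Q \<theta>)) \<le> ennreal (c n)" .
    show shift: "W n \<theta> z \<le> ennreal (norm (z - z')) + W n \<theta> z'" for z z'
      unfolding W_def by (rule nn_integral_norm_shift_le(1)[OF PiM(1) Y])
    have "W n \<theta> (q \<theta>) \<le> ennreal (c n)"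
      using dev unfolding W_def by (simp add: norm_minus_commute)
    then show "W n \<theta> z \<le> ennreal (norm (z - q \<theta>) + c n)"
      using order_trans[OF shift[of z "q \<theta>"] add_left_mono] c0 by (simp add: ennreal_plus)
    show "ennreal (norm (z - q \<theta>)) \<le> W n \<theta> z + ennreal (c n)"
      unfolding W_def by (rule order_trans[OF nn_integral_norm_shift_le(2)[OF PiM(1) Y] add_left_mono[OF dev]])
  qed
  define V where "V n z = enn2real (INF \<theta>\<in>\<Theta>. W n \<theta> z)" for n and z :: "'d linf_lip10"
  have Wfin: "W n \<theta> z < \<infinity>" if "n \<ge> 1" "\<theta> \<in> \<Theta>" for n \<theta> z
    using le_less_trans[OF W_q(1)[OF that]] by simp
  \<comment> \<open>Being Lipschitz in z, the infimum over the uncountable set \<Theta> is Borel,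
    and its composition with the empirical functional is a random variable.\<close>
  have V_lip: "\<bar>V n y - V n z\<bar> \<le> dist y z" if n: "n \<ge> 1" for n y z
  proof -
    have "V n y \<le> V n z + dist y z" for y z
    proof -
      have "V n y \<le> (INF \<theta>\<in>\<Theta>. enn2real (W n \<theta> z)) + dist y z"
        unfolding V_def
      proof (rule enn2real_INF_le[OF ne])
        fix \<theta> assume \<theta>: "\<theta> \<in> \<Theta>"
        show "W n \<theta> y \<le> ennreal (enn2real (W n \<theta> z) + dist y z)"
          using W_shift[OF n \<theta>, of y z] Wfin[OF n \<theta>, of z]
          by (simp add: ennreal_plus dist_norm add.commute less_top)
      qed auto
      moreover have "(INF \<theta>\<in>\<Theta>. enn2real (W n \<theta> z)) \<le> V n z + 0"
        unfolding V_def using Wfin[OF n] by (intro le_enn2real_INF[OF ne]) (auto simp: less_top)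
      ultimately show ?thesis by simp
    qed
    from this[of y z] this[of z y] show ?thesis by (simp add: abs_le_iff dist_commute)
  qed
  have V_close: "\<bar>V n z - (INF \<theta>\<in>\<Theta>. norm (z - q \<theta>))\<bar> \<le> c n" if n: "n \<ge> 1" for n z
  proof -
    have "V n z \<le> (INF \<theta>\<in>\<Theta>. norm (z - q \<theta>)) + c n"
      unfolding V_def by (rule enn2real_INF_le[OF ne W_q(1)[OF n]]) (auto simp: c0)
    moreover have "(INF \<theta>\<in>\<Theta>. norm (z - q \<theta>)) \<le> V n z + c n"
      unfolding V_def by (rule le_enn2real_INF[OF ne W_q(2)[OF n]]) (use c0 Wfin[OF n] in auto)
    ultimately show ?thesis by (simp add: abs_le_iff)
  qed
  define Z where "Z n \<omega> = sqrt (real n) *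
      enn2real (INF \<theta>\<in>\<Theta>. expected_smoothed_wasserstein1 \<sigma> n (\<lambda>i. X i \<omega>) (m n) (Q \<theta>))" for n \<omega>
  have Z_V: "Z n \<omega> = sqrt (real n) * V n (empirical_functional \<sigma> n (\<lambda>i. X i \<omega>))" if n: "n \<ge> 1" for n \<omega>
    unfolding Z_def V_def W_def expected_smoothed_wasserstein1_eq[OF \<sigma> n assms(20)[OF n]] ..
  have Zm: "Z n \<in> borel_measurable \<Omega>" for n
  proof (cases "n \<ge> 1")
    case True
    have "V n \<in> borel_measurable borel"
      by (rule borel_measurable_lipschitz_dist[of _ 1]) (simp add: V_lip[OF True])
    from measurable_compose[OF measurable_empirical_functional[OF \<sigma> True, of X \<Omega>] this]
    have "(\<lambda>\<omega>. sqrt (real n) * V n (empirical_functional \<sigma> n (\<lambda>i. X i \<omega>))) \<in> borel_measurable \<Omega>" by simp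
    then show ?thesis using Z_V[OF True] by (simp cong: measurable_cong)
  next
    \<comment> \<open>For n = 0 the factor sqrt 0 makes the statistic vanish, whatever the infimum
      is.\<close>
    case False
    then have "n = 0" by simp
    then show ?thesis by (simp add: Z_def[abs_def])
  qed
  have Z_close: "\<bar>Z n \<omega> - (INF \<theta>\<in>\<Theta>. norm (E n \<omega> - sqrt (real n) *\<^sub>R (q \<theta> - q \<theta>\<^sub>0)))\<bar> \<le> C * sqrt (real n / real (m n))"
    if n: "n \<ge> 1" for n \<omega>
  proof -
    define z where "z = empirical_functional \<sigma> n (\<lambda>i. X i \<omega>)"
    have "sqrt (real n) * (INF \<theta>\<in>\<Theta>. norm (z - q \<theta>)) = (INF \<theta>\<in>\<Theta>. sqrt (real n) * norm (z - q \<theta>))"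
      using n by (intro mult_cINF[OF ne]) auto
    also have "\<dots> = (INF \<theta>\<in>\<Theta>. norm (E n \<omega> - sqrt (real n) *\<^sub>R (q \<theta> - q \<theta>\<^sub>0)))"
    proof (rule INF_cong[OF refl])
      fix \<theta>
      have "E n \<omega> - sqrt (real n) *\<^sub>R (q \<theta> - q \<theta>\<^sub>0) = sqrt (real n) *\<^sub>R (z - q \<theta>)"
        unfolding E_def empirical_process_def z_def[symmetric] Pq by (simp add: scaleR_diff_right)
      then show "sqrt (real n) * norm (z - q \<theta>) = norm (E n \<omega> - sqrt (real n) *\<^sub>R (q \<theta> - q \<theta>\<^sub>0))"
        by simp
    qed
    finally have eq: "(INF \<theta>\<in>\<Theta>. norm (E n \<omega> - sqrt (real n) *\<^sub>R (q \<theta> - q \<theta>\<^sub>0)))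
      = sqrt (real n) * (INF \<theta>\<in>\<Theta>. norm (z - q \<theta>))" ..
    have "\<bar>Z n \<omega> - sqrt (real n) * (INF \<theta>\<in>\<Theta>. norm (z - q \<theta>))\<bar> = sqrt (real n) * \<bar>V n z - (INF \<theta>\<in>\<Theta>. norm (z - q \<theta>))\<bar>"
      unfolding Z_V[OF n] z_def[symmetric] by (simp add: right_diff_distrib[symmetric] abs_mult)
    also have "\<dots> \<le> sqrt (real n) * c n" using V_close[OF n] by (intro mult_left_mono) auto
    also have "\<dots> = C * sqrt (real n / real (m n))" by (simp add: c_def real_sqrt_divide)
    finally show ?thesis unfolding eq .
  qed

  \<comment> \<open>Local and global behaviour of the model\<close>
  have diff: "\<exists>\<delta>>0. \<forall>\<theta>\<in>\<Theta>. dist \<theta> \<theta>\<^sub>0 < \<delta> \<longrightarrow> norm (q \<theta> - q \<theta>\<^sub>0 - A (\<theta> - \<theta>\<^sub>0)) \<le> \<eta> * norm (\<theta> - \<theta>\<^sub>0)"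
    if \<eta>: "\<eta> > 0" for \<eta>
  proof -
    from landau_o.smallD[OF differentiable \<eta>] obtain \<delta> where \<delta>: "\<delta> > 0"
      "\<And>\<theta>. \<theta> \<in> \<Theta> \<Longrightarrow> \<theta> \<noteq> \<theta>\<^sub>0 \<Longrightarrow> dist \<theta> \<theta>\<^sub>0 < \<delta> \<Longrightarrow> norm (q \<theta> - q \<theta>\<^sub>0 - A (\<theta> - \<theta>\<^sub>0)) \<le> \<eta> * norm (\<theta> - \<theta>\<^sub>0)"
      unfolding eventually_at q_def A_def by auto
    \<comment> \<open>The limit at \<open>\<theta>\<^sub>0\<close> within \<Theta> leaves out the
      point itself, where both sides are 0.\<close>
    have "norm (q \<theta>\<^sub>0 - q \<theta>\<^sub>0 - A (\<theta>\<^sub>0 - \<theta>\<^sub>0)) \<le> \<eta> * norm (\<theta>\<^sub>0 - \<theta>\<^sub>0)"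
      by (simp add: A_def pairing_def)
    then show ?thesis using \<delta> by blast
  qed
  have sep: "\<exists>\<kappa>>0. \<forall>\<theta>\<in>\<Theta>. dist \<theta> \<theta>\<^sub>0 \<ge> \<delta> \<longrightarrow> norm (q \<theta> - q \<theta>\<^sub>0) \<ge> \<kappa>" if "\<delta> > 0" for \<delta>
    unfolding q_def
    by (rule smoothed_functional_separation[OF \<sigma> assms(2) \<theta>0 Qp weakly_continuous _ that])
      (use identifiable assms(6) in auto)
  have expansion: "\<exists>n0. \<forall>n\<ge>n0. \<forall>z. norm z \<le> R \<longrightarrow>
    \<bar>(INF \<theta>\<in>\<Theta>. norm (z - sqrt (real n) *\<^sub>R (q \<theta> - q \<theta>\<^sub>0))) - \<Phi> z\<bar> \<le> e" if "R \<ge> 0" "e > 0" for R e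
    unfolding \<Phi>_def
    by (rule minimum_distance_expansion[OF _ _ assms(5) diff sep that])
      (use linear_pairing nonsingular in \<open>auto simp: A_def[abs_def]\<close>)

  \<comment> \<open>Weak convergence of the rescaled criterion\<close>
  have Ym: "(\<lambda>\<omega>. \<Phi> (G \<omega>)) \<in> borel_measurable N" by (rule measurable_compose[OF Gm \<Phi>m])
  have "weak_conv_m (\<lambda>n. distr \<Omega> borel (Z n)) (distr N borel (\<lambda>\<omega>. \<Phi> (G \<omega>)))"
  proof (rule integral_cts_step_conv_imp_weak_conv)
    show "real_distribution (distr \<Omega> borel (Z n))" for n
      using Zm by (rule \<Omega>.real_distribution_distr)
    show "real_distribution (distr N borel (\<lambda>\<omega>. \<Phi> (G \<omega>)))"
      using Ym by (rule N.real_distribution_distr)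
    fix x y :: real assume xy: "x < y"
    \<comment> \<open>Continuous steps are enough for weak convergence, and they are bounded and
      Lipschitz, as the functional limit theorem demands after composition with
      \<open>\<Phi>\<close>.\<close>
    define h where "h = cts_step x y"
    define L where "L = 1 / (y - x)"
    have L: "L > 0" using xy by (simp add: L_def)
    have h01: "0 \<le> h u" "h u \<le> 1" for u
      using xy by (auto simp: h_def cts_step_def field_simps)
    have h1: "\<bar>h u\<bar> \<le> 1" for u using h01[of u] by simp
    have hlip: "\<bar>h u - h v\<bar> \<le> L * \<bar>u - v\<bar>" for u v
      unfolding h_def L_def by (rule cts_step_lipschitz[OF xy])
    have hm[measurable]: "h \<in> borel_measurable borel"
      by (rule borel_measurable_lipschitz_dist[of _ L]) (simp add: hlip dist_real_def)
    have h\<Phi>: "\<bar>h (\<Phi> u) - h (\<Phi> v)\<bar> \<le> L * dist u v" for u v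
      using order_trans[OF hlip mult_left_mono[OF \<Phi>_lip]] L by simp
    have "(\<lambda>n. \<integral>\<omega>. h (Z (Suc n) \<omega>) \<partial>\<Omega>) \<longlonglongrightarrow> (\<integral>\<omega>. h (\<Phi> (G \<omega>)) \<partial>N)"
    proof (rule LIMSEQ_approx)
      fix e :: real assume e: "0 < e"
      \<comment> \<open>Two errors of size \<open>e1\<close> enter, from the expansion and from the
        sampling; amplified by the slope L of the step they use up half of e. The other half pays
        for the event that the process is large.\<close>
      define e1 where "e1 = e / (4 * L)"
      have e1: "e1 > 0" "L * (2 * e1) = e / 2" using e L by (simp_all add: e1_def)
      obtain R where R: "R > 0" "\<And>n. n \<ge> 1 \<Longrightarrow> measure \<Omega> {\<omega> \<in> space \<Omega>. norm (E n \<omega>) > R} \<le> e / 2"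
        using E_tight[of "e / 2"] e by auto
      obtain n0 where n0: "\<And>n z. n \<ge> n0 \<Longrightarrow> norm z \<le> R \<Longrightarrow>
        \<bar>(INF \<theta>\<in>\<Theta>. norm (z - sqrt (real n) *\<^sub>R (q \<theta> - q \<theta>\<^sub>0))) - \<Phi> z\<bar> \<le> e1"
        using expansion[of R e1] R(1) e1(1) by auto
      have "(\<lambda>n. C * sqrt (real n / real (m n))) \<longlonglongrightarrow> C * sqrt 0"
        by (intro tendsto_intros assms(21))
      then have "\<forall>\<^sub>F n in sequentially. C * sqrt (real n / real (m n)) < e1"
        using e1(1) by (intro order_tendstoD(2)) auto
      then obtain n1 where n1: "\<And>n. n \<ge> n1 \<Longrightarrow> C * sqrt (real n / real (m n)) < e1"
        unfolding eventually_sequentially by blast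
      have close: "\<bar>(\<integral>\<omega>. h (Z n \<omega>) \<partial>\<Omega>) - (\<integral>\<omega>. h (\<Phi> (E n \<omega>)) \<partial>\<Omega>)\<bar> \<le> e"
        if n: "n \<ge> n0" "n \<ge> n1" "n \<ge> 1" for n
      proof -
        \<comment> \<open>The expansion is uniform only on bounded sets of E. On S both values of h
          lie between 0 and 1, so tightness controls its contribution.\<close>
        define S where "S = {\<omega> \<in> space \<Omega>. norm (E n \<omega>) > R}"
        have S: "S \<in> sets \<Omega>"
        proof -
          have "(\<lambda>\<omega>. norm (E n \<omega>)) \<in> borel_measurable \<Omega>"
            by (rule measurable_compose[OF E_measurable[OF n(3)] borel_measurable_continuous_onI])
              (intro continuous_intros)
          then show ?thesis unfolding S_def by measurable
        qed
        have i1: "integrable \<Omega> (\<lambda>\<omega>. h (Z n \<omega>))"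
          by (rule \<Omega>.integrable_const_bound[where B=1]) (use h1 measurable_compose[OF Zm hm] in auto)
        have i2: "integrable \<Omega> (\<lambda>\<omega>. h (\<Phi> (E n \<omega>)))"
          by (rule \<Omega>.integrable_const_bound[where B=1])
            (use h1 measurable_compose[OF measurable_compose[OF E_measurable[OF n(3)] \<Phi>m] hm] in auto)
        have i3: "integrable \<Omega> (\<lambda>\<omega>. e / 2 + indicator S \<omega> :: real)"
          using S by (intro Bochner_Integration.integrable_add integrable_real_indicator)
            (auto simp: \<Omega>.emeasure_eq_measure)
        have "\<bar>\<integral>\<omega>. h (Z n \<omega>) - h (\<Phi> (E n \<omega>)) \<partial>\<Omega>\<bar> \<le> (\<integral>\<omega>. e / 2 + indicator S \<omega> \<partial>\<Omega>)"
        proof (rule abs_integral_le[OF Bochner_Integration.integrable_diff[OF i1 i2] i3])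
          fix \<omega> assume \<omega>: "\<omega> \<in> space \<Omega>"
          show "\<bar>h (Z n \<omega>) - h (\<Phi> (E n \<omega>))\<bar> \<le> e / 2 + indicator S \<omega>"
          proof (cases "\<omega> \<in> S")
            case True
            then show ?thesis
              using h01[of "Z n \<omega>"] h01[of "\<Phi> (E n \<omega>)"] e by (simp add: abs_le_iff)
          next
            case False
            then have "norm (E n \<omega>) \<le> R" using \<omega> by (simp add: S_def)
            from n0[OF n(1) this] Z_close[OF n(3), of \<omega>] n1[OF n(2)]
            have "\<bar>Z n \<omega> - \<Phi> (E n \<omega>)\<bar> \<le> 2 * e1" by linarith
            then have "\<bar>h (Z n \<omega>) - h (\<Phi> (E n \<omega>))\<bar> \<le> L * (2 * e1)"
              using order_trans[OF hlip mult_left_mono] L by (meson less_imp_le)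
            then show ?thesis using False e1(2) by simp
          qed
        qed
        also have "\<dots> = e / 2 + measure \<Omega> S"
          using S by (subst Bochner_Integration.integral_add) (auto simp: \<Omega>.prob_space \<Omega>.emeasure_eq_measure)
        also have "\<dots> \<le> e" using R(2)[OF n(3)] by (simp add: S_def)
        finally show ?thesis using i1 i2 by simp
      qed
      have "\<forall>\<^sub>F n in sequentially. \<bar>(\<integral>\<omega>. h (Z (Suc n) \<omega>) \<partial>\<Omega>) - (\<integral>\<omega>. h (\<Phi> (E (Suc n) \<omega>)) \<partial>\<Omega>)\<bar> \<le> e"
        unfolding eventually_sequentially by (intro exI[of _ "max n0 n1"] allI impI close) auto
      moreover have "(\<lambda>n. \<integral>\<omega>. h (\<Phi> (E (Suc n) \<omega>)) \<partial>\<Omega>) \<longlonglongrightarrow> (\<integral>\<omega>. h (\<Phi> (G \<omega>)) \<partial>N)"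
        by (rule empirical_process_clt[OF assms(26), where H="\<lambda>z. h (\<Phi> z)"]) (rule h\<Phi>, rule h1)
      ultimately show "\<exists>y y'. (\<forall>\<^sub>F n in sequentially. \<bar>(\<integral>\<omega>. h (Z (Suc n) \<omega>) \<partial>\<Omega>) - y n\<bar> \<le> e) \<and>
          \<bar>(\<integral>\<omega>. h (\<Phi> (G \<omega>)) \<partial>N) - y'\<bar> \<le> e \<and> y \<longlonglongrightarrow> y'"
        using e by (intro exI[of _ "\<lambda>n. \<integral>\<omega>. h (\<Phi> (E (Suc n) \<omega>)) \<partial>\<Omega>"]
            exI[of _ "\<integral>\<omega>. h (\<Phi> (G \<omega>)) \<partial>N"] conjI) auto
    qed
    then have "(\<lambda>n. \<integral>\<omega>. h (Z n \<omega>) \<partial>\<Omega>) \<longlonglongrightarrow> (\<integral>\<omega>. h (\<Phi> (G \<omega>)) \<partial>N)"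
      by (rule LIMSEQ_imp_Suc)
    then show "(\<lambda>n. integral\<^sup>L (distr \<Omega> borel (Z n)) (cts_step x y))
      \<longlonglongrightarrow> integral\<^sup>L (distr N borel (\<lambda>\<omega>. \<Phi> (G \<omega>))) (cts_step x y)"
      unfolding h_def[symmetric] by (simp add: integral_distr[OF Zm hm] integral_distr[OF Ym hm])
  qed
  then show ?thesis
    unfolding converges_in_distribution_def using Zm Ym unfolding Z_def[abs_def] \<Phi>_def A_def by blast
qed

end
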